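(* Let $A=(A_1,\dots,A_n)$ be a $C_0$-contraction on a $d$-dimensional Hilbert space $\mathcal V$. Let $\mathfrak J$ be the kernel of the WOT-continuous representation $\Phi_A$ of $\mathfrak L_n$ that it determines. Then $\Phi_A$ is unitarily equivalent to the compression of $\mathfrak L_n$ to a semi-invariant subspace $\mathcal S=\mathcal N_1\ominus\mathcal N_2$ of $\mathcal K_n$, where $\mathcal N_1=\mathfrak L_n[\mathcal S]$ and $\mathcal N_2=\mathcal N_1\ominus\mathcal S$ belong to $\operatorname{Lat}\mathfrak L_n$. Let $\mathcal M=\overline{\mathfrak J\mathcal K_n}$ be the corresponding $\mathfrak L_n$- and $\mathfrak R_n$-invariant subspace associated to $\mathfrak J$. Then there are at most $d$ unit wandering vectors $\zeta_j$, say for $1\le j\le s$ where $s\le d$, with $\mathfrak L_n[\zeta_j]$ pairwise orthogonal, such that $$\mathcal N_1=\sum_{j=1}^{s}{}^{\!\oplus}R_{\zeta_j}\mathcal K_n\qquad\text{and}\qquad\mathcal N_2\supset\sum_{j=1}^{s}{}^{\!\oplus}R_{\zeta_j}\mathcal M.$$ Moreover, the subspaces $\mathcal M_j=R_{\zeta_j}^*\mathcal S$ are $\mathfrak L_n^*$-invariant subspaces of $\mathcal M^\perp$, and $\dim\mathcal M_j\le d$. The contractive $n$-tuples $B_j=(B_{j1},\dots,B_{jn})$ obtained by compression of $L$ to $\mathcal M_j$ have pure rank $1$ and $\ker\Phi_{B_j}\supset\mathfrak J$. There is an isometry $X$ mapping $\mathcal S$ into $\sum_{j=1}^{\oplus s}\mathcal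 M_j$ so that (identifying $A_i$ with the compression of $L_i$ to $\mathcal S$) $$\Bigl(\sum_{j=1}^{s}{}^{\!\oplus}B_{ji}^*\Bigr)X=XA_i^*\qquad\text{for }1\le i\le n.$$ Thus $A^*$ is unitarily equivalent to the restriction of $\sum_{j=1}^{\oplus s}B_j^*$ to an invariant subspace. Consequently, $A_i=X^*\bigl(\sum_{j=1}^{\oplus s}B_{ji}\bigr)X$ for all $i$, so that $A$ is a C*-convex combination of the $B_j$'s. In particular, when $\mathfrak A=\mathcal B(\mathcal V)$, each subspace $\mathcal M_j$ is $d$-dimensional and each $n$-tuple $B_j$ is similar to $A$.
   Context: Fix an integer $n\ge2$ and $d\ge1$. $\mathcal F_n$ is the unital free semigroup on letters $1,\dots,n$ with identity $e$; for an $n$-tuple $T$ and $w=i_1\cdots i_k$, $T_w=T_{i_1}\cdots T_{i_k}$. $\mathcal K_n=\ell^2(\mathcal F_n)$ with orthonormal basis $\{\xi_w\}$; $L_i\xi_w=\xi_{iw}$; $\mathfrak L_n$ is the WOT-closed (weak operator topology) unital algebra generated by $L=(L_1,\dots,L_n)$ and $\mathfrak R_n$ is its commutant. $\mathfrak L_n[\mathcal S]$ is the smallest closed $\mathfrak L_n$-invariant subspace containing $\mathcal S$; $\operatorname{Lat}\mathfrak L_n$ is the lattice of closed invariant subspaces; $\mathfrak L_n^*$ is the algebra of adjoints. $T^{(s)}$ is the direct sum of $s$ copies. An $n$-tuple $A$ on $\mathcal V$ is contractive if $\sum_iA_iA_i^*\le I$; it is a $C_0$-contraction if also $\lim_{k\to\infty}\sum_{|w|=k}A_wA_w^*=0$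 (WOT). $\mathfrak A$ is the unital algebra generated by the $A_i$. The minimal isometric dilation of a contractive $A$ is the (unique up to unitary equivalence fixing $\mathcal V$) $n$-tuple $S$ of isometries with pairwise orthogonal ranges on some $\mathcal H\supseteq\mathcal V$ with $\mathcal V$ invariant for each $S_i^*$, $S_i^*|_{\mathcal V}=A_i^*$ and $\mathcal H$ the closed span of $\{S_w\mathcal V\}$. The pure rank of $A$ is $\dim\operatorname{Ran}(I-\sum_iS_iS_i^* )$. For a $C_0$-contraction $S_i\simeq L_i^{(r)}$ with $r$ the pure rank, and $\Phi_A:\mathfrak L_n\to\mathcal B(\mathcal V)$, $\Phi_A(X)=P_{\mathcal V}X^{(r)}|_{\mathcal V}$, is the associated WOT-continuous unital homomorphism, with $\Phi_A(L_w)=A_w$. A vector $\zeta\in\mathcal K_n$ is wandering (for $L$) if $\{L_w\zeta:w\in\mathcal F_n\}$ is pairwise orthogonal. For a unit wandering vector $\zeta$, $R_\zeta$ is the isometry in $\mathfrak R_n$ given by $R_\zeta\xi_w=L_w\zeta$; its range is $\mathfrak L_n[\zeta]$. A subspace is semi-invariant if it is of the form $\mathcal N_1\ominus\mathcal N_2$ with $\mathcal N_2\subseteq\mathcal N_1$ in $\operatorname{Lat}\mathfrak L_n$; the compression of $\mathfrak L_n$ to $\mathcal S$ is $Y\mapsto P_{\mathcal S}Y|_{\mathcal S}$. $A$ is a C*-convex combination of $B_1,\dots,B_s$ if $A_i=\sum_jX_j^*B_{ji}X_j$ for all $i$ for some operators $X_j$ with $\sum_jX_j^*X_j=I$. Two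 $n$-tuples are similar if they are intertwined entrywise by one invertible operator. *)

theory Defs
  imports "HOL-Analysis.Analysis"
begin

section \<open>Complex Hilbert spaces\<close>

text \<open>The inner product is linear in its first argument.\<close>

class chilbert_space = banach +
  fixes scaleC :: "complex \<Rightarrow> 'a \<Rightarrow> 'a" (infixr \<open>*\<^sub>C\<close> 75)
    and cinner :: "'a \<Rightarrow> 'a \<Rightarrow> complex"
  assumes scaleC_of_real: "of_real r *\<^sub>C x = r *\<^sub>R x"
    and scaleC_add_right: "c *\<^sub>C (x + y) = c *\<^sub>C x + c *\<^sub>C y"
    and scaleC_add_left: "(b + c) *\<^sub>C x = b *\<^sub>C x + c *\<^sub>C x"
    and scaleC_scaleC: "b *\<^sub>C c *\<^sub>C x = (b * c) *\<^sub>C x"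
    and cinner_commute: "cinner x y = cnj (cinner y x)"
    and cinner_add_left: "cinner (x + y) z = cinner x z + cinner y z"
    and cinner_scaleC_left: "cinner (c *\<^sub>C x) y = c * cinner x y"
    and cinner_self: "cinner x x = of_real ((norm x)\<^sup>2)"

lemma scaleC_one [simp]: "1 *\<^sub>C x = (x :: 'a :: chilbert_space)"
  using scaleC_of_real[of 1 x] by simp

global_interpretation cvec: vector_space "scaleC :: complex \<Rightarrow> 'a \<Rightarrow> 'a :: chilbert_space"
  defines cindependent = "cvec.independent"
    and csubspace = "cvec.subspace"
    and cspan = "cvec.span"
  by unfold_locales (auto simp: scaleC_add_right scaleC_add_left scaleC_scaleC)

lemma cinner_add_right: "cinner x (y + z) = cinner x y + cinner x z"
  by (metis cinner_add_left cinner_commute complex_cnj_add)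

lemma cinner_scaleC_right: "cinner x (c *\<^sub>C y) = cnj c * cinner x y"
  by (metis cinner_commute cinner_scaleC_left complex_cnj_mult)

lemma cinner_zero_left [simp]: "cinner 0 x = 0"
  using cinner_add_left[of 0 0 x] by simp

lemma cinner_zero_right [simp]: "cinner x 0 = 0"
  using cinner_add_right[of x 0 0] by simp

lemma norm_scaleC: "norm (c *\<^sub>C x) = norm c * norm x"
proof -
  have "complex_of_real ((norm (c *\<^sub>C x))\<^sup>2) = (c * cnj c) * of_real ((norm x)\<^sup>2)"
    by (simp only: cinner_self[symmetric] cinner_scaleC_left cinner_scaleC_right mult.assoc mult.left_commute[of "cnj c"])
  also have "\<dots> = of_real ((norm c * norm x)\<^sup>2)"
    by (simp only: complex_norm_square[symmetric] of_real_mult[symmetric] power_mult_distrib)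
  finally show ?thesis
    by (simp only: of_real_eq_iff) (simp add: power2_eq_iff_nonneg)
qed

lemma cinner_Cauchy_Schwarz: "norm (cinner x y) \<le> norm x * norm y"
proof (cases "y = 0")
  case False
  define c where "c = cinner x y"
  define t where "t = - c / of_real ((norm y)\<^sup>2)"
  have ny: "norm y \<noteq> 0" using False by simp
  have tt: "t * of_real ((norm y)\<^sup>2) = - c" using ny by (simp add: t_def)
  have yx: "cinner y x = cnj c" unfolding c_def by (rule cinner_commute)
  have "of_real ((norm (x + t *\<^sub>C y))\<^sup>2)
      = cinner x x + t * cinner y x + cnj t * (cinner x y + t * cinner y y)"
    unfolding cinner_self[symmetric, of "x + t *\<^sub>C y"]
      cinner_add_left cinner_add_right cinner_scaleC_left cinner_scaleC_right
    by (simp only: distrib_left ac_simps)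
  also have "\<dots> = of_real ((norm x)\<^sup>2) + t * cnj c"
    unfolding yx cinner_self tt unfolding c_def by simp
  also have "t * cnj c = - (c * cnj c / of_real ((norm y)\<^sup>2))" by (simp add: t_def)
  also have "of_real ((norm x)\<^sup>2) + \<dots> = of_real ((norm x)\<^sup>2 - (norm c)\<^sup>2 / (norm y)\<^sup>2)"
    by (simp only: complex_norm_square[symmetric] of_real_add of_real_minus of_real_divide diff_conv_add_uminus)
  finally have "(norm (x + t *\<^sub>C y))\<^sup>2 = (norm x)\<^sup>2 - (norm c)\<^sup>2 / (norm y)\<^sup>2"
    by (simp only: of_real_eq_iff)
  then have "(norm c)\<^sup>2 / (norm y)\<^sup>2 \<le> (norm x)\<^sup>2"
    by (metis diff_ge_0_iff_ge zero_le_power2)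
  then have "(norm c)\<^sup>2 \<le> (norm x * norm y)\<^sup>2"
    using ny by (simp add: divide_simps power_mult_distrib)
  then show ?thesis unfolding c_def by (rule power2_le_imp_le) simp
qed simp

instantiation complex :: chilbert_space
begin
definition "scaleC_complex = ((*) :: complex \<Rightarrow> complex \<Rightarrow> complex)"
definition "cinner_complex x y = x * cnj (y :: complex)"
instance
  by standard (simp_all add: scaleC_complex_def cinner_complex_def distrib_left distrib_right
      scaleR_conv_of_real mult.commute complex_norm_square del: of_real_power)
end

section \<open>The spaces \<open>\<ell>\<^sup>2(I; H)\<close>\<close>

typedef (overloaded) ('i, 'h) l2 =
  "{f :: 'i \<Rightarrow> 'h::chilbert_space. (\<lambda>i. (norm (f i))\<^sup>2) summable_on UNIV}"
  by (rule exI[of _ "\<lambda>_. 0"]) simp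

setup_lifting type_definition_l2

lemma l2_iff_bound:
  "(\<lambda>i. (norm (f i))\<^sup>2) summable_on UNIV \<longleftrightarrow> (\<exists>C. \<forall>F. finite F \<longrightarrow> (\<Sum>i\<in>F. (norm (f i))\<^sup>2) \<le> C)"
proof
  assume "(\<lambda>i. (norm (f i))\<^sup>2) summable_on UNIV"
  then have "\<forall>F. finite F \<longrightarrow> (\<Sum>i\<in>F. (norm (f i))\<^sup>2) \<le> infsum (\<lambda>i. (norm (f i))\<^sup>2) UNIV"
    by (auto intro: finite_sum_le_infsum)
  then show "\<exists>C. \<forall>F. finite F \<longrightarrow> (\<Sum>i\<in>F. (norm (f i))\<^sup>2) \<le> C" by blast
next
  assume "\<exists>C. \<forall>F. finite F \<longrightarrow> (\<Sum>i\<in>F. (norm (f i))\<^sup>2) \<le> C"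
  then show "(\<lambda>i. (norm (f i))\<^sup>2) summable_on UNIV"
    by (intro nonneg_bdd_above_summable_on) (auto simp: bdd_above_def)
qed

lemma l2_add:
  assumes "(\<lambda>i. (norm (f i))\<^sup>2) summable_on UNIV" "(\<lambda>i. (norm (g i))\<^sup>2) summable_on UNIV"
  shows "(\<lambda>i. (norm (f i + g i))\<^sup>2) summable_on UNIV"
proof -
  have "(norm (f i + g i))\<^sup>2 \<le> 2 * (norm (f i))\<^sup>2 + 2 * (norm (g i))\<^sup>2" for i
  proof -
    have "(norm (f i + g i))\<^sup>2 \<le> (norm (f i) + norm (g i))\<^sup>2"
      by (simp add: norm_triangle_ineq power_mono)
    also have "\<dots> \<le> 2 * (norm (f i))\<^sup>2 + 2 * (norm (g i))\<^sup>2"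
      using sum_squares_bound[of "norm (f i)" "norm (g i)"] by (simp add: power2_sum)
    finally show ?thesis .
  qed
  note le = this
  have "(\<lambda>i. 2 * (norm (f i))\<^sup>2 + 2 * (norm (g i))\<^sup>2) summable_on UNIV"
    by (intro summable_on_add summable_on_cmult_right assms)
  from summable_on_comparison_test[OF this] le show ?thesis by simp
qed

lemma l2_scaleR:
  "(\<lambda>i. (norm (f i))\<^sup>2) summable_on UNIV \<Longrightarrow> (\<lambda>i. (norm (r *\<^sub>R f i))\<^sup>2) summable_on UNIV"
  by (simp add: power_mult_distrib summable_on_cmult_right)

instantiation l2 :: (type, chilbert_space) real_vector
begin
lift_definition zero_l2 :: "('a, 'b) l2" is "\<lambda>_. 0" by simp
lift_definition plus_l2 :: "('a, 'b) l2 \<Rightarrow> ('a, 'b) l2 \<Rightarrow> ('a, 'b) l2" is "\<lambda>f g i. f i + g i"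
  by (rule l2_add)
lift_definition uminus_l2 :: "('a, 'b) l2 \<Rightarrow> ('a, 'b) l2" is "\<lambda>f i. - f i" by simp
lift_definition minus_l2 :: "('a, 'b) l2 \<Rightarrow> ('a, 'b) l2 \<Rightarrow> ('a, 'b) l2" is "\<lambda>f g i. f i - g i"
  subgoal for f g using l2_add[of f "\<lambda>i. - g i"] by simp
  done
lift_definition scaleR_l2 :: "real \<Rightarrow> ('a, 'b) l2 \<Rightarrow> ('a, 'b) l2" is "\<lambda>r f i. r *\<^sub>R f i"
  by (rule l2_scaleR)
instance
  by standard (simp_all add: Rep_l2_inject[symmetric] fun_eq_iff zero_l2.rep_eq plus_l2.rep_eq
      uminus_l2.rep_eq minus_l2.rep_eq scaleR_l2.rep_eq scaleR_add_left scaleR_add_right)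
end

instantiation l2 :: (type, chilbert_space) real_normed_vector
begin
lift_definition norm_l2 :: "('a, 'b) l2 \<Rightarrow> real" is "\<lambda>f. sqrt (\<Sum>\<^sub>\<infinity>i. (norm (f i))\<^sup>2)" .
definition "sgn_l2 x = x /\<^sub>R norm x" for x :: "('a, 'b) l2"
definition "dist_l2 x y = norm (x - y)" for x y :: "('a, 'b) l2"
definition "uniformity_l2 =
  (INF e\<in>{0 <..}. principal {(x :: ('a, 'b) l2, y). dist x y < e})"
definition "open_l2 U \<longleftrightarrow>
  (\<forall>x\<in>U. \<forall>\<^sub>F (x', y) in uniformity. x' = x \<longrightarrow> y \<in> U)" for U :: "('a, 'b) l2 set"

lemma L2_set_le_norm_l2:
  assumes "finite F" shows "L2_set (\<lambda>i. norm (Rep_l2 x i)) F \<le> norm x"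
  using Rep_l2[of x] assms unfolding L2_set_def norm_l2.rep_eq
  by (auto intro!: finite_sum_le_infsum)

lemma norm_l2_le:
  assumes "\<And>F. finite F \<Longrightarrow> L2_set (\<lambda>i. norm (Rep_l2 x i)) F \<le> C"
  shows "norm x \<le> C"
proof -
  have C: "0 \<le> C" using assms[of "{}"] by simp
  have "(\<Sum>i\<in>F. (norm (Rep_l2 x i))\<^sup>2) \<le> C\<^sup>2" if "finite F" for F
    using assms[OF that] C unfolding L2_set_def
    by (metis real_le_rsqrt real_sqrt_le_iff real_sqrt_unique)
  then have "(\<Sum>\<^sub>\<infinity>i. (norm (Rep_l2 x i))\<^sup>2) \<le> C\<^sup>2"
    using Rep_l2[of x] by (auto intro!: infsum_le_finite_sums)
  then show ?thesis unfolding norm_l2.rep_eq using C by (simp add: real_le_lsqrt)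
qed

instance
proof
  fix x y :: "('a, 'b) l2" and r :: real
  show "dist x y = norm (x - y)" by (rule dist_l2_def)
  show "sgn x = x /\<^sub>R norm x" by (rule sgn_l2_def)
  show "uniformity = (INF e\<in>{0 <..}. principal {(x :: ('a, 'b) l2, y). dist x y < e})"
    by (rule uniformity_l2_def)
  show "open U \<longleftrightarrow> (\<forall>x\<in>U. \<forall>\<^sub>F (x', y) in uniformity. x' = x \<longrightarrow> y \<in> U)"
    for U :: "('a, 'b) l2 set" by (rule open_l2_def)
  show "norm x = 0 \<longleftrightarrow> x = 0"
  proof
    assume n: "norm x = 0"
    have "Rep_l2 x i = 0" for i using L2_set_le_norm_l2[of "{i}" x] n by simp
    then show "x = 0" by (intro Rep_l2_inject[THEN iffD1]) (auto simp: zero_l2.rep_eq)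
  next
    assume "x = 0" then show "norm x = 0" by (simp add: norm_l2.rep_eq zero_l2.rep_eq)
  qed
  show "norm (x + y) \<le> norm x + norm y"
  proof (rule norm_l2_le)
    fix F :: "'a set" assume F: "finite F"
    have "L2_set (\<lambda>i. norm (Rep_l2 (x + y) i)) F \<le> L2_set (\<lambda>i. norm (Rep_l2 x i) + norm (Rep_l2 y i)) F"
      by (rule L2_set_mono) (auto simp: plus_l2.rep_eq norm_triangle_ineq)
    also have "\<dots> \<le> norm x + norm y"
      by (rule order_trans[OF L2_set_triangle_ineq]) (intro add_mono L2_set_le_norm_l2 F)
    finally show "L2_set (\<lambda>i. norm (Rep_l2 (x + y) i)) F \<le> norm x + norm y" .
  qed
  show "norm (r *\<^sub>R x) = \<bar>r\<bar> * norm x"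
    by (simp add: norm_l2.rep_eq scaleR_l2.rep_eq power_mult_distrib infsum_cmult_right' real_sqrt_mult)
qed
end

instance l2 :: (type, chilbert_space) banach
proof
  fix X :: "nat \<Rightarrow> ('a, 'b) l2" assume X: "Cauchy X"
  have "Cauchy (\<lambda>m. Rep_l2 (X m) i)" for i
  proof (rule metric_CauchyI)
    fix e :: real assume "e > 0"
    then obtain M where M: "\<forall>m\<ge>M. \<forall>n\<ge>M. dist (X m) (X n) < e" using X metric_CauchyD by blast
    have "dist (Rep_l2 (X m) i) (Rep_l2 (X n) i) \<le> dist (X m) (X n)" for m n
      using L2_set_le_norm_l2[of "{i}" "X m - X n"] by (simp add: dist_norm minus_l2.rep_eq)
    with M show "\<exists>M. \<forall>m\<ge>M. \<forall>n\<ge>M. dist (Rep_l2 (X m) i) (Rep_l2 (X n) i) < e"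
      by (meson le_less_trans)
  qed
  then obtain g where g: "\<And>i. (\<lambda>m. Rep_l2 (X m) i) \<longlonglongrightarrow> g i"
    unfolding Cauchy_convergent_iff convergent_def by metis
  have *: "\<exists>M. \<forall>m\<ge>M. \<forall>F. finite F \<longrightarrow> L2_set (\<lambda>i. norm (Rep_l2 (X m) i - g i)) F \<le> e" if e: "e > 0" for e
  proof -
    obtain M where M: "\<forall>m\<ge>M. \<forall>n\<ge>M. dist (X m) (X n) < e" using X e metric_CauchyD by blast
    have "L2_set (\<lambda>i. norm (Rep_l2 (X m) i - g i)) F \<le> e" if m: "m \<ge> M" and F: "finite F" for m F
    proof (rule LIMSEQ_le_const2)
      show "(\<lambda>n. L2_set (\<lambda>i. norm (Rep_l2 (X m) i - Rep_l2 (X n) i)) F)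
          \<longlonglongrightarrow> L2_set (\<lambda>i. norm (Rep_l2 (X m) i - g i)) F"
        unfolding L2_set_def by (intro tendsto_intros g)
      have "L2_set (\<lambda>i. norm (Rep_l2 (X m) i - Rep_l2 (X n) i)) F \<le> e" if "n \<ge> M" for n
        using L2_set_le_norm_l2[OF F, of "X m - X n"] M m that
        by (fastforce simp: dist_norm minus_l2.rep_eq)
      then show "\<exists>N. \<forall>n\<ge>N. L2_set (\<lambda>i. norm (Rep_l2 (X m) i - Rep_l2 (X n) i)) F \<le> e" by blast
    qed
    then show ?thesis by blast
  qed
  obtain M where M: "\<forall>F. finite F \<longrightarrow> L2_set (\<lambda>i. norm (Rep_l2 (X M) i - g i)) F \<le> 1"
    using *[of 1] by auto
  have "(\<Sum>i\<in>F. (norm (Rep_l2 (X M) i - g i))\<^sup>2) \<le> 1" if "finite F" for F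
    using M that unfolding L2_set_def by (simp add: real_sqrt_le_1_iff)
  then have "(\<lambda>i. (norm (Rep_l2 (X M) i - g i))\<^sup>2) summable_on UNIV"
    unfolding l2_iff_bound[of "\<lambda>i. Rep_l2 (X M) i - g i"] by blast
  then have "(\<lambda>i. (norm (- (Rep_l2 (X M) i - g i)))\<^sup>2) summable_on UNIV"
    unfolding norm_minus_cancel .
  from l2_add[OF _ this, of "Rep_l2 (X M)"] Rep_l2[of "X M"]
  have gl: "(\<lambda>i. (norm (g i))\<^sup>2) summable_on UNIV" by simp
  define y where "y = Abs_l2 g"
  have y: "Rep_l2 y = g" unfolding y_def using gl by (simp add: Abs_l2_inverse)
  have "X \<longlonglongrightarrow> y"
  proof (rule metric_LIMSEQ_I)
    fix e :: real assume e: "e > 0"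
    then obtain M where M: "\<forall>m\<ge>M. \<forall>F. finite F \<longrightarrow> L2_set (\<lambda>i. norm (Rep_l2 (X m) i - g i)) F \<le> e / 2"
      using *[of "e / 2"] by auto
    have "dist (X m) y \<le> e / 2" if "m \<ge> M" for m
      unfolding dist_norm by (rule norm_l2_le) (use M that in \<open>simp add: minus_l2.rep_eq y\<close>)
    then show "\<exists>no. \<forall>n\<ge>no. dist (X n) y < e" using e by (intro exI[of _ M]) fastforce
  qed
  then show "convergent X" by (rule convergentI)
qed

lemma l2_cinner_summable:
  "(\<lambda>i. cinner (Rep_l2 x i) (Rep_l2 y i)) summable_on UNIV"
proof -
  have sum: "(\<lambda>i. (norm (Rep_l2 x i))\<^sup>2 + (norm (Rep_l2 y i))\<^sup>2) summable_on UNIV"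
    using Rep_l2[of x] Rep_l2[of y] by (auto intro: summable_on_add)
  have le: "norm (cinner (Rep_l2 x i) (Rep_l2 y i)) \<le> (norm (Rep_l2 x i))\<^sup>2 + (norm (Rep_l2 y i))\<^sup>2" for i
  proof -
    have "norm (cinner (Rep_l2 x i) (Rep_l2 y i)) \<le> norm (Rep_l2 x i) * norm (Rep_l2 y i)"
      by (rule cinner_Cauchy_Schwarz)
    also have "\<dots> \<le> (norm (Rep_l2 x i))\<^sup>2 + (norm (Rep_l2 y i))\<^sup>2"
      using sum_squares_bound[of "norm (Rep_l2 x i)" "norm (Rep_l2 y i)"]
        mult_nonneg_nonneg[OF norm_ge_zero[of "Rep_l2 x i"] norm_ge_zero[of "Rep_l2 y i"]] by linarith
    finally show ?thesis .
  qed
  have "(\<lambda>i. norm (cinner (Rep_l2 x i) (Rep_l2 y i))) summable_on UNIV"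
    by (rule summable_on_comparison_test[OF sum]) (use le in auto)
  then show ?thesis by (rule abs_summable_summable)
qed

instantiation l2 :: (type, chilbert_space) chilbert_space
begin
lift_definition scaleC_l2 :: "complex \<Rightarrow> ('a, 'b) l2 \<Rightarrow> ('a, 'b) l2" is "\<lambda>c f i. c *\<^sub>C f i"
  by (simp add: norm_scaleC power_mult_distrib summable_on_cmult_right)
lift_definition cinner_l2 :: "('a, 'b) l2 \<Rightarrow> ('a, 'b) l2 \<Rightarrow> complex" is
  "\<lambda>f g. \<Sum>\<^sub>\<infinity>i. cinner (f i) (g i)" .
instance
proof
  fix x y z :: "('a, 'b) l2" and r :: real and b c :: complex
  show "of_real r *\<^sub>C x = r *\<^sub>R x"
    by (intro Rep_l2_inject[THEN iffD1] ext) (simp only: scaleC_l2.rep_eq plus_l2.rep_eq scaleR_l2.rep_eq scaleC_of_real)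
  show "c *\<^sub>C (x + y) = c *\<^sub>C x + c *\<^sub>C y"
    by (intro Rep_l2_inject[THEN iffD1] ext) (simp only: scaleC_l2.rep_eq plus_l2.rep_eq scaleR_l2.rep_eq scaleC_add_right)
  show "(b + c) *\<^sub>C x = b *\<^sub>C x + c *\<^sub>C x"
    by (intro Rep_l2_inject[THEN iffD1] ext) (simp only: scaleC_l2.rep_eq plus_l2.rep_eq scaleR_l2.rep_eq scaleC_add_left)
  show "b *\<^sub>C c *\<^sub>C x = (b * c) *\<^sub>C x"
    by (intro Rep_l2_inject[THEN iffD1] ext) (simp only: scaleC_l2.rep_eq plus_l2.rep_eq scaleR_l2.rep_eq scaleC_scaleC)
  show "cinner x y = cnj (cinner y x)"
    unfolding cinner_l2.rep_eq infsum_cnj[symmetric] by (intro infsum_cong cinner_commute)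
  show "cinner (x + y) z = cinner x z + cinner y z"
    unfolding cinner_l2.rep_eq plus_l2.rep_eq cinner_add_left
    by (intro infsum_add l2_cinner_summable)
  show "cinner (c *\<^sub>C x) y = c * cinner x y"
    unfolding cinner_l2.rep_eq scaleC_l2.rep_eq cinner_scaleC_left by (rule infsum_cmult_right')
  have "0 \<le> (\<Sum>\<^sub>\<infinity>i. (norm (Rep_l2 x i))\<^sup>2)" by (intro infsum_nonneg) simp
  moreover have "(\<Sum>\<^sub>\<infinity>i. of_real ((norm (Rep_l2 x i))\<^sup>2)) = complex_of_real (\<Sum>\<^sub>\<infinity>i. (norm (Rep_l2 x i))\<^sup>2)"
    using Rep_l2[of x] by (intro infsumI has_sum_of_real has_sum_infsum) simp
  ultimately show "cinner x x = of_real ((norm x)\<^sup>2)"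
    unfolding cinner_l2.rep_eq norm_l2.rep_eq cinner_self by simp
qed
end

section \<open>Operators between subspaces\<close>

text \<open>A Hilbert space is given as a closed subspace \<open>V\<close> of a type, and an operator on \<open>V\<close> as a
  function of which only the values on \<open>V\<close> matter.\<close>

definition hilbert_subspace :: "'a::chilbert_space set \<Rightarrow> bool" where
  "hilbert_subspace V \<longleftrightarrow> csubspace V \<and> closed V"

definition has_cdim :: "'a::chilbert_space set \<Rightarrow> nat \<Rightarrow> bool" where
  "has_cdim V d \<longleftrightarrow> (\<exists>B. finite B \<and> cindependent B \<and> cspan B = V \<and> card B = d)"

definition closed_cspan :: "'a::chilbert_space set \<Rightarrow> 'a set" where
  "closed_cspan E = closure (cspan E)"

definition ocompl_in :: "'a::chilbert_space set \<Rightarrow> 'a set \<Rightarrow> 'a set" (infixl \<open>\<ominus>\<close> 65) where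
  "N1 \<ominus> N2 = {x \<in> N1. \<forall>y\<in>N2. cinner x y = 0}"

definition orthogonal_sets :: "'a::chilbert_space set \<Rightarrow> 'a set \<Rightarrow> bool" where
  "orthogonal_sets E F \<longleftrightarrow> (\<forall>x\<in>E. \<forall>y\<in>F. cinner x y = 0)"

definition sum_sets :: "'j set \<Rightarrow> ('j \<Rightarrow> 'a::comm_monoid_add set) \<Rightarrow> 'a set" where
  "sum_sets I F = {\<Sum>j\<in>I. x j |x. \<forall>j\<in>I. x j \<in> F j}"

definition bounded_ops :: "'a::chilbert_space set \<Rightarrow> 'b::chilbert_space set \<Rightarrow> ('a \<Rightarrow> 'b) set" where
  "bounded_ops V W = {T. T ` V \<subseteq> W
     \<and> (\<forall>x\<in>V. \<forall>y\<in>V. T (x + y) = T x + T y)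
     \<and> (\<forall>c. \<forall>x\<in>V. T (c *\<^sub>C x) = c *\<^sub>C T x)
     \<and> (\<exists>K. \<forall>x\<in>V. norm (T x) \<le> K * norm x)}"

definition isometry_on :: "'a::chilbert_space set \<Rightarrow> 'b::chilbert_space set \<Rightarrow> ('a \<Rightarrow> 'b) \<Rightarrow> bool" where
  "isometry_on V W T \<longleftrightarrow> T \<in> bounded_ops V W \<and> (\<forall>x\<in>V. norm (T x) = norm x)"

definition unitary_on :: "'a::chilbert_space set \<Rightarrow> 'b::chilbert_space set \<Rightarrow> ('a \<Rightarrow> 'b) \<Rightarrow> bool" where
  "unitary_on V W T \<longleftrightarrow> isometry_on V W T \<and> T ` V = W"

text \<open>The adjoint of an operator \<open>T\<close> from \<open>V\<close> to \<open>W\<close>. It depends on the domain \<open>V\<close> but not on the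
  codomain, since the inner product of \<open>W\<close> is that of the surrounding type.\<close>

definition adj :: "'a::chilbert_space set \<Rightarrow> ('a \<Rightarrow> 'b::chilbert_space) \<Rightarrow> 'b \<Rightarrow> 'a" where
  "adj V T y = (THE x. x \<in> V \<and> (\<forall>v\<in>V. cinner (T v) y = cinner v x))"

definition proj :: "'a::chilbert_space set \<Rightarrow> 'a \<Rightarrow> 'a" where
  "proj M x = (THE y. y \<in> M \<and> (\<forall>z\<in>M. cinner (x - y) z = 0))"

definition compression :: "'a::chilbert_space set \<Rightarrow> ('a \<Rightarrow> 'a) \<Rightarrow> 'a \<Rightarrow> 'a" where
  "compression M T x = proj M (T x)"

definition op_le :: "'a::chilbert_space set \<Rightarrow> ('a \<Rightarrow> 'a) \<Rightarrow> ('a \<Rightarrow> 'a) \<Rightarrow> bool" where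
  "op_le V S T \<longleftrightarrow> (\<forall>x\<in>V. cinner (T x - S x) x \<in> \<real>\<^sub>\<ge>\<^sub>0)"

text \<open>The weak operator topology on \<open>\<B>(V)\<close>.\<close>

definition wot :: "'a::chilbert_space set \<Rightarrow> ('a \<Rightarrow> 'a) topology" where
  "wot V = pullback_topology (bounded_ops V V)
     (\<lambda>T. restrict (\<lambda>(x, y). cinner (T x) y) (V \<times> V))
     (product_topology (\<lambda>_. euclidean) (V \<times> V))"

definition unital_algebra :: "'a::chilbert_space set \<Rightarrow> ('a \<Rightarrow> 'a) set \<Rightarrow> bool" where
  "unital_algebra V \<A> \<longleftrightarrow> \<A> \<subseteq> bounded_ops V V \<and> id \<in> \<A>
     \<and> (\<forall>S\<in>\<A>. \<forall>T\<in>\<A>. (\<lambda>x. S x + T x) \<in> \<A> \<and> S \<circ> T \<in> \<A>)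
     \<and> (\<forall>c. \<forall>T\<in>\<A>. (\<lambda>x. c *\<^sub>C T x) \<in> \<A>)"

definition gen_algebra :: "'a::chilbert_space set \<Rightarrow> ('n \<Rightarrow> 'a \<Rightarrow> 'a) \<Rightarrow> ('a \<Rightarrow> 'a) set" where
  "gen_algebra V A = \<Inter>{\<A>. unital_algebra V \<A> \<and> range A \<subseteq> \<A>}"

text \<open>Hilbert space direct sums over an index set \<open>I\<close> are realised inside \<open>\<ell>\<^sup>2\<close> as the elements
  supported on \<open>I\<close>; the sum of operators is only used for finite \<open>I\<close>.\<close>

definition hsum :: "'j set \<Rightarrow> ('j \<Rightarrow> 'a::chilbert_space set) \<Rightarrow> ('j, 'a) l2 set" where
  "hsum I M = {f. \<forall>j. if j \<in> I then Rep_l2 f j \<in> M j else Rep_l2 f j = 0}"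

definition hsum_op ::
    "'j set \<Rightarrow> ('j \<Rightarrow> 'a::chilbert_space \<Rightarrow> 'b::chilbert_space) \<Rightarrow> ('j, 'a) l2 \<Rightarrow> ('j, 'b) l2" where
  "hsum_op I T f = Abs_l2 (\<lambda>j. if j \<in> I then T j (Rep_l2 f j) else 0)"

section \<open>Tuples of operators and dilations\<close>

text \<open>An \<open>n\<close>-tuple is indexed by a finite type \<open>'n\<close> with \<open>n = CARD('n)\<close>; the free semigroup on
  \<open>n\<close> letters is \<open>'n list\<close>.\<close>

definition word_op :: "('n \<Rightarrow> 'a \<Rightarrow> 'a) \<Rightarrow> 'n list \<Rightarrow> 'a \<Rightarrow> 'a" where
  "word_op T w = foldr (\<lambda>i S. T i \<circ> S) w id"

definition contractive :: "'v::chilbert_space set \<Rightarrow> ('n::finite \<Rightarrow> 'v \<Rightarrow> 'v) \<Rightarrow> bool" where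
  "contractive V A \<longleftrightarrow> hilbert_subspace V \<and> (\<forall>i. A i \<in> bounded_ops V V)
     \<and> op_le V (\<lambda>x. \<Sum>i\<in>UNIV. A i (adj V (A i) x)) id"

definition C0_contraction :: "'v::chilbert_space set \<Rightarrow> ('n::finite \<Rightarrow> 'v \<Rightarrow> 'v) \<Rightarrow> bool" where
  "C0_contraction V A \<longleftrightarrow> contractive V A
     \<and> limitin (wot V)
         (\<lambda>k x. \<Sum>w\<in>{w. length w = k}. word_op A w (adj V (word_op A w) x)) (\<lambda>_. 0) sequentially"

text \<open>\<open>S\<close> on \<open>H\<close> is a minimal isometric dilation of \<open>A\<close> on \<open>V\<close>, where \<open>V\<close> is identified with a
  subspace of \<open>H\<close> by the isometry \<open>J\<close>.\<close>

definition min_isom_dilation ::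
    "'v::chilbert_space set \<Rightarrow> ('n::finite \<Rightarrow> 'v \<Rightarrow> 'v) \<Rightarrow>
     'h::chilbert_space set \<Rightarrow> ('n \<Rightarrow> 'h \<Rightarrow> 'h) \<Rightarrow> ('v \<Rightarrow> 'h) \<Rightarrow> bool" where
  "min_isom_dilation V A H S J \<longleftrightarrow>
     hilbert_subspace H \<and> (\<forall>i. isometry_on H H (S i))
     \<and> (\<forall>i j. i \<noteq> j \<longrightarrow> orthogonal_sets (S i ` H) (S j ` H))
     \<and> isometry_on V H J
     \<and> (\<forall>i. \<forall>v\<in>V. adj H (S i) (J v) = J (adj V (A i) v))
     \<and> closed_cspan {word_op S w (J v) |w v. v \<in> V} = H"

section \<open>The left regular representation\<close>

type_synonym 'n fock = "('n list, complex) l2"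

lift_definition \<xi> :: "'n list \<Rightarrow> 'n fock" is "\<lambda>w u. if u = w then 1 else 0"
proof -
  fix w :: "'n list"
  have "(\<lambda>u. (norm (if u = w then 1 else 0 :: complex))\<^sup>2) summable_on {w}" by simp
  then show "(\<lambda>u. (norm (if u = w then 1 else 0 :: complex))\<^sup>2) summable_on UNIV"
    by (subst summable_on_cong_neutral[where T = "{w}"]) auto
qed

lift_definition L_op :: "'n \<Rightarrow> 'n fock \<Rightarrow> 'n fock" is
  "\<lambda>i f u. case u of [] \<Rightarrow> 0 | j # v \<Rightarrow> if j = i then f v else 0"
proof -
  fix i :: 'n and f :: "'n list \<Rightarrow> complex"
  assume f: "(\<lambda>w. (norm (f w))\<^sup>2) summable_on UNIV"
  let ?g = "\<lambda>u. (norm (case u of [] \<Rightarrow> 0 | j # v \<Rightarrow> if j = i then f v else 0))\<^sup>2"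
  have "?g \<circ> (#) i = (\<lambda>w. (norm (f w))\<^sup>2)" by auto
  with f have "?g summable_on range ((#) i)" by (subst summable_on_reindex) auto
  then show "?g summable_on UNIV"
    by (subst summable_on_cong_neutral[where T = "range ((#) i)"]) (auto split: list.splits)
qed

lemma L_op_xi: "L_op i (\<xi> w) = \<xi> (i # w)"
  by (intro Rep_l2_inject[THEN iffD1]) (auto simp: L_op.rep_eq \<xi>.rep_eq split: list.splits)

definition L_alg :: "('n fock \<Rightarrow> 'n fock) set" where
  "L_alg = \<Inter>{\<A>. unital_algebra UNIV \<A> \<and> range L_op \<subseteq> \<A> \<and> closedin (wot UNIV) \<A>}"

definition R_alg :: "('n fock \<Rightarrow> 'n fock) set" where
  "R_alg = {T \<in> bounded_ops UNIV UNIV. \<forall>X\<in>L_alg. T \<circ> X = X \<circ> T}"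

definition Lat_L :: "'n fock set set" where
  "Lat_L = {N. hilbert_subspace N \<and> (\<forall>X\<in>L_alg. X ` N \<subseteq> N)}"

definition L_gen :: "'n fock set \<Rightarrow> 'n fock set" where
  "L_gen E = \<Inter>{N \<in> Lat_L. E \<subseteq> N}"

definition wandering :: "'n fock \<Rightarrow> bool" where
  "wandering \<zeta> \<longleftrightarrow> (\<forall>u w. u \<noteq> w \<longrightarrow> cinner (word_op L_op u \<zeta>) (word_op L_op w \<zeta>) = 0)"

definition R_op :: "'n fock \<Rightarrow> 'n fock \<Rightarrow> 'n fock" where
  "R_op \<zeta> = (THE R. R \<in> R_alg \<and> isometry_on UNIV UNIV R \<and> (\<forall>w. R (\<xi> w) = word_op L_op w \<zeta>))"

section \<open>Pure rank and the representation of a \<open>C\<^sub>0\<close>-contraction\<close>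

text \<open>The minimal isometric dilation is unique up to unitary equivalence, and for separable \<open>V\<close> its
  space is separable, hence realisable as a closed subspace of any separable infinite-dimensional
  Hilbert space; the space used here is a direct sum of countably many copies of \<open>'n fock\<close>.\<close>

definition has_pure_rank :: "'v::chilbert_space set \<Rightarrow> ('n::finite \<Rightarrow> 'v \<Rightarrow> 'v) \<Rightarrow> nat \<Rightarrow> bool" where
  "has_pure_rank V A r \<longleftrightarrow> (\<exists>(H :: (nat, 'n fock) l2 set) S J. min_isom_dilation V A H S J
     \<and> has_cdim ((\<lambda>x. x - (\<Sum>i\<in>UNIV. S i (adj H (S i) x))) ` H) r)"

definition fock_sum :: "nat \<Rightarrow> (nat, 'n fock) l2 set" where
  "fock_sum r = hsum {1..r} (\<lambda>_. UNIV)"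

definition ampl :: "nat \<Rightarrow> ('n fock \<Rightarrow> 'n fock) \<Rightarrow> (nat, 'n fock) l2 \<Rightarrow> (nat, 'n fock) l2" where
  "ampl r X = hsum_op {1..r} (\<lambda>_. X)"

text \<open>For a \<open>C\<^sub>0\<close>-contraction of finite pure rank \<open>r\<close>, the minimal isometric dilation is
  \<open>L\<close> amplified to \<open>r\<close> copies. With \<open>V\<close> embedded by \<open>J\<close>, the compression of the amplification of
  \<open>X\<close> to \<open>V\<close> is \<open>J\<^sup>* X\<^sup>(\<^sup>r\<^sup>) J\<close>; it does not depend on the choice of \<open>J\<close>.\<close>

definition Phi :: "'v::chilbert_space set \<Rightarrow> ('n::finite \<Rightarrow> 'v \<Rightarrow> 'v) \<Rightarrow>
    ('n fock \<Rightarrow> 'n fock) \<Rightarrow> 'v \<Rightarrow> 'v" where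
  "Phi V A = (let (r, J) = (SOME (r, J). min_isom_dilation V A (fock_sum r) (\<lambda>i. ampl r (L_op i)) J)
     in (\<lambda>X v. adj V J (ampl r X (J v))))"

definition ker_Phi :: "'v::chilbert_space set \<Rightarrow> ('n::finite \<Rightarrow> 'v \<Rightarrow> 'v) \<Rightarrow> ('n fock \<Rightarrow> 'n fock) set" where
  "ker_Phi V A = {X \<in> L_alg. \<forall>v\<in>V. Phi V A X v = 0}"

section \<open>C*-convex combinations and similarity\<close>

definition cstar_convex_comb ::
    "'v::chilbert_space set \<Rightarrow> ('n \<Rightarrow> 'v \<Rightarrow> 'v) \<Rightarrow>
     'j set \<Rightarrow> ('j \<Rightarrow> 'w::chilbert_space set) \<Rightarrow> ('j \<Rightarrow> 'n \<Rightarrow> 'w \<Rightarrow> 'w) \<Rightarrow> bool" where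
  "cstar_convex_comb V A I W B \<longleftrightarrow> (\<exists>X. (\<forall>j\<in>I. X j \<in> bounded_ops V (W j))
     \<and> (\<forall>v\<in>V. (\<Sum>j\<in>I. adj V (X j) (X j v)) = v)
     \<and> (\<forall>i. \<forall>v\<in>V. A i v = (\<Sum>j\<in>I. adj V (X j) (B j i (X j v)))))"

definition similar_tuples ::
    "'v::chilbert_space set \<Rightarrow> ('n \<Rightarrow> 'v \<Rightarrow> 'v) \<Rightarrow> 'w::chilbert_space set \<Rightarrow> ('n \<Rightarrow> 'w \<Rightarrow> 'w) \<Rightarrow> bool" where
  "similar_tuples V A W B \<longleftrightarrow> (\<exists>T T'. T \<in> bounded_ops V W \<and> T' \<in> bounded_ops W V
     \<and> (\<forall>v\<in>V. T' (T v) = v) \<and> (\<forall>w\<in>W. T (T' w) = w)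
     \<and> (\<forall>i. \<forall>v\<in>V. T (A i v) = B i (T v)))"

end

theory Submission
  imports Defs "HOL-Library.Sublist"
begin

text \<open>
  The minimal isometric dilation of \<open>A\<close> is an amplification \<open>L\<^sup>(\<^sup>r\<^sup>)\<close>, with \<open>V\<close> embedded by an isometry
  \<open>J\<close> as a co-invariant subspace. Minimality says that the vacuum components of \<open>J v\<close> fill \<open>\<complex>\<^sup>r\<close>, so
  \<open>r \<le> d\<close>. Since \<open>n \<ge> 2\<close>, there are \<open>r\<close> words no two of which are right factors of a common word;
  the corresponding right multiplications \<open>R\<^sub>j\<close> commute with \<open>L\<close> and have orthogonal ranges, so
  \<open>\<Psi> f = \<Sum>\<^sub>j R\<^sub>j f\<^sub>j\<close> moves the amplification into one copy of the Fock space. Thus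
  \<open>N1 = \<Psi> \<K>\<^sup>(\<^sup>r\<^sup>)\<close> and \<open>\<S> = \<Psi> J V\<close>, and \<open>\<M>\<^sub>j = R\<^sub>j\<^sup>* \<S>\<close> is the set of \<open>j\<close>-th components of the
  vectors \<open>J v\<close>. Everything that concerns all of \<open>\<LL>\<^sub>n\<close> follows from the fact that invariance of a closed
  subspace of an amplification under the generators passes to the WOT-closed algebra. If the \<open>A\<^sub>i\<close>
  generate \<open>\<B>(V)\<close>, the kernel of \<open>v \<mapsto> (J v)\<^sub>j\<close> is a proper subspace invariant under all adjoints, hence
  zero, and the adjoint of this map is the similarity.
\<close>

section \<open>Geometry of Hilbert spaces\<close>

text \<open>\<open>Phi\<close> rests on a choice of dilation about which nothing is known beyond its
  defining properties. So the model is built from the very \<open>J\<close> that was chosen, and the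
  kernels for A and for the \<open>B j\<close>, which come from unrelated choices, have to be
  compared through a joint graph of two embeddings. The work is done on the adjoint side, where
  projections disappear: the adjoint of X in \<open>L_alg\<close> sends the components of
  \<open>J v\<close> to the components of \<open>J t\<close>, with one t in V for all components.
  Hence X lies in the kernel exactly when its adjoint kills every component of every
  \<open>J v\<close>. The orthogonality of the \<open>M j\<close> to the range space of the kernel
  and the inclusion of the kernels are both read off from this. Finite dimension enters through the
  defect form: a finite family orthonormal for it replaces the square root of the defect operator,
  and its length supplies the multiplicity r. It also keeps images of linear maps closed.\<close>

lemma hilbert_subspaceD:
  assumes "hilbert_subspace V"
  shows "csubspace V" "closed V" "0 \<in> V"
    and "\<And>x y. x \<in> V \<Longrightarrow> y \<in> V \<Longrightarrow> x + y \<in> V"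
    and "\<And>x y. x \<in> V \<Longrightarrow> y \<in> V \<Longrightarrow> x - y \<in> V"
    and "\<And>c x. x \<in> V \<Longrightarrow> c *\<^sub>C x \<in> V"
  using assms by (auto simp: hilbert_subspace_def cvec.subspace_0 cvec.subspace_add cvec.subspace_diff
      cvec.subspace_scale)

lemma scaleC_minus_one: "(- 1) *\<^sub>C x = - (x :: 'a :: chilbert_space)"
  by (simp add: cvec.scale_minus_left)

lemma scaleC_zero [simp]: "0 *\<^sub>C x = (0 :: 'a :: chilbert_space)" "c *\<^sub>C (0 :: 'a :: chilbert_space) = 0"
  by (simp_all add: cvec.scale_zero_left cvec.scale_zero_right)

lemma scaleR_eq_scaleC: "r *\<^sub>R x = of_real r *\<^sub>C (x :: 'a :: chilbert_space)"
  by (simp add: scaleC_of_real)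

lemma cinner_minus_left: "cinner (- x) y = - cinner x y"
  by (metis cinner_scaleC_left mult_minus1 scaleC_minus_one)

lemma cinner_minus_right: "cinner x (- y) = - cinner x y"
  by (metis cinner_minus_left cinner_commute complex_cnj_minus)

lemma cinner_diff_left: "cinner (x - y) z = cinner x z - cinner y z"
  by (metis cinner_add_left cinner_minus_left diff_conv_add_uminus)

lemma cinner_diff_right: "cinner x (y - z) = cinner x y - cinner x z"
  by (metis cinner_add_right cinner_minus_right diff_conv_add_uminus)

lemma cinner_sum_left: "cinner (sum f I) y = (\<Sum>i\<in>I. cinner (f i) y)"
  by (induction I rule: infinite_finite_induct) (auto simp: cinner_add_left)

lemma cinner_sum_right: "cinner x (sum f I) = (\<Sum>i\<in>I. cinner x (f i))"
  by (induction I rule: infinite_finite_induct) (auto simp: cinner_add_right)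

lemma cinner_eq_zero_iff [simp]: "cinner x x = 0 \<longleftrightarrow> x = 0"
  by (simp add: cinner_self)

lemma cinner_eq_zero_commute: "cinner x y = 0 \<Longrightarrow> cinner y x = 0"
  by (metis cinner_commute complex_cnj_zero)

lemma Re_cinner_self: "Re (cinner x x) = (norm x)\<^sup>2"
  by (simp add: cinner_self del: of_real_power)

lemma cinner_eqI:
  assumes "hilbert_subspace V" "x \<in> V" "y \<in> V" "\<And>z. z \<in> V \<Longrightarrow> cinner x z = cinner y z"
  shows "x = y"
proof -
  have "cinner (x - y) (x - y) = 0"
    using assms hilbert_subspaceD(5)[OF assms(1-3)] by (simp add: cinner_diff_left)
  then show ?thesis by simp
qed

lemma bounded_bilinear_cinner: "bounded_bilinear (cinner :: 'a::chilbert_space \<Rightarrow> 'a \<Rightarrow> complex)"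
proof
  show "\<exists>K. \<forall>a b. norm (cinner (a::'a) b) \<le> norm a * norm b * K"
    by (intro exI[of _ 1]) (auto simp: cinner_Cauchy_Schwarz)
qed (auto simp: cinner_add_left cinner_add_right cinner_scaleC_left cinner_scaleC_right
    scaleR_eq_scaleC scaleC_complex_def)

lemma closed_cinner_eq: "closed {x. cinner x y = c}"
proof -
  have "continuous_on UNIV (\<lambda>x. cinner x y)"
    by (intro bounded_bilinear.continuous_on[OF bounded_bilinear_cinner] continuous_intros)
  from continuous_closed_preimage_constant[OF this, of c] show ?thesis by simp
qed

lemma norm_add_square:
  "(norm (x + y))\<^sup>2 = (norm x)\<^sup>2 + (norm y)\<^sup>2 + 2 * Re (cinner x (y :: 'a :: chilbert_space))"
proof -
  have "Re (cinner y x) = Re (cinner x y)" by (subst cinner_commute) simp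
  then show ?thesis by (simp add: Re_cinner_self[symmetric] cinner_add_left cinner_add_right)
qed

lemma parallelogram:
  "(norm (x + y))\<^sup>2 + (norm (x - y))\<^sup>2 = 2 * (norm x)\<^sup>2 + 2 * (norm (y :: 'a :: chilbert_space))\<^sup>2"
  using norm_add_square[of x y] norm_add_square[of x "- y"] by (simp add: cinner_minus_right)

text \<open>Only norms occur on the right, so a norm-preserving linear map also preserves inner
  products. The imaginary part comes from
  \<open>cinner x (\<i> *\<^sub>C y) = - \<i> * cinner x y\<close>.\<close>

lemma polarization:
  "cinner x y = complex_of_real (((norm (x + y))\<^sup>2 - (norm x)\<^sup>2 - (norm y)\<^sup>2) / 2)
    + \<i> * complex_of_real (((norm (x + \<i> *\<^sub>C y))\<^sup>2 - (norm x)\<^sup>2 - (norm (\<i> *\<^sub>C y))\<^sup>2) / 2)"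
proof -
  have "cinner x (\<i> *\<^sub>C y) = - \<i> * cinner x y" by (simp add: cinner_scaleC_right)
  then show ?thesis unfolding norm_add_square by (simp add: complex_eq_iff)
qed

lemma csubspace_ortho: "csubspace {x. \<forall>y\<in>E. cinner x y = 0}"
  by (auto simp: cvec.subspace_def cinner_add_left cinner_scaleC_left)

lemma hilbert_subspace_ortho: "hilbert_subspace {x. \<forall>y\<in>E. cinner x y = 0}"
proof -
  have "{x. \<forall>y\<in>E. cinner x y = 0} = (\<Inter>y\<in>E. {x. cinner x y = 0})" by auto
  then have "closed {x. \<forall>y\<in>E. cinner x y = 0}" by (simp add: closed_INT closed_cinner_eq)
  then show ?thesis by (simp add: hilbert_subspace_def csubspace_ortho)
qed

lemma hilbert_subspace_Int: "hilbert_subspace V \<Longrightarrow> hilbert_subspace W \<Longrightarrow> hilbert_subspace (V \<inter> W)"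
  by (auto simp: hilbert_subspace_def cvec.subspace_inter)

lemma hilbert_subspace_UNIV [simp]: "hilbert_subspace UNIV"
  by (simp add: hilbert_subspace_def)

lemma hilbert_subspace_ocompl: "hilbert_subspace V \<Longrightarrow> hilbert_subspace (V \<ominus> W)"
  using hilbert_subspace_Int[of V, OF _ hilbert_subspace_ortho[of W]]
  by (simp add: ocompl_in_def Int_def)

text \<open>A minimising sequence for the distance to a closed subspace is Cauchy by the parallelogram
  law.\<close>

lemma nearest_point:
  assumes V: "hilbert_subspace V"
  shows "\<exists>y\<in>V. \<forall>z\<in>V. norm (x - y) \<le> norm (x - z)"
proof -
  define \<delta> where "\<delta> = (INF z\<in>V. norm (x - z))"
  have ne: "V \<noteq> {}" using hilbert_subspaceD(3)[OF V] by auto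
  have bdd: "bdd_below ((\<lambda>z. norm (x - z)) ` V)" by (auto intro!: bdd_belowI[of _ 0])
  have lb: "\<delta> \<le> norm (x - z)" if "z \<in> V" for z
    unfolding \<delta>_def by (rule cINF_lower[OF bdd that])
  have \<delta>0: "\<delta> \<ge> 0" unfolding \<delta>_def by (rule cINF_greatest[OF ne]) simp
  have "\<exists>z\<in>V. norm (x - z) < \<delta> + 1 / Suc n" for n
    using cINF_less_iff[OF ne bdd, of "\<delta> + 1 / Suc n"] unfolding \<delta>_def by auto
  then obtain z where z: "\<And>n. z n \<in> V" "\<And>n. norm (x - z n) < \<delta> + 1 / Suc n" by metis
  \<comment> \<open>The factor is twice 2 * \<delta> + 1, the coarse coefficient in the bound of
    (\<delta> + 1 / Suc n)^2 by \<delta>^2 plus an error. The midpoint lies in V, so the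
    parallelogram law subtracts at least 4 * \<delta>^2.\<close>
  have est: "(norm (z m - z n))\<^sup>2 \<le> (4 * \<delta> + 2) * (1 / Suc m + 1 / Suc n)" for m n
  proof -
    have mid: "(1/2) *\<^sub>R (z m + z n) \<in> V"
      using z V by (simp add: hilbert_subspaceD scaleR_eq_scaleC)
    have "(x - z m) + (x - z n) = 2 *\<^sub>R (x - (1/2) *\<^sub>R (z m + z n))"
      by (simp add: scaleR_diff_right scaleR_2)
    then have "norm ((x - z m) + (x - z n)) = 2 * norm (x - (1/2) *\<^sub>R (z m + z n))"
      by simp
    then have 1: "norm ((x - z m) + (x - z n)) \<ge> 2 * \<delta>" using lb[OF mid] by simp
    have 2: "(norm (x - z n))\<^sup>2 \<le> \<delta>\<^sup>2 + (2 * \<delta> + 1) * (1 / Suc n)" for n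
    proof -
      have "(norm (x - z n))\<^sup>2 \<le> (\<delta> + 1 / Suc n)\<^sup>2" using z(2)[of n] by (intro power_mono) auto
      also have "\<dots> = \<delta>\<^sup>2 + 2 * \<delta> * (1 / Suc n) + (1 / Suc n) * (1 / Suc n)"
        by (simp add: power2_eq_square algebra_simps)
      also have "(1 / real (Suc n)) * (1 / Suc n) \<le> 1 * (1 / Suc n)"
        by (intro mult_right_mono) auto
      finally show ?thesis by (simp add: algebra_simps)
    qed
    have "(2 * \<delta>)\<^sup>2 \<le> (norm ((x - z m) + (x - z n)))\<^sup>2" using 1 \<delta>0 by (intro power_mono) auto
    moreover have "norm ((x - z m) - (x - z n)) = norm (z m - z n)"
      by (simp add: norm_minus_commute)
    ultimately have "(norm (z m - z n))\<^sup>2 \<le> 2 * (norm (x - z m))\<^sup>2 + 2 * (norm (x - z n))\<^sup>2 - 4 * \<delta>\<^sup>2"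
      using parallelogram[of "x - z m" "x - z n"] by (simp add: power_mult_distrib)
    then have "(norm (z m - z n))\<^sup>2 \<le> 2 * ((2 * \<delta> + 1) * (1 / Suc m)) + 2 * ((2 * \<delta> + 1) * (1 / Suc n))"
      using 2[of m] 2[of n] by linarith
    also have "\<dots> = (4 * \<delta> + 2) * (1 / Suc m + 1 / Suc n)" by (simp only: distrib_left) algebra
    finally show ?thesis .
  qed
  have "Cauchy z"
  proof (rule CauchyI)
    fix e :: real assume e: "e > 0"
    have c: "4 * \<delta> + 2 > 0" using \<delta>0 by simp
    obtain N where N: "1 / real (Suc N) < e\<^sup>2 / (2 * (4 * \<delta> + 2))"
      using nat_approx_posE[of "e\<^sup>2 / (2 * (4 * \<delta> + 2))"] e c by auto
    have "norm (z m - z n) < e" if "m \<ge> N" "n \<ge> N" for m n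
    proof -
      have "1 / real (Suc m) \<le> 1 / Suc N" "1 / real (Suc n) \<le> 1 / Suc N"
        using that by (auto simp: frac_le)
      then have "1 / real (Suc m) + 1 / real (Suc n) < e\<^sup>2 / (4 * \<delta> + 2)" using N
        by (simp only: divide_divide_eq_left[symmetric])
      then have "(4 * \<delta> + 2) * (1 / real (Suc m) + 1 / real (Suc n)) < e\<^sup>2"
        using c by (simp add: pos_less_divide_eq mult.commute)
      then have "(norm (z m - z n))\<^sup>2 < e\<^sup>2" using est[of m n] by linarith
      then show ?thesis using e by (simp add: power_less_imp_less_base)
    qed
    then show "\<exists>M. \<forall>m\<ge>M. \<forall>n\<ge>M. norm (z m - z n) < e" by blast
  qed
  then obtain y where y: "z \<longlonglongrightarrow> y" using Cauchy_convergent_iff convergent_def by blast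
  have "y \<in> V" using closed_sequentially[OF hilbert_subspaceD(2)[OF V] _ y] z by blast
  moreover have "norm (x - y) \<le> \<delta>"
  proof (rule LIMSEQ_le)
    show "(\<lambda>n. norm (x - z n)) \<longlonglongrightarrow> norm (x - y)" by (intro tendsto_intros y)
    show "(\<lambda>n. \<delta> + 1 / Suc n) \<longlonglongrightarrow> \<delta>"
      using tendsto_add[OF tendsto_const lim_1_over_n[THEN LIMSEQ_Suc], of \<delta>] by simp
  qed (use z(2) less_imp_le in blast)
  ultimately show ?thesis using lb order_trans by blast
qed

lemma proj_exists:
  assumes V: "hilbert_subspace V"
  shows "\<exists>y\<in>V. \<forall>z\<in>V. cinner (x - y) z = 0"
proof -
  obtain y where y: "y \<in> V" "\<And>z. z \<in> V \<Longrightarrow> norm (x - y) \<le> norm (x - z)"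
    using nearest_point[OF V] by blast
  have "cinner (x - y) z = 0" if z: "z \<in> V" for z
  proof (cases "z = 0")
    case False
    \<comment> \<open>c is the coefficient of the projection of x - y onto z. Moving y by c times z
      lowers the squared distance by the square of norm c * norm z, which a nearest point does not
      allow unless c = 0.\<close>
    define c where "c = cinner (x - y) z / of_real ((norm z)\<^sup>2)"
    have "(norm (x - y))\<^sup>2 \<le> (norm (x - (y + c *\<^sub>C z)))\<^sup>2"
      using y z V by (intro power_mono y) (auto simp: hilbert_subspaceD)
    also have "x - (y + c *\<^sub>C z) = (x - y) + - (c *\<^sub>C z)" by simp
    also have "(norm \<dots>)\<^sup>2 = (norm (x - y))\<^sup>2 + (norm c * norm z)\<^sup>2 - 2 * Re (cnj c * cinner (x - y) z)"
      unfolding norm_add_square by (simp add: norm_scaleC cinner_minus_right cinner_scaleC_right)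
    also have "cnj c * cinner (x - y) z = of_real ((norm c * norm z)\<^sup>2)"
    proof -
      have "cinner (x - y) z = c * of_real ((norm z)\<^sup>2)" using False by (simp add: c_def)
      then show ?thesis by (simp add: power_mult_distrib complex_norm_square del: of_real_power)
    qed
    finally have "(norm c * norm z)\<^sup>2 \<le> 0" by (simp add: Re_complex_of_real del: of_real_power of_real_mult)
    then have "c = 0" using False by simp
    then show ?thesis using False by (simp add: c_def)
  qed simp
  with y show ?thesis by blast
qed

lemma proj_eqI:
  assumes "hilbert_subspace V" "y \<in> V" "\<And>z. z \<in> V \<Longrightarrow> cinner x z = cinner y z"
  shows "proj V x = y"
  unfolding proj_def using assms
  by (intro the_equality) (auto simp: cinner_diff_left intro: cinner_eqI)

lemma proj:
  assumes V: "hilbert_subspace V"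
  shows "proj V x \<in> V" "z \<in> V \<Longrightarrow> cinner (proj V x) z = cinner x z"
    "z \<in> V \<Longrightarrow> cinner z (proj V x) = cinner z x"
proof -
  obtain y where y: "y \<in> V" "\<forall>z\<in>V. cinner (x - y) z = 0" using proj_exists[OF V] by blast
  have *: "proj V x = y" using y by (intro proj_eqI V) (auto simp: cinner_diff_left)
  show "proj V x \<in> V" "z \<in> V \<Longrightarrow> cinner (proj V x) z = cinner x z"
    using y by (auto simp: * cinner_diff_left)
  then show "z \<in> V \<Longrightarrow> cinner z (proj V x) = cinner z x" by (metis cinner_commute)
qed

lemma ocompl_ocompl:
  assumes "hilbert_subspace V" "hilbert_subspace W" "W \<subseteq> V"
  shows "V \<ominus> (V \<ominus> W) = W"
proof
  show "W \<subseteq> V \<ominus> (V \<ominus> W)"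
    using assms(3) unfolding ocompl_in_def by (auto intro: cinner_eq_zero_commute)
  show "V \<ominus> (V \<ominus> W) \<subseteq> W"
  proof
    fix x assume x: "x \<in> V \<ominus> (V \<ominus> W)"
    have "proj W x \<in> V" using assms(3) proj(1)[OF assms(2)] by blast
    then have "x - proj W x \<in> V \<ominus> W"
      using x proj(2)[OF assms(2)] hilbert_subspaceD(5)[OF assms(1)] by (auto simp: ocompl_in_def cinner_diff_left)
    then have "cinner x (x - proj W x) = 0" "cinner (x - proj W x) (proj W x) = 0"
      using x proj(1)[OF assms(2)] by (auto simp: ocompl_in_def)
    then have "cinner (proj W x) (x - proj W x) = 0" by (metis cinner_commute complex_cnj_zero)
    with \<open>cinner x (x - proj W x) = 0\<close> have "cinner (x - proj W x) (x - proj W x) = 0"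
      by (subst cinner_diff_left) simp
    then show "x \<in> W" using proj(1)[OF assms(2), of x] by simp
  qed
qed

text \<open>The form in which density is used below: W fills V as soon as every vector of V
  orthogonal to W vanishes.\<close>

lemma hilbert_subspace_eqI:
  assumes "hilbert_subspace V" "hilbert_subspace W" "W \<subseteq> V"
    and "\<And>x. x \<in> V \<Longrightarrow> (\<And>y. y \<in> W \<Longrightarrow> cinner x y = 0) \<Longrightarrow> x = 0"
  shows "W = V"
proof -
  have "V \<ominus> W = {0}"
    using assms(4) hilbert_subspaceD(3)[OF assms(1)] by (auto simp: ocompl_in_def)
  moreover have "V \<ominus> {0} = V" by (auto simp: ocompl_in_def)
  ultimately show ?thesis using ocompl_ocompl[OF assms(1-3)] by simp
qed

lemma hilbert_subspace_closed_cspan: "hilbert_subspace (closed_cspan E)"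
proof -
  let ?S = "cspan E"
  have S: "csubspace ?S" by simp
  have add: "x + y \<in> closure ?S" if xy: "x \<in> closure ?S" "y \<in> closure ?S" for x y
  proof -
    obtain a b where "\<And>n. a n \<in> ?S" "a \<longlonglongrightarrow> x" "\<And>n. b n \<in> ?S" "b \<longlonglongrightarrow> y"
      using xy unfolding closure_sequential by blast
    then show ?thesis unfolding closure_sequential
      by (intro exI[of _ "\<lambda>n. a n + b n"]) (auto intro: tendsto_add cvec.span_add)
  qed
  have sc: "c *\<^sub>C x \<in> closure ?S" if xy: "x \<in> closure ?S" for x c
  proof -
    obtain a where a: "\<And>n. a n \<in> ?S" "a \<longlonglongrightarrow> x"
      using xy unfolding closure_sequential by blast
    have "bounded_linear (\<lambda>x :: 'a. c *\<^sub>C x)"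
      by (rule bounded_linear_intro[of _ "norm c"])
        (auto simp: scaleC_add_right scaleR_eq_scaleC norm_scaleC cvec.scale_left_commute mult.commute)
    from bounded_linear.tendsto[OF this a(2)] a(1)
    show ?thesis unfolding closure_sequential
      by (intro exI[of _ "\<lambda>n. c *\<^sub>C a n"]) (auto intro: cvec.span_scale)
  qed
  have "0 \<in> closure ?S" using closure_subset[of ?S] cvec.span_zero by blast
  with add sc show ?thesis
    by (auto simp: hilbert_subspace_def closed_cspan_def cvec.subspace_def)
qed

lemma subset_closed_cspan: "E \<subseteq> closed_cspan E"
  using cvec.span_superset closure_subset by (fastforce simp: closed_cspan_def)

lemma closed_cspan_minimal: "hilbert_subspace N \<Longrightarrow> E \<subseteq> N \<Longrightarrow> closed_cspan E \<subseteq> N"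
  unfolding closed_cspan_def hilbert_subspace_def by (intro closure_minimal cvec.span_minimal) auto

section \<open>Operators and adjoints\<close>

lemma bounded_opsI:
  assumes "\<And>x. x \<in> V \<Longrightarrow> T x \<in> W" "\<And>x y. x \<in> V \<Longrightarrow> y \<in> V \<Longrightarrow> T (x + y) = T x + T y"
    "\<And>c x. x \<in> V \<Longrightarrow> T (c *\<^sub>C x) = c *\<^sub>C T x" "\<And>x. x \<in> V \<Longrightarrow> norm (T x) \<le> K * norm x"
  shows "T \<in> bounded_ops V W"
  using assms unfolding bounded_ops_def by blast

lemma bounded_opsD:
  assumes "T \<in> bounded_ops V W"
  shows "\<And>x. x \<in> V \<Longrightarrow> T x \<in> W" "\<And>x y. x \<in> V \<Longrightarrow> y \<in> V \<Longrightarrow> T (x + y) = T x + T y"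
    "\<And>c x. x \<in> V \<Longrightarrow> T (c *\<^sub>C x) = c *\<^sub>C T x"
  using assms unfolding bounded_ops_def by auto

lemma bounded_ops_bound:
  assumes "T \<in> bounded_ops V W"
  obtains K where "K \<ge> 0" "\<And>x. x \<in> V \<Longrightarrow> norm (T x) \<le> K * norm x"
proof -
  obtain K where K: "\<forall>x\<in>V. norm (T x) \<le> K * norm x" using assms by (auto simp: bounded_ops_def)
  have "norm (T x) \<le> \<bar>K\<bar> * norm x" if "x \<in> V" for x
    using K that mult_right_mono[of K "\<bar>K\<bar>" "norm x"] by fastforce
  then show ?thesis using that[of "\<bar>K\<bar>"] by simp
qed

lemma bounded_ops_zero: "T \<in> bounded_ops V W \<Longrightarrow> 0 \<in> V \<Longrightarrow> T 0 = 0"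
  using bounded_opsD(3)[of T V W 0 0] by simp

lemma bounded_ops_diff:
  assumes "T \<in> bounded_ops V W" "hilbert_subspace V" "x \<in> V" "y \<in> V"
  shows "T (x - y) = T x - T y"
  using bounded_opsD(2)[OF assms(1), of "x - y" y] hilbert_subspaceD(5)[OF assms(2-4)] assms(4) by simp

lemma bounded_ops_sum:
  assumes T: "T \<in> bounded_ops V W" and V: "hilbert_subspace V" and f: "\<And>i. i \<in> I \<Longrightarrow> f i \<in> V"
  shows "T (sum f I) = (\<Sum>i\<in>I. T (f i))"
proof -
  have "sum f I \<in> V \<and> T (sum f I) = (\<Sum>i\<in>I. T (f i))" using f
    by (induction I rule: infinite_finite_induct)
      (auto simp: bounded_ops_zero[OF T] hilbert_subspaceD[OF V] bounded_opsD[OF T])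
  then show ?thesis ..
qed

lemma bounded_ops_add:
  assumes "S \<in> bounded_ops V W" "T \<in> bounded_ops V W" "csubspace W"
  shows "(\<lambda>x. S x + T x) \<in> bounded_ops V W"
proof -
  obtain K K' where K: "\<And>x. x \<in> V \<Longrightarrow> norm (S x) \<le> K * norm x" "\<And>x. x \<in> V \<Longrightarrow> norm (T x) \<le> K' * norm x"
    using bounded_ops_bound assms(1,2) by metis
  have "norm (S x + T x) \<le> (K + K') * norm x" if "x \<in> V" for x
    using K(1,2)[OF that] norm_triangle_ineq[of "S x" "T x"] by (simp add: distrib_right)
  then show ?thesis
    by (intro bounded_opsI[where K = "K + K'"])
      (use assms in \<open>auto simp: bounded_opsD[OF assms(1)] bounded_opsD[OF assms(2)] cvec.subspace_add scaleC_add_right\<close>)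
qed

lemma bounded_ops_scaleC:
  assumes "T \<in> bounded_ops V W" "csubspace W"
  shows "(\<lambda>x. c *\<^sub>C T x) \<in> bounded_ops V W"
proof -
  obtain K where K: "\<And>x. x \<in> V \<Longrightarrow> norm (T x) \<le> K * norm x"
    using bounded_ops_bound assms(1) by metis
  have "norm (c *\<^sub>C T x) \<le> (norm c * K) * norm x" if "x \<in> V" for x
    using mult_left_mono[OF K[OF that], of "norm c"] by (simp add: norm_scaleC mult.assoc)
  then show ?thesis
    by (intro bounded_opsI[where K = "norm c * K"])
      (use assms in \<open>auto simp: bounded_opsD[OF assms(1)] cvec.subspace_scale scaleC_add_right cvec.scale_left_commute\<close>)
qed

lemma bounded_ops_comp:
  assumes "T \<in> bounded_ops V W" "S \<in> bounded_ops W Z"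
  shows "S \<circ> T \<in> bounded_ops V Z"
proof -
  obtain K K' where K: "\<And>x. x \<in> V \<Longrightarrow> norm (T x) \<le> K * norm x" "\<And>x. x \<in> W \<Longrightarrow> norm (S x) \<le> K' * norm x" "K' \<ge> 0"
    using bounded_ops_bound assms(1,2) by metis
  have "norm (S (T x)) \<le> (K' * K) * norm x" if "x \<in> V" for x
    using K(2)[OF bounded_opsD(1)[OF assms(1) that]] mult_left_mono[OF K(1)[OF that] K(3)] by (simp add: mult.assoc)
  then show ?thesis
    by (intro bounded_opsI[where K = "K' * K"])
      (auto simp: bounded_opsD[OF assms(1)] bounded_opsD[OF assms(2)])
qed

lemma bounded_ops_id: "id \<in> bounded_ops V V"
  by (auto simp: bounded_ops_def intro!: exI[of _ 1])

lemma word_op_simps [simp]: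
  "word_op T [] = id" "word_op T (i # w) = T i \<circ> word_op T w"
  by (simp_all add: word_op_def)

lemma word_op_append: "word_op T (u @ w) = word_op T u \<circ> word_op T w"
  by (induction u) (auto simp: o_assoc)

lemma word_op_bounded: "(\<And>i. T i \<in> bounded_ops V V) \<Longrightarrow> word_op T w \<in> bounded_ops V V"
  by (induction w) (auto simp: bounded_ops_id intro: bounded_ops_comp)

lemma closed_bounded_ops_vimage:
  assumes T: "T \<in> bounded_ops V W" and V: "hilbert_subspace V" and C: "closed C"
  shows "closed {x \<in> V. T x \<in> C}"
proof -
  obtain K where K: "\<And>x. x \<in> V \<Longrightarrow> norm (T x) \<le> K * norm x" "K \<ge> 0"
    using bounded_ops_bound[OF T] by metis
  have "continuous_on V T"
  proof (rule continuous_on_iff[THEN iffD2], intro ballI allI impI)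
    fix x e assume x: "x \<in> V" and e: "0 < (e :: real)"
    \<comment> \<open>K + 1 instead of K keeps the radius meaningful when K = 0.\<close>
    have "dist (T y) (T x) < e" if y: "y \<in> V" "dist y x < e / (K + 1)" for y
    proof -
      have "dist (T y) (T x) \<le> K * dist y x"
        using K(1)[of "y - x"] x y V by (simp add: dist_norm bounded_ops_diff[OF T V] hilbert_subspaceD)
      also have "\<dots> \<le> (K + 1) * dist y x" by (simp add: mult_right_mono)
      also have "\<dots> < e" using y(2) K(2) by (simp add: pos_less_divide_eq mult.commute)
      finally show ?thesis .
    qed
    then show "\<exists>d>0. \<forall>x'\<in>V. dist x' x < d \<longrightarrow> dist (T x') (T x) < e"
      using e K(2) by (intro exI[of _ "e / (K + 1)"]) auto
  qed
  from continuous_closed_preimage[OF this hilbert_subspaceD(2)[OF V] C]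
  show ?thesis by (simp add: vimage_def Int_def)
qed

text \<open>A main source of closed subspaces below: kernels, graphs of operators, equalizers and
  coordinate conditions are all preimages of this kind.\<close>

lemma hilbert_subspace_vimage:
  assumes T: "T \<in> bounded_ops V W" and V: "hilbert_subspace V" and C: "hilbert_subspace C"
  shows "hilbert_subspace {x \<in> V. T x \<in> C}"
  unfolding hilbert_subspace_def
proof
  show "closed {x \<in> V. T x \<in> C}" by (rule closed_bounded_ops_vimage[OF T V hilbert_subspaceD(2)[OF C]])
  show "csubspace {x \<in> V. T x \<in> C}"
    using hilbert_subspaceD[OF V] hilbert_subspaceD[OF C]
    by (auto simp: cvec.subspace_def bounded_opsD[OF T] bounded_ops_zero[OF T])
qed

text \<open>Riesz representation: the representing vector is taken from the orthogonal complement of the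
  kernel.\<close>

lemma Riesz:
  assumes V: "hilbert_subspace V" and f: "f \<in> bounded_ops V (UNIV :: complex set)"
  shows "\<exists>x\<in>V. \<forall>v\<in>V. f v = cinner v x"
proof (cases "\<forall>v\<in>V. f v = 0")
  case True then show ?thesis using hilbert_subspaceD(3)[OF V] by (intro bexI[of _ 0]) auto
next
  case False
  then obtain u where u: "u \<in> V" "f u \<noteq> 0" by blast
  define N where "N = {x \<in> V. f x \<in> {0}}"
  have "hilbert_subspace {0 :: complex}" by (simp add: hilbert_subspace_def cvec.subspace_single_0)
  then have N: "hilbert_subspace N" unfolding N_def by (intro hilbert_subspace_vimage[OF f V])
  define z where "z = u - proj N u"
  have pN: "proj N u \<in> V" "f (proj N u) = 0" using proj(1)[OF N, of u] by (auto simp: N_def)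
  have z: "z \<in> V" "f z = f u" "\<And>v. v \<in> N \<Longrightarrow> cinner v z = 0"
    using pN u hilbert_subspaceD[OF V]
    by (auto simp: z_def bounded_ops_diff[OF f V] cinner_diff_right proj(3)[OF N])
  have nz: "cinner z z \<noteq> 0" using z(2) u bounded_ops_zero[OF f] hilbert_subspaceD(3)[OF V] by auto
  \<comment> \<open>The scalar is chosen to give \<open>cinner z x = f z\<close>.\<close>
  define x where "x = cnj (f z / cinner z z) *\<^sub>C z"
  have "f v = cinner v x" if v: "v \<in> V" for v
  proof -
    have "v - (f v / f z) *\<^sub>C z \<in> N"
      using v z u hilbert_subspaceD[OF V]
      by (simp add: N_def bounded_ops_diff[OF f V] bounded_opsD[OF f] scaleC_complex_def)
    then have "cinner v z = (f v / f z) * cinner z z"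
      using z(3) by (fastforce simp: cinner_diff_left cinner_scaleC_left)
    then show ?thesis using nz z(2) u(2) by (simp add: x_def cinner_scaleC_right)
  qed
  moreover have "x \<in> V" using z(1) V by (simp add: x_def hilbert_subspaceD)
  ultimately show ?thesis by blast
qed

lemma adj_eqI:
  assumes "hilbert_subspace V" "x \<in> V" "\<And>v. v \<in> V \<Longrightarrow> cinner (T v) y = cinner v x"
  shows "adj V T y = x"
  unfolding adj_def
proof (rule the_equality)
  fix z assume z: "z \<in> V \<and> (\<forall>v\<in>V. cinner (T v) y = cinner v z)"
  show "z = x"
  proof (rule cinner_eqI[OF assms(1)])
    fix v assume "v \<in> V"
    then have "cinner v z = cinner v x" using assms(3) z by simp
    then show "cinner z v = cinner x v" by (metis cinner_commute)
  qed (use z assms in auto)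
qed (use assms in auto)

lemma adj:
  assumes V: "hilbert_subspace V" and T: "T \<in> bounded_ops V W"
  shows "adj V T y \<in> V" "v \<in> V \<Longrightarrow> cinner v (adj V T y) = cinner (T v) y"
    "v \<in> V \<Longrightarrow> cinner (adj V T y) v = cinner y (T v)"
proof -
  obtain K where K: "\<And>x. x \<in> V \<Longrightarrow> norm (T x) \<le> K * norm x" using bounded_ops_bound[OF T] by metis
  have "(\<lambda>v. cinner (T v) y) \<in> bounded_ops V UNIV"
  proof (rule bounded_opsI[where K = "K * norm y"])
    fix x assume "x \<in> V"
    then show "norm (cinner (T x) y) \<le> K * norm y * norm x"
      using order_trans[OF cinner_Cauchy_Schwarz mult_right_mono[OF K]] by (simp add: mult.assoc mult.commute mult.left_commute)
  qed (auto simp: bounded_opsD[OF T] cinner_add_left cinner_scaleC_left scaleC_complex_def)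
  from Riesz[OF V this] obtain x where x: "x \<in> V" "\<And>v. v \<in> V \<Longrightarrow> cinner (T v) y = cinner v x" by blast
  have *: "adj V T y = x" by (intro adj_eqI V x)
  show "adj V T y \<in> V" "v \<in> V \<Longrightarrow> cinner v (adj V T y) = cinner (T v) y" using x * by auto
  then show "v \<in> V \<Longrightarrow> cinner (adj V T y) v = cinner y (T v)" by (metis cinner_commute)
qed

lemma adj_bounded:
  assumes V: "hilbert_subspace V" and T: "T \<in> bounded_ops V W"
  shows "adj V T \<in> bounded_ops UNIV V"
proof -
  obtain K where K: "\<And>x. x \<in> V \<Longrightarrow> norm (T x) \<le> K * norm x" "K \<ge> 0" using bounded_ops_bound[OF T] by metis
  show ?thesis
  proof (rule bounded_opsI[where K = K])
    fix x y c
    show "adj V T (x + y) = adj V T x + adj V T y" "adj V T (c *\<^sub>C x) = c *\<^sub>C adj V T x"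
      by (intro adj_eqI V; simp add: adj[OF V T] hilbert_subspaceD[OF V] cinner_add_right cinner_scaleC_right)+
    have "(norm (adj V T x))\<^sup>2 = Re (cinner (T (adj V T x)) x)"
      using adj[OF V T] by (metis Re_cinner_self)
    also have "\<dots> \<le> norm (T (adj V T x)) * norm x"
      using cinner_Cauchy_Schwarz complex_Re_le_cmod order_trans by blast
    also have "\<dots> \<le> K * norm (adj V T x) * norm x" by (intro mult_right_mono K adj[OF V T]) auto
    finally show "norm (adj V T x) \<le> K * norm x"
      using K(2) by (cases "norm (adj V T x) = 0") (auto simp: power2_eq_square)
  qed (rule adj(1)[OF V T])
qed

lemma bounded_ops_mono: "T \<in> bounded_ops V W \<Longrightarrow> V' \<subseteq> V \<Longrightarrow> W \<subseteq> W' \<Longrightarrow> T \<in> bounded_ops V' W'"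
  unfolding bounded_ops_def by blast

lemma adj_comp:
  assumes "hilbert_subspace V" "T \<in> bounded_ops V V" "S \<in> bounded_ops V V"
  shows "adj V (T \<circ> S) x = adj V S (adj V T x)"
  using assms by (intro adj_eqI) (simp_all add: adj bounded_opsD)

lemma isometry_onD:
  assumes "isometry_on V W T"
  shows "T \<in> bounded_ops V W" "\<And>x. x \<in> V \<Longrightarrow> norm (T x) = norm x"
  using assms by (auto simp: isometry_on_def)

lemma isometry_on_cinner:
  assumes T: "isometry_on V W T" and V: "hilbert_subspace V" and "x \<in> V" "y \<in> V"
  shows "cinner (T x) (T y) = cinner x y"
proof -
  have "norm (T x + T y) = norm (x + y)"
    using isometry_onD(2)[OF T, of "x + y"] assms
    by (simp add: hilbert_subspaceD bounded_opsD[OF isometry_onD(1)[OF T]])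
  moreover have "norm (T x + \<i> *\<^sub>C T y) = norm (x + \<i> *\<^sub>C y)"
    using isometry_onD(2)[OF T, of "x + \<i> *\<^sub>C y"] assms
    by (simp add: hilbert_subspaceD bounded_opsD[OF isometry_onD(1)[OF T]])
  ultimately show ?thesis
    unfolding polarization[of "T x"] polarization[of x] using isometry_onD(2)[OF T] assms(3,4)
    by (simp add: norm_scaleC)
qed

text \<open>Closedness holds because T preserves distances: a convergent sequence of images comes
  from a Cauchy sequence of preimages, whose limit stays in V.\<close>

lemma isometry_on_image_hilbert:
  assumes T: "isometry_on V W T" and V: "hilbert_subspace V"
  shows "hilbert_subspace (T ` V)"
proof -
  note TB = isometry_onD(1)[OF T]
  have "csubspace (T ` V)"
    unfolding cvec.subspace_def
  proof (intro conjI ballI allI)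
    show "0 \<in> T ` V"
      using bounded_ops_zero[OF TB] hilbert_subspaceD(3)[OF V] by (metis imageI)
  qed (auto simp: bounded_opsD(2,3)[OF TB, symmetric] hilbert_subspaceD[OF V])
  moreover have "closed (T ` V)"
    unfolding closed_sequential_limits
  proof (intro allI impI)
    fix y l assume yl: "(\<forall>n. y n \<in> T ` V) \<and> y \<longlonglongrightarrow> l"
    then obtain x where x: "\<And>n. x n \<in> V" "\<And>n. y n = T (x n)"
    proof -
      have "\<exists>x. x \<in> V \<and> y n = T x" for n using yl by blast
      then show ?thesis using that by metis
    qed
    have d: "dist (x m) (x n) = dist (y m) (y n)" for m n
      unfolding dist_norm x(2) using isometry_onD(2)[OF T, of "x m - x n"] x(1)
      by (simp add: bounded_ops_diff[OF TB V] hilbert_subspaceD[OF V])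
    have "Cauchy y" using yl LIMSEQ_imp_Cauchy by blast
    then have "Cauchy x" by (simp add: Cauchy_def d)
    then obtain z where z: "x \<longlonglongrightarrow> z" using Cauchy_convergent_iff convergent_def by blast
    have zV: "z \<in> V" using closed_sequentially[OF hilbert_subspaceD(2)[OF V] _ z] x by blast
    have "dist (y n) (T z) = dist (x n) z" for n
      unfolding dist_norm x(2) using isometry_onD(2)[OF T, of "x n - z"] x(1) zV
      by (simp add: bounded_ops_diff[OF TB V] hilbert_subspaceD[OF V])
    then have "y \<longlonglongrightarrow> T z" using z by (subst tendsto_dist_iff) (simp, subst (asm) tendsto_dist_iff)
    then have "l = T z" using yl LIMSEQ_unique by blast
    then show "l \<in> T ` V" using zV by blast
  qed
  ultimately show ?thesis by (simp add: hilbert_subspace_def)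
qed

section \<open>Finite-dimensional subspaces\<close>

lemma has_cdim_csubspace: "has_cdim V d \<Longrightarrow> csubspace V"
  by (auto simp: has_cdim_def)

lemma independent_card_le_cdim:
  assumes "has_cdim V d" "cindependent S" "S \<subseteq> V"
  shows "finite S" "card S \<le> d"
  using assms cvec.independent_span_bound[of _ S] unfolding has_cdim_def cindependent_def by auto

lemma has_cdim_unique: "has_cdim V d \<Longrightarrow> has_cdim V k \<Longrightarrow> d = k"
  using independent_card_le_cdim cvec.span_superset unfolding has_cdim_def by (metis le_antisym)

text \<open>For a positive semidefinite form the orthonormal families have bounded length, and the
  residual of a vector with respect to a longest one is a null vector.\<close>

lemma psd_form_orthonormal:
  fixes q :: "'a::chilbert_space \<Rightarrow> 'a \<Rightarrow> complex"
  assumes V: "has_cdim V d"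
    and add: "\<And>x y z. x \<in> V \<Longrightarrow> y \<in> V \<Longrightarrow> z \<in> V \<Longrightarrow> q (x + y) z = q x z + q y z"
    and sc: "\<And>c x z. x \<in> V \<Longrightarrow> z \<in> V \<Longrightarrow> q (c *\<^sub>C x) z = c * q x z"
    and herm: "\<And>x y. x \<in> V \<Longrightarrow> y \<in> V \<Longrightarrow> q x y = cnj (q y x)"
    and pos: "\<And>x. x \<in> V \<Longrightarrow> Re (q x x) \<ge> 0"
  obtains r e where "r \<le> d" "\<And>k. k \<in> {1..r} \<Longrightarrow> e k \<in> V"
    "\<And>k l. k \<in> {1..r} \<Longrightarrow> l \<in> {1..r} \<Longrightarrow> q (e k) (e l) = (if k = l then 1 else 0)"
    "\<And>v. v \<in> V \<Longrightarrow> q v v = of_real (\<Sum>k=1..r. (norm (q v (e k)))\<^sup>2)"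
proof -
  define ON where "ON r e \<longleftrightarrow> (\<forall>k\<in>{1..r}. e k \<in> V)
    \<and> (\<forall>k\<in>{1..r}. \<forall>l\<in>{1..r}. q (e k) (e l) = (if k = l then 1 else 0))" for r :: nat and e
  note sub = cvec.subspace_0 cvec.subspace_add cvec.subspace_scale cvec.subspace_diff cvec.subspace_sum
  note VS = has_cdim_csubspace[OF V]
  have sum: "q (\<Sum>i\<in>I. f i *\<^sub>C g i) z = (\<Sum>i\<in>I. f i * q (g i) z)"
    if "\<And>i. i \<in> I \<Longrightarrow> g i \<in> V" "z \<in> V" for I :: "'i set" and f g z
  proof -
    have "(\<Sum>i\<in>I. f i *\<^sub>C g i) \<in> V \<and> q (\<Sum>i\<in>I. f i *\<^sub>C g i) z = (\<Sum>i\<in>I. f i * q (g i) z)"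
      using that by (induction I rule: infinite_finite_induct)
        (use sc[of 0 z 0] in \<open>auto simp: add sc sub[OF VS]\<close>)
    then show ?thesis ..
  qed
  \<comment> \<open>The form q may be degenerate, yet orthonormality for q still implies linear
    independence: pairing a linear relation with e l isolates its l-th coefficient.\<close>
  have bound: "r \<le> d" if "ON r e" for r e
  proof -
    have inj: "inj_on e {1..r}" using that unfolding ON_def inj_on_def by (metis zero_neq_one)
    have "cindependent (e ` {1..r})"
    proof (rule ccontr)
      assume "\<not> cindependent (e ` {1..r})"
      then obtain u l where u: "l \<in> {1..r}" "u (e l) \<noteq> 0" "(\<Sum>v\<in>e ` {1..r}. u v *\<^sub>C v) = 0"
        by (simp only: cindependent_def not_not) (subst (asm) cvec.dependent_finite, auto)
      have "(\<Sum>k\<in>{1..r}. u (e k) *\<^sub>C e k) = 0" using u(3) inj by (simp add: sum.reindex)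
      then have "(\<Sum>k\<in>{1..r}. u (e k) * q (e k) (e l)) = q 0 (e l)"
        using that u(1) by (subst sum[symmetric]) (auto simp: ON_def)
      also have "\<dots> = 0" using sc[of 0 "e l" 0] sub(1)[OF VS] that u(1) by (auto simp: ON_def)
      also have "(\<Sum>k\<in>{1..r}. u (e k) * q (e k) (e l)) = (\<Sum>k\<in>{1..r}. if k = l then u (e k) else 0)"
        using that u(1) by (intro sum.cong) (auto simp: ON_def)
      also have "\<dots> = u (e l)" using u(1) by simp
      finally show False using u(2) by simp
    qed
    from independent_card_le_cdim(2)[OF V this] that show ?thesis
      using card_image[OF inj] by (auto simp: ON_def)
  qed
  define P where "P r = (\<exists>e. ON r e)" for r
  have P0: "P 0" and Pd: "\<And>r. P r \<Longrightarrow> r \<le> d" using bound by (auto simp: P_def ON_def)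
  obtain r where r: "P r" "\<And>r'. P r' \<Longrightarrow> r' \<le> r"
    using Nat.ex_has_greatest_nat[of P 0 d] P0 Pd by blast
  from r(1) obtain e where "ON r e" unfolding P_def ..
  with r(2) have e: "ON r e" "\<And>r' e'. ON r' e' \<Longrightarrow> r' \<le> r" by (auto simp: P_def)
  have "q v v = of_real (\<Sum>k=1..r. (norm (q v (e k)))\<^sup>2)" if v: "v \<in> V" for v
  proof -
    define p where "p = (\<Sum>k=1..r. q v (e k) *\<^sub>C e k)"
    have eV: "\<And>k. k \<in> {1..r} \<Longrightarrow> e k \<in> V" using e(1) by (auto simp: ON_def)
    have pV: "p \<in> V" unfolding p_def by (intro sub(5)[OF VS] sub(3)[OF VS] eV)
    define w where "w = v - p"
    have wV: "w \<in> V" using v pV sub(4)[OF VS] by (simp add: w_def)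
    have w: "q w z = q v z - q p z" if "z \<in> V" for z
      using add[of w p z] wV pV that by (simp add: w_def)
    have pe: "q p (e l) = q v (e l)" if l: "l \<in> {1..r}" for l
    proof -
      have "q p (e l) = (\<Sum>k=1..r. q v (e k) * q (e k) (e l))"
        unfolding p_def by (rule sum) (use eV l in auto)
      also have "\<dots> = (\<Sum>k\<in>{1..r}. if k = l then q v (e k) else 0)"
        using e(1) l by (intro sum.cong) (auto simp: ON_def)
      finally show ?thesis using l by simp
    qed
    have we: "q w (e l) = 0" "q (e l) w = 0" if l: "l \<in> {1..r}" for l
      using w[OF eV[OF l]] pe[OF l] herm[OF eV[OF l] wV] by auto
    have "q p w = 0" unfolding p_def by (subst sum) (use eV wV we in auto)
    then have "q w p = 0" using herm[OF wV pV] by simp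
    then have "q w w = q v w"
      using w[OF wV] \<open>q p w = 0\<close> by simp
    also have "q v w = cnj (q w v)" using herm v wV by blast
    also have "q w v = q v v - q p v" using w v by blast
    also have "q p v = (\<Sum>k=1..r. q v (e k) * q (e k) v)" unfolding p_def by (rule sum) (use eV v in auto)
    also have "\<dots> = (\<Sum>k=1..r. of_real ((norm (q v (e k)))\<^sup>2))"
      by (intro sum.cong refl) (use herm[OF eV v] complex_norm_square in auto)
    also have "cnj (q v v - \<dots>) = q v v - of_real (\<Sum>k=1..r. (norm (q v (e k)))\<^sup>2)"
      using herm[OF v v] by (simp del: of_real_power)
    finally have qw: "q w w = q v v - of_real (\<Sum>k=1..r. (norm (q v (e k)))\<^sup>2)" .
    have im: "q w w = of_real (Re (q w w))" using herm[OF wV wV] by (simp add: complex_eq_iff)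
    have "q w w = 0"
    proof (rule ccontr)
      assume "q w w \<noteq> 0"
      then have re: "Re (q w w) > 0" using im pos[OF wV] by (metis less_eq_real_def of_real_0)
      define c where "c = complex_of_real (1 / sqrt (Re (q w w)))"
      have c: "cnj c = c" by (simp add: c_def)
      have cc: "c * (c * q w w) = 1"
        using re by (subst im) (simp add: c_def flip: of_real_mult)
      have sc': "q x (c *\<^sub>C w) = c * q x w" if "x \<in> V" for x
        using herm[of x "c *\<^sub>C w"] herm[of x w] that wV sub(3)[OF VS] by (simp add: sc c)
      \<comment> \<open>A residual of positive square could be normalised and appended to the
        family, which contradicts the maximality of r.\<close>
      have "ON (Suc r) (e(Suc r := c *\<^sub>C w))"
        unfolding ON_def
      proof (intro conjI ballI)
        fix k l assume "k \<in> {1..Suc r}" "l \<in> {1..Suc r}"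
        then have kl: "k \<in> {1..r} \<or> k = Suc r" "l \<in> {1..r} \<or> l = Suc r" by auto
        show "q ((e(Suc r := c *\<^sub>C w)) k) ((e(Suc r := c *\<^sub>C w)) l) = (if k = l then 1 else 0)"
          using kl e(1) we eV wV sub(3)[OF VS] cc by (auto simp: sc sc' ON_def)
      qed (use eV wV sub(3)[OF VS] in \<open>auto simp: le_Suc_eq\<close>)
      then have "Suc r \<le> r" by (rule e(2))
      then show False by simp
    qed
    then show ?thesis using qw by simp
  qed
  with e(1) bound[OF e(1)] show ?thesis by (intro that[of r e]) (auto simp: ON_def)
qed

text \<open>The form is now the inner product itself. It is definite, so a vector with vanishing
  coordinates is 0, and applying this to the residual gives the expansion.\<close>

lemma has_cdim_orthonormal:
  assumes V: "has_cdim (V :: 'a::chilbert_space set) d"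
  obtains r :: nat and e where "\<And>k. k \<in> {1..r} \<Longrightarrow> e k \<in> V"
    "\<And>v. v \<in> V \<Longrightarrow> v = (\<Sum>k=1..r. cinner v (e k) *\<^sub>C e k)"
proof -
  obtain r :: nat and e where e: "\<And>k. k \<in> {1..r} \<Longrightarrow> e k \<in> V"
    "\<And>k l. k \<in> {1..r} \<Longrightarrow> l \<in> {1..r} \<Longrightarrow> cinner (e k) (e l) = (if k = l then 1 else 0)"
    "\<And>v. v \<in> V \<Longrightarrow> cinner v v = of_real (\<Sum>k=1..r. (norm (cinner v (e k)))\<^sup>2)"
    by (rule psd_form_orthonormal[OF V, of cinner])
      (use cinner_commute in \<open>auto simp: cinner_add_left cinner_scaleC_left Re_cinner_self\<close>)
  have "v = (\<Sum>k=1..r. cinner v (e k) *\<^sub>C e k)" if v: "v \<in> V" for v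
  proof -
    define p where "p = (\<Sum>k=1..r. cinner v (e k) *\<^sub>C e k)"
    have "v - p \<in> V" unfolding p_def using has_cdim_csubspace[OF V] v e(1)
      by (intro cvec.subspace_diff cvec.subspace_sum cvec.subspace_scale) auto
    moreover have "cinner (v - p) (e l) = 0" if "l \<in> {1..r}" for l
    proof -
      have "cinner p (e l) = (\<Sum>k\<in>{1..r}. if k = l then cinner v (e k) else 0)"
        unfolding p_def cinner_sum_left cinner_scaleC_left using e(2) that by (intro sum.cong) auto
      then show ?thesis using that by (simp add: cinner_diff_left)
    qed
    ultimately have "cinner (v - p) (v - p) = 0" using e(3)[of "v - p"] by simp
    then show ?thesis by (simp add: p_def)
  qed
  with e(1) show ?thesis using that by blast
qed

lemma linear_on_sum:
  assumes V: "csubspace V"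
    and T: "\<And>x y. x \<in> V \<Longrightarrow> y \<in> V \<Longrightarrow> T (x + y) = T x + T y" "\<And>c x. x \<in> V \<Longrightarrow> T (c *\<^sub>C x) = c *\<^sub>C T x"
    and f: "\<And>i. i \<in> I \<Longrightarrow> f i \<in> (V :: 'a::chilbert_space set)"
  shows "T (sum f I) = (\<Sum>i\<in>I. T (f i) :: 'b::chilbert_space)"
proof -
  have "sum f I \<in> V \<and> T (sum f I) = (\<Sum>i\<in>I. T (f i))" using f
    by (induction I rule: infinite_finite_induct)
      (use V T(2)[of 0 0] in \<open>auto simp: cvec.subspace_0 cvec.subspace_add T(1)\<close>)
  then show ?thesis ..
qed

lemma has_cdim_bounded_ops:
  assumes V: "has_cdim V d"
    and T: "\<And>x y. x \<in> V \<Longrightarrow> y \<in> V \<Longrightarrow> T (x + y) = T x + T y" "\<And>c x. x \<in> V \<Longrightarrow> T (c *\<^sub>C x) = c *\<^sub>C T x"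
      "\<And>x. x \<in> V \<Longrightarrow> T x \<in> W"
  shows "T \<in> bounded_ops V W"
proof -
  note VS = has_cdim_csubspace[OF V]
  obtain r :: nat and e where e: "\<And>k. k \<in> {1..r} \<Longrightarrow> e k \<in> V"
    "\<And>v. v \<in> V \<Longrightarrow> v = (\<Sum>k=1..r. cinner v (e k) *\<^sub>C e k)" using has_cdim_orthonormal[OF V] by blast
  have "norm (T x) \<le> (\<Sum>k=1..r. norm (e k) * norm (T (e k))) * norm x" if x: "x \<in> V" for x
  proof -
    have "T x = T (\<Sum>k=1..r. cinner x (e k) *\<^sub>C e k)" using e(2)[OF x] by simp
    also have "\<dots> = (\<Sum>k=1..r. T (cinner x (e k) *\<^sub>C e k))"
      by (rule linear_on_sum[OF VS T(1,2)]) (use e(1) cvec.subspace_scale[OF VS] in auto)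
    also have "\<dots> = (\<Sum>k=1..r. cinner x (e k) *\<^sub>C T (e k))"
      by (intro sum.cong refl T(2) e(1))
    also have "norm \<dots> \<le> (\<Sum>k=1..r. norm x * norm (e k) * norm (T (e k)))"
      by (intro order_trans[OF norm_sum] sum_mono) (auto simp: norm_scaleC intro!: mult_right_mono cinner_Cauchy_Schwarz)
    finally show ?thesis by (simp add: sum_distrib_left sum_distrib_right mult_ac)
  qed
  then show ?thesis by (intro bounded_opsI[OF T(3) T(1) T(2)])
qed

text \<open>V is the set of vectors equal to their own coordinate expansion. Moving the expansion to
  the other side of the inner product turns this condition into an intersection of closed
  hyperplanes.\<close>

lemma has_cdim_hilbert_subspace:
  assumes V: "has_cdim V d"
  shows "hilbert_subspace V"
proof -
  note VS = has_cdim_csubspace[OF V]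
  obtain r :: nat and e where e: "\<And>k. k \<in> {1..r} \<Longrightarrow> e k \<in> V"
    "\<And>v. v \<in> V \<Longrightarrow> v = (\<Sum>k=1..r. cinner v (e k) *\<^sub>C e k)" using has_cdim_orthonormal[OF V] by blast
  have "V = {v. (\<forall>y. cinner (v - (\<Sum>k=1..r. cinner v (e k) *\<^sub>C e k)) y = 0)}" (is "_ = ?R")
  proof
    show "V \<subseteq> ?R" using e(2) by auto
    show "?R \<subseteq> V"
    proof
      fix v assume "v \<in> ?R"
      then have "v - (\<Sum>k=1..r. cinner v (e k) *\<^sub>C e k) = 0" using cinner_eq_zero_iff by blast
      then have "v = (\<Sum>k=1..r. cinner v (e k) *\<^sub>C e k)" by simp
      moreover have "\<dots> \<in> V" using e(1) by (intro cvec.subspace_sum[OF VS] cvec.subspace_scale[OF VS])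
      ultimately show "v \<in> V" by simp
    qed
  qed
  moreover have "closed ?R"
  proof -
    have eq: "cinner (v - (\<Sum>k=1..r. cinner v (e k) *\<^sub>C e k)) y
        = cinner v (y - (\<Sum>k=1..r. cinner y (e k) *\<^sub>C e k))" for v y
      by (simp add: cinner_diff_left cinner_diff_right cinner_sum_left cinner_sum_right
          cinner_scaleC_left cinner_scaleC_right cinner_commute[of "e _" y] mult.commute)
    have "?R = (\<Inter>y. {v. cinner v (y - (\<Sum>k=1..r. cinner y (e k) *\<^sub>C e k)) = 0})" unfolding eq by auto
    then show ?thesis by (simp only:) (intro closed_INT ballI closed_cinner_eq)
  qed
  ultimately show ?thesis using VS by (simp add: hilbert_subspace_def)
qed

lemma has_cdim_image:
  assumes V: "has_cdim V d"
    and T: "\<And>x y. x \<in> V \<Longrightarrow> y \<in> V \<Longrightarrow> T (x + y) = T x + T y" "\<And>c x. x \<in> V \<Longrightarrow> T (c *\<^sub>C x) = c *\<^sub>C T x"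
  shows "\<exists>k\<le>d. has_cdim (T ` V) k"
proof -
  note VS = has_cdim_csubspace[OF V]
  have T0: "T 0 = 0" using T(2)[OF cvec.subspace_0[OF VS], of 0] by simp
  obtain B where B: "finite B" "cspan B = V" "card B = d" using V by (auto simp: has_cdim_def)
  have BV: "B \<subseteq> V" using B(2) cvec.span_superset by auto
  have TV: "csubspace (T ` V)"
    unfolding cvec.subspace_def
  proof (intro conjI ballI allI)
    show "0 \<in> T ` V" using T0 cvec.subspace_0[OF VS] by (metis imageI)
  qed (auto simp: T[symmetric] cvec.subspace_add[OF VS] cvec.subspace_scale[OF VS])
  have "V \<subseteq> {x \<in> V. T x \<in> cspan (T ` B)}"
    using B(2) BV by (subst B(2)[symmetric], intro cvec.span_minimal)
     (auto simp: cvec.subspace_def cvec.subspace_0[OF VS] cvec.subspace_add[OF VS]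
       cvec.subspace_scale[OF VS] T T0 cvec.span_zero cvec.span_add cvec.span_scale intro: cvec.span_base)
  then have "T ` V = cspan (T ` B)"
    using cvec.span_minimal[OF _ TV, of "T ` B"] BV by blast
  moreover obtain B' where B': "B' \<subseteq> T ` B" "cindependent B'" "T ` B \<subseteq> cspan B'"
    using cvec.maximal_independent_subset unfolding cindependent_def by blast
  moreover have "cspan B' = cspan (T ` B)"
    using B' cvec.span_minimal[OF B'(3)] cvec.span_mono[OF B'(1)] by auto
  moreover have "finite B'" "card B' \<le> d"
    using B'(1) B(1,3) finite_subset card_mono[OF _ B'(1)] card_image_le[OF B(1), of T] by auto
  ultimately show ?thesis unfolding has_cdim_def by metis
qed

text \<open>The dimension cannot drop, because the inverse map is linear on the image and leads back
  onto V.\<close>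

lemma has_cdim_inj_image:
  assumes V: "has_cdim V d"
    and T: "\<And>x y. x \<in> V \<Longrightarrow> y \<in> V \<Longrightarrow> T (x + y) = T x + T y" "\<And>c x. x \<in> V \<Longrightarrow> T (c *\<^sub>C x) = c *\<^sub>C T x"
    and inj: "inj_on T V"
  shows "has_cdim (T ` V) d"
proof -
  note VS = has_cdim_csubspace[OF V]
  obtain k where k: "k \<le> d" "has_cdim (T ` V) k" using has_cdim_image[OF V T] by blast
  define S where "S = inv_into V T"
  have S: "S (T x) = x" if "x \<in> V" for x using inj that by (simp add: S_def)
  have "S (x + y) = S x + S y" if "x \<in> T ` V" "y \<in> T ` V" for x y
    using that by (auto simp: T[symmetric] S cvec.subspace_add[OF VS])
  moreover have "S (c *\<^sub>C x) = c *\<^sub>C S x" if "x \<in> T ` V" for c x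
    using that by (auto simp: T[symmetric] S cvec.subspace_scale[OF VS])
  ultimately have "\<exists>l\<le>k. has_cdim (S ` T ` V) l" by (rule has_cdim_image[OF k(2)])
  then obtain l where "l \<le> k" "has_cdim (S ` T ` V) l" by (elim exE conjE)
  moreover have "S ` T ` V = V" using S by (auto simp: image_image)
  ultimately have "d \<le> k" using has_cdim_unique[OF V] by auto
  with k show ?thesis by simp
qed

section \<open>Direct sums\<close>

lift_definition l2_single :: "'j \<Rightarrow> 'a::chilbert_space \<Rightarrow> ('j, 'a) l2" is
  "\<lambda>j x i. if i = j then x else 0"
proof -
  fix j :: 'j and x :: 'a
  have "(\<lambda>i. (norm (if i = j then x else 0))\<^sup>2) summable_on {j}" by simp
  then show "(\<lambda>i. (norm (if i = j then x else 0))\<^sup>2) summable_on UNIV"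
    by (subst summable_on_cong_neutral[where T = "{j}"]) auto
qed

lemma l2_eqI: "(\<And>j. Rep_l2 f j = Rep_l2 g j) \<Longrightarrow> f = g"
  by (simp add: Rep_l2_inject[symmetric] ext)

lemmas Rep_l2_simps [simp] = zero_l2.rep_eq plus_l2.rep_eq uminus_l2.rep_eq minus_l2.rep_eq
  scaleC_l2.rep_eq l2_single.rep_eq

lemma Rep_l2_sum [simp]: "Rep_l2 (sum f I) j = (\<Sum>i\<in>I. Rep_l2 (f i) j)"
  by (induction I rule: infinite_finite_induct) auto

lemma cinner_l2_single: "cinner f (l2_single j x) = cinner (Rep_l2 f j) x"
proof -
  have "cinner f (l2_single j x) = (\<Sum>\<^sub>\<infinity>i\<in>{j}. cinner (Rep_l2 f i) x)"
    unfolding cinner_l2.rep_eq by (rule infsum_cong_neutral) auto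
  then show ?thesis by simp
qed

lemma norm_Rep_l2_le: "norm (Rep_l2 f j) \<le> norm f"
  using L2_set_le_norm_l2[of "{j}" f] by simp

lemma Rep_l2_bounded_ops: "(\<lambda>f. Rep_l2 f j) \<in> bounded_ops UNIV UNIV"
  by (rule bounded_opsI[where K = 1]) (auto simp: norm_Rep_l2_le)

lemma cinner_l2_finite:
  assumes "finite I" "\<And>j. j \<notin> I \<Longrightarrow> Rep_l2 f j = 0"
  shows "cinner f g = (\<Sum>j\<in>I. cinner (Rep_l2 f j) (Rep_l2 g j))"
proof -
  have "cinner f g = (\<Sum>\<^sub>\<infinity>j\<in>I. cinner (Rep_l2 f j) (Rep_l2 g j))"
    unfolding cinner_l2.rep_eq using assms(2) by (intro infsum_cong_neutral) auto
  with assms(1) show ?thesis by simp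
qed

lemma cinner_hsum:
  "finite I \<Longrightarrow> f \<in> hsum I M \<Longrightarrow> cinner f g = (\<Sum>j\<in>I. cinner (Rep_l2 f j) (Rep_l2 g j))"
  by (rule cinner_l2_finite) (auto simp: hsum_def split: if_splits)

lemma hilbert_subspace_hsum:
  assumes "\<And>j. j \<in> I \<Longrightarrow> hilbert_subspace (M j)"
  shows "hilbert_subspace (hsum I M)"
proof -
  have 0: "hilbert_subspace {0 :: 'b}" by (simp add: hilbert_subspace_def cvec.subspace_single_0)
  have "hilbert_subspace {f \<in> UNIV. Rep_l2 f j \<in> (if j \<in> I then M j else {0})}" for j
    using assms 0 by (intro hilbert_subspace_vimage[OF Rep_l2_bounded_ops]) auto
  then have "closed (\<Inter>j. {f. Rep_l2 f j \<in> (if j \<in> I then M j else {0})})"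
     "csubspace (\<Inter>j. {f. Rep_l2 f j \<in> (if j \<in> I then M j else {0})})"
    by (auto simp: hilbert_subspace_def intro!: closed_INT cvec.subspace_Int)
  moreover have "(\<Inter>j. {f. Rep_l2 f j \<in> (if j \<in> I then M j else {0})}) = hsum I M"
    by (auto simp: hsum_def split: if_splits; metis)
  ultimately show ?thesis by (simp add: hilbert_subspace_def)
qed

text \<open>A way to assemble components into an element of the direct sum. For infinite I the
  argument of \<open>Abs_l2\<close> might fail to be square summable, hence the finiteness in
  \<open>Rep_tuple\<close>.\<close>

definition tuple :: "'j set \<Rightarrow> ('j \<Rightarrow> 'a::chilbert_space) \<Rightarrow> ('j, 'a) l2" where
  "tuple I f = Abs_l2 (\<lambda>j. if j \<in> I then f j else 0)"

lemma Rep_tuple [simp]: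
  assumes "finite I"
  shows "Rep_l2 (tuple I f) j = (if j \<in> I then f j else 0)"
proof -
  have "(\<lambda>j. (norm (if j \<in> I then f j else 0))\<^sup>2) summable_on I" using assms by simp
  then have "(\<lambda>j. (norm (if j \<in> I then f j else 0))\<^sup>2) summable_on UNIV"
    by (subst summable_on_cong_neutral[where T = I]) auto
  then show ?thesis unfolding tuple_def by (subst Abs_l2_inverse) auto
qed

lemma hsum_op_eq_tuple: "hsum_op I T f = tuple I (\<lambda>j. T j (Rep_l2 f j))"
  by (simp add: hsum_op_def tuple_def)

lemma Rep_hsum_op [simp]:
  "finite I \<Longrightarrow> Rep_l2 (hsum_op I T f) j = (if j \<in> I then T j (Rep_l2 f j) else 0)"
  by (simp add: hsum_op_eq_tuple)

lemma norm_square_hsum: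
  assumes "finite I" "f \<in> hsum I M"
  shows "(norm f)\<^sup>2 = (\<Sum>j\<in>I. (norm (Rep_l2 f j))\<^sup>2)"
proof -
  have "complex_of_real ((norm f)\<^sup>2) = of_real (\<Sum>j\<in>I. (norm (Rep_l2 f j))\<^sup>2)"
    unfolding cinner_self[symmetric] cinner_hsum[OF assms] of_real_sum ..
  then show ?thesis by (simp only: of_real_eq_iff)
qed

lemma norm_square_eqI:
  assumes "cinner x x = cinner y y" shows "norm x = norm y"
proof -
  have "(norm x)\<^sup>2 = (norm y)\<^sup>2" using assms by (simp only: cinner_self of_real_eq_iff)
  then show ?thesis by simp
qed

section \<open>The left and right regular representations\<close>

lemma xi_eq_single: "\<xi> w = l2_single w 1"
  by (rule l2_eqI) (simp add: \<xi>.rep_eq)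

lemma cinner_xi: "cinner f (\<xi> w) = Rep_l2 f w"
  by (simp add: xi_eq_single cinner_l2_single cinner_complex_def)

lemma norm_xi [simp]: "norm (\<xi> w) = 1"
proof -
  have "cinner (\<xi> w) (\<xi> w) = 1" by (simp add: cinner_xi \<xi>.rep_eq)
  then have "(norm (\<xi> w))\<^sup>2 = 1" by (simp only: cinner_self of_real_eq_1_iff)
  then show ?thesis by (simp add: power2_eq_1_iff) (metis norm_ge_zero not_one_le_zero neg_0_le_iff_le)
qed

text \<open>Covers both \<open>L_op\<close> and \<open>R_mul\<close>: each moves coefficients along
  an injection of words and puts zeros elsewhere.\<close>

lemma norm_l2_reindex:
  assumes inj: "inj h" and eq: "\<And>u. Rep_l2 g (h u) = Rep_l2 f u" and 0: "\<And>u. u \<notin> range h \<Longrightarrow> Rep_l2 g u = 0"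
  shows "norm g = norm f"
proof -
  have "(\<Sum>\<^sub>\<infinity>u. (norm (Rep_l2 g u))\<^sup>2) = (\<Sum>\<^sub>\<infinity>u\<in>range h. (norm (Rep_l2 g u))\<^sup>2)"
    by (rule infsum_cong_neutral) (auto simp: 0)
  also have "\<dots> = (\<Sum>\<^sub>\<infinity>u. (norm (Rep_l2 f u))\<^sup>2)"
    by (subst infsum_reindex[OF inj]) (simp add: o_def eq)
  finally show ?thesis by (simp add: norm_l2.rep_eq)
qed

lemma Rep_L_op [simp]: "Rep_l2 (L_op i f) [] = 0" "Rep_l2 (L_op i f) (j # v) = (if j = i then Rep_l2 f v else 0)"
  by (simp_all add: L_op.rep_eq)

lemma isometry_L_op: "isometry_on UNIV UNIV (L_op i)"
proof -
  have n: "norm (L_op i f) = norm f" for f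
    by (rule norm_l2_reindex[of "(#) i"]) (auto simp: L_op.rep_eq split: list.splits)
  have "L_op i \<in> bounded_ops UNIV UNIV"
    by (rule bounded_opsI[where K = 1])
      (auto simp: n L_op.rep_eq scaleC_complex_def split: list.splits intro!: l2_eqI)
  with n show ?thesis by (simp add: isometry_on_def)
qed

lemmas L_op_bounded [simp] = isometry_onD(1)[OF isometry_L_op]

lemma word_L_bounded [simp]: "word_op L_op w \<in> bounded_ops UNIV UNIV"
  by (intro word_op_bounded) simp

lemma word_L_xi: "word_op L_op w (\<xi> u) = \<xi> (w @ u)"
  by (induction w) (auto simp: L_op_xi)

lemma cinner_L_op_neq: "i \<noteq> j \<Longrightarrow> cinner (L_op i f) (L_op j g) = 0"
  unfolding cinner_l2.rep_eq by (intro infsum_0) (auto simp: L_op.rep_eq split: list.splits)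

abbreviation Ls :: "'n \<Rightarrow> 'n fock \<Rightarrow> 'n fock" where "Ls i \<equiv> adj UNIV (L_op i)"

lemma Rep_word_L_adj: "Rep_l2 (adj UNIV (word_op L_op w) f) u = Rep_l2 f (w @ u)"
  by (simp add: cinner_xi[symmetric] adj[OF hilbert_subspace_UNIV word_L_bounded] word_L_xi)

lemma Rep_Ls [simp]: "Rep_l2 (Ls i f) u = Rep_l2 f (i # u)"
  by (simp add: cinner_xi[symmetric] adj[OF hilbert_subspace_UNIV L_op_bounded] L_op_xi)

lemma cinner_Ls: "cinner f (Ls i g) = cinner (L_op i f) g" "cinner (Ls i f) g = cinner f (L_op i g)"
  by (auto simp: adj[OF hilbert_subspace_UNIV L_op_bounded])

lemma Ls_bounded: "Ls i \<in> bounded_ops UNIV UNIV"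
  by (rule adj_bounded[OF hilbert_subspace_UNIV L_op_bounded])

text \<open>Words are sorted by their first letter, with the empty word apart: the identity minus
  the sum of \<open>L_op i \<circ> Ls i\<close> is the projection onto the vacuum vector.\<close>

lemma fock_expand: "f = Rep_l2 f [] *\<^sub>C \<xi> [] + (\<Sum>i\<in>UNIV. L_op i (Ls i f))" for f :: "'n::finite fock"
proof (rule l2_eqI)
  fix u show "Rep_l2 f u = Rep_l2 (Rep_l2 f [] *\<^sub>C \<xi> [] + (\<Sum>i\<in>UNIV. L_op i (Ls i f))) u"
    by (cases u) (auto simp: \<xi>.rep_eq scaleC_complex_def)
qed

lemma fock_dense:
  assumes "hilbert_subspace N" "\<And>w. \<xi> w \<in> N"
  shows "N = UNIV"
proof (rule hilbert_subspace_eqI[OF hilbert_subspace_UNIV assms(1)])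
  fix x assume "\<And>y. y \<in> N \<Longrightarrow> cinner x y = 0"
  then have "Rep_l2 x w = 0" for w using assms(2) by (simp add: cinner_xi[symmetric])
  then show "x = 0" by (intro l2_eqI) simp
qed simp

text \<open>The right creation operator: the coefficient at v moves to v @ w, and
  \<open>take\<close> recovers v from v @ w.\<close>

lift_definition R_mul :: "'n list \<Rightarrow> 'n fock \<Rightarrow> 'n fock" is
  "\<lambda>w f u. if suffix w u then f (take (length u - length w) u) else 0"
proof -
  fix w :: "'n list" and f :: "'n list \<Rightarrow> complex"
  assume f: "(\<lambda>w. (norm (f w))\<^sup>2) summable_on UNIV"
  let ?g = "\<lambda>u. (norm (if suffix w u then f (take (length u - length w) u) else 0))\<^sup>2"
  have "?g \<circ> (\<lambda>v. v @ w) = (\<lambda>w. (norm (f w))\<^sup>2)" by (auto simp: suffix_def)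
  with f have "?g summable_on range (\<lambda>v. v @ w)" by (subst summable_on_reindex) (auto simp: inj_def)
  then show "?g summable_on UNIV"
    by (subst summable_on_cong_neutral[where T = "range (\<lambda>v. v @ w)"]) (auto simp: suffix_def)
qed

lemma isometry_R_mul: "isometry_on UNIV UNIV (R_mul w)"
proof -
  have n: "norm (R_mul w f) = norm f" for f
    by (rule norm_l2_reindex[of "\<lambda>v. v @ w"]) (auto simp: R_mul.rep_eq suffix_def inj_def)
  have "R_mul w \<in> bounded_ops UNIV UNIV"
    by (rule bounded_opsI[where K = 1])
      (auto simp: n R_mul.rep_eq scaleC_complex_def intro!: l2_eqI)
  with n show ?thesis by (simp add: isometry_on_def)
qed

lemmas R_mul_bounded = isometry_onD(1)[OF isometry_R_mul]

lemma R_mul_xi: "R_mul w (\<xi> u) = \<xi> (u @ w)"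
  by (rule l2_eqI) (auto simp: R_mul.rep_eq \<xi>.rep_eq suffix_def)

lemma L_op_R_mul: "L_op i (R_mul w f) = R_mul w (L_op i f)"
proof (rule l2_eqI)
  fix u show "Rep_l2 (L_op i (R_mul w f)) u = Rep_l2 (R_mul w (L_op i f)) u"
  proof (cases u)
    case (Cons k v)
    show ?thesis
    proof (cases "suffix w v")
      case True
      then obtain z where "v = z @ w" by (auto simp: suffix_def)
      then show ?thesis using Cons by (auto simp: R_mul.rep_eq suffix_def)
    next
      case False
      then show ?thesis using Cons
        by (auto simp: R_mul.rep_eq suffix_Cons)
    qed
  qed (auto simp: R_mul.rep_eq)
qed

lemma cinner_R_mul_orthogonal:
  assumes "\<And>u v. u @ w \<noteq> v @ w'"
  shows "cinner (R_mul w f) (R_mul w' g) = 0"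
  unfolding cinner_l2.rep_eq using assms by (intro infsum_0) (auto simp: R_mul.rep_eq suffix_def)

section \<open>The weak operator topology\<close>

lemma topspace_wot: "topspace (wot V) = bounded_ops V V"
  by (auto simp: wot_def topspace_pullback_topology)

lemma continuous_map_wot:
  assumes "x \<in> V" "y \<in> V"
  shows "continuous_map (wot V) euclidean (\<lambda>T. cinner (T x) y)"
proof -
  have "continuous_map (product_topology (\<lambda>_. euclidean) (V \<times> V)) euclidean (\<lambda>h :: 'a \<times> 'a \<Rightarrow> complex. h (x, y))"
    using assms by (intro continuous_map_product_projection) auto
  from continuous_map_pullback[OF this, of "bounded_ops V V" "\<lambda>T. restrict (\<lambda>(x, y). cinner (T x) y) (V \<times> V)"]
  show ?thesis unfolding wot_def using assms by (simp add: o_def)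
qed

lemma limitin_wot:
  "limitin (wot V) f l F \<longleftrightarrow> l \<in> bounded_ops V V \<and> (\<forall>\<^sub>F k in F. f k \<in> bounded_ops V V)
     \<and> (\<forall>x\<in>V. \<forall>y\<in>V. ((\<lambda>k. cinner (f k x) y) \<longlongrightarrow> cinner (l x) y) F)" (is "?L \<longleftrightarrow> ?R")
proof
  assume L: ?L
  have "((\<lambda>k. cinner (f k x) y) \<longlongrightarrow> cinner (l x) y) F" if "x \<in> V" "y \<in> V" for x y
    using continuous_map_limit[OF continuous_map_wot[OF that] L] by (simp add: o_def)
  moreover have "\<forall>\<^sub>F k in F. f k \<in> bounded_ops V V"
    using L openin_topspace[of "wot V"] unfolding limitin_def topspace_wot by blast
  ultimately show ?R using limitin_topspace[OF L] by (simp add: topspace_wot)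
next
  assume R: ?R
  define h where "h = (\<lambda>T :: 'a \<Rightarrow> 'a. restrict (\<lambda>(x, y). cinner (T x) y) (V \<times> V))"
  define X where "X = product_topology (\<lambda>_ :: 'a \<times> 'a. euclidean :: complex topology) (V \<times> V)"
  have lim: "limitin X (\<lambda>k. h (f k)) (h l) F"
    unfolding X_def limitin_componentwise using R by (auto simp: h_def)
  show ?L unfolding limitin_def
  proof (intro conjI allI impI)
    show "l \<in> topspace (wot V)" using R by (simp add: topspace_wot)
    fix U assume U: "openin (wot V) U \<and> l \<in> U"
    then obtain W where W: "openin X W" "U = h -` W \<inter> bounded_ops V V"
      by (auto simp: wot_def openin_pullback_topology X_def h_def)
    have "\<forall>\<^sub>F k in F. h (f k) \<in> W" using lim W U by (auto simp: limitin_def)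
    with R show "\<forall>\<^sub>F k in F. f k \<in> U"
      by (auto simp: W(2) elim: eventually_elim2)
  qed
qed

text \<open>Together with \<open>closedin_invariant\<close> this makes the operators whose
  amplification preserves N a competitor in the intersection that defines \<open>L_alg\<close>. N is
  cut down to vectors supported on I because \<open>hsum_op\<close> truncates to I, so that the
  amplified identity fixes only those.\<close>

lemma unital_algebra_invariant:
  fixes N :: "('j, 'h::chilbert_space) l2 set"
  assumes I: "finite I" and N: "hilbert_subspace N"
  defines "\<A> \<equiv> {X \<in> bounded_ops UNIV UNIV. hsum_op I (\<lambda>_. X) ` (N \<inter> hsum I (\<lambda>_. UNIV)) \<subseteq> N}"
  shows "unital_algebra UNIV \<A>"
  unfolding unital_algebra_def
proof (intro conjI ballI allI)
  let ?H = "hsum I (\<lambda>_. UNIV) :: ('j, 'h) l2 set"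
  have H: "hsum_op I (\<lambda>_. X) f \<in> ?H" for X f using I by (auto simp: hsum_def)
  show "\<A> \<subseteq> bounded_ops UNIV UNIV" by (auto simp: \<A>_def)
  have "hsum_op I (\<lambda>_. id) f = f" if "f \<in> ?H" for f
    using that I by (intro l2_eqI) (auto simp: hsum_def)
  then show "id \<in> \<A>" by (auto simp: \<A>_def bounded_ops_id)
  fix S T and c :: complex assume S: "S \<in> \<A>" and T: "T \<in> \<A>"
  have eq: "hsum_op I (\<lambda>_ x. S x + T x) f = hsum_op I (\<lambda>_. S) f + hsum_op I (\<lambda>_. T) f"
    "hsum_op I (\<lambda>_. S \<circ> T) f = hsum_op I (\<lambda>_. S) (hsum_op I (\<lambda>_. T) f)"
    "hsum_op I (\<lambda>_ x. c *\<^sub>C T x) f = c *\<^sub>C hsum_op I (\<lambda>_. T) f" for f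
    using I by (auto intro!: l2_eqI)
  have NI: "hsum_op I (\<lambda>_. S) f \<in> N" "hsum_op I (\<lambda>_. T) f \<in> N" if "f \<in> N" "f \<in> ?H" for f
    using S T that by (auto simp: \<A>_def)
  have B: "S \<in> bounded_ops UNIV UNIV" "T \<in> bounded_ops UNIV UNIV" using S T by (auto simp: \<A>_def)
  show "(\<lambda>x. S x + T x) \<in> \<A>" using B NI
    by (auto simp: \<A>_def eq hilbert_subspaceD[OF N] intro!: bounded_ops_add)
  show "S \<circ> T \<in> \<A>" using B NI H by (auto simp: \<A>_def eq simp del: o_apply intro: bounded_ops_comp)
  show "(\<lambda>x. c *\<^sub>C T x) \<in> \<A>" using B NI
    by (auto simp: \<A>_def eq hilbert_subspaceD[OF N] intro!: bounded_ops_scaleC)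
qed

text \<open>X preserves N exactly when the pairings of its amplification with f in N and g
  orthogonal to N all vanish. As I is finite, each pairing is a finite sum of matrix coefficients of
  X, hence continuous in the weak operator topology.\<close>

lemma closedin_invariant:
  fixes N :: "('j, 'h::chilbert_space) l2 set"
  assumes I: "finite I" and N: "hilbert_subspace N"
  defines "\<A> \<equiv> {X \<in> bounded_ops UNIV UNIV. hsum_op I (\<lambda>_. X) ` (N \<inter> hsum I (\<lambda>_. UNIV)) \<subseteq> N}"
  shows "closedin (wot UNIV) \<A>"
proof -
  let ?H = "hsum I (\<lambda>_. UNIV) :: ('j, 'h) l2 set"
  define F where "F f g = {X \<in> topspace (wot UNIV). (\<Sum>j\<in>I. cinner (X (Rep_l2 f j)) (Rep_l2 g j)) \<in> {0}}"
    for f g :: "('j, 'h) l2"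
  have "closedin (wot UNIV) (F f g)" for f g
    unfolding F_def
  proof (rule closedin_continuous_map_preimage)
    show "continuous_map (wot UNIV) euclidean (\<lambda>X. \<Sum>j\<in>I. cinner (X (Rep_l2 f j)) (Rep_l2 g j))"
      by (intro continuous_map_sum I continuous_map_wot) auto
  qed simp
  then have "closedin (wot UNIV) (\<Inter>p\<in>{p. fst p \<in> N \<inter> ?H \<and> snd p \<in> UNIV \<ominus> N}. F (fst p) (snd p))"
    using hilbert_subspaceD(3)[OF N] by (intro closedin_INT) (auto simp: ocompl_in_def hsum_def intro!: exI[of _ 0])
  also have "(\<Inter>p\<in>{p. fst p \<in> N \<inter> ?H \<and> snd p \<in> UNIV \<ominus> N}. F (fst p) (snd p)) = \<A>" (is "?A = _")
  proof -
    have c: "(\<Sum>j\<in>I. cinner (X (Rep_l2 f j)) (Rep_l2 g j)) = cinner (hsum_op I (\<lambda>_. X) f) g" for X f g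
      using I by (subst cinner_l2_finite[OF I]) auto
    have N': "x \<in> N \<longleftrightarrow> (\<forall>g\<in>UNIV \<ominus> N. cinner x g = 0)" for x
      by (subst ocompl_ocompl[OF hilbert_subspace_UNIV N subset_UNIV, symmetric]) (simp add: ocompl_in_def)
    \<comment> \<open>With nonempty index sets the intersection stays inside
      \<open>bounded_ops UNIV UNIV\<close>.\<close>
    have ne: "0 \<in> N \<inter> ?H" "0 \<in> UNIV \<ominus> N"
      using hilbert_subspaceD(3)[OF N] by (auto simp: hsum_def ocompl_in_def)
    have "X \<in> ?A \<longleftrightarrow> (\<forall>f\<in>N \<inter> ?H. \<forall>g\<in>UNIV \<ominus> N. X \<in> F f g)" for X by auto
    also have "\<dots> X \<longleftrightarrow> X \<in> bounded_ops UNIV UNIV \<and> (\<forall>f\<in>N \<inter> ?H. \<forall>g\<in>UNIV \<ominus> N. cinner (hsum_op I (\<lambda>_. X) f) g = 0)" for X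
      unfolding F_def c topspace_wot using ne by blast
    also have "\<dots> X \<longleftrightarrow> X \<in> \<A>" for X unfolding \<A>_def N'[symmetric] by blast
    finally show ?thesis by blast
  qed
  finally show ?thesis .
qed

text \<open>Later transfers of invariance or commutation from the shifts to \<open>L_alg\<close> all
  reduce to this, for a suitable N and I; no approximation of elements of \<open>L_alg\<close> by
  polynomials in the shifts takes place.\<close>

lemma L_alg_invariant:
  assumes I: "finite I" and N: "hilbert_subspace N" "N \<subseteq> hsum I (\<lambda>_. UNIV)"
    and L: "\<And>i f. f \<in> N \<Longrightarrow> hsum_op I (\<lambda>_. L_op i) f \<in> N"
    and X: "X \<in> L_alg" and f: "f \<in> N"
  shows "hsum_op I (\<lambda>_. X) f \<in> N"
proof -
  have "L_alg \<subseteq> {X \<in> bounded_ops UNIV UNIV. hsum_op I (\<lambda>_. X) ` (N \<inter> hsum I (\<lambda>_. UNIV)) \<subseteq> N}"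
    unfolding L_alg_def using closedin_invariant[OF I N(1)] unital_algebra_invariant[OF I N(1)] L
    by (intro Inter_lower) auto
  with X f N(2) show ?thesis by auto
qed

text \<open>For empty I the invariance condition is vacuous, so the two preceding results say that
  the bounded operators themselves form a closed unital algebra.\<close>

lemma L_alg_bounded: "L_alg \<subseteq> bounded_ops UNIV UNIV"
proof -
  have "hilbert_subspace (UNIV :: (unit, 'a fock) l2 set)" by simp
  from closedin_invariant[OF finite.emptyI this] unital_algebra_invariant[OF finite.emptyI this]
  show ?thesis unfolding L_alg_def by (intro Inter_lower) auto
qed

lemma L_alg_unital: "unital_algebra UNIV (L_alg :: ('n fock \<Rightarrow> 'n fock) set)"
  using L_alg_bounded[where 'a = 'n] unfolding unital_algebra_def
  by (auto simp: L_alg_def unital_algebra_def)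

lemma L_op_L_alg: "L_op i \<in> L_alg"
  by (auto simp: L_alg_def)

lemma L_alg_closed:
  "id \<in> L_alg" "S \<in> L_alg \<Longrightarrow> T \<in> L_alg \<Longrightarrow> (\<lambda>x. S x + T x) \<in> L_alg"
  "S \<in> L_alg \<Longrightarrow> T \<in> L_alg \<Longrightarrow> S \<circ> T \<in> L_alg" "T \<in> L_alg \<Longrightarrow> (\<lambda>x. c *\<^sub>C T x) \<in> L_alg"
  using L_alg_unital by (auto simp only: unital_algebra_def)

lemma word_L_alg: "word_op L_op w \<in> L_alg"
  by (induction w) (simp_all only: word_op_simps L_alg_closed L_op_L_alg)

lemma L_alg_invariant_fock:
  assumes N: "hilbert_subspace N" and L: "\<And>i f. f \<in> N \<Longrightarrow> L_op i f \<in> N" and X: "X \<in> L_alg" and f: "f \<in> N"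
  shows "X f \<in> N"
proof -
  have "hsum_op {()} (\<lambda>_. X) (l2_single () f) \<in> hsum {()} (\<lambda>_. N)"
    by (rule L_alg_invariant[OF _ hilbert_subspace_hsum[OF N] _ _ X]) (use f L in \<open>auto simp: hsum_def\<close>)
  then show ?thesis by (simp add: hsum_def)
qed

lemma Lat_LI: "hilbert_subspace N \<Longrightarrow> (\<And>i f. f \<in> N \<Longrightarrow> L_op i f \<in> N) \<Longrightarrow> N \<in> Lat_L"
  unfolding Lat_L_def using L_alg_invariant_fock[of N] by (auto simp del: o_apply)

text \<open>Commutation with \<open>L_op\<close> is invariance of the graph, hence passes to the whole algebra.\<close>

lemma R_algI:
  assumes R: "R \<in> bounded_ops UNIV UNIV" and L: "\<And>i f. R (L_op i f) = L_op i (R f)"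
  shows "R \<in> R_alg"
proof -
  have "R (X f) = X (R f)" if X: "X \<in> L_alg" for X f
  proof -
    define N where "N = {g \<in> UNIV :: (bool, 'a fock) l2 set. Rep_l2 g True + (- 1) *\<^sub>C R (Rep_l2 g False) \<in> {0}}"
    have "(\<lambda>g. Rep_l2 g True + (- 1) *\<^sub>C R (Rep_l2 g False)) \<in> bounded_ops UNIV UNIV"
      using bounded_ops_comp[OF Rep_l2_bounded_ops R, of False]
      by (intro bounded_ops_add bounded_ops_scaleC Rep_l2_bounded_ops) (auto simp: o_def)
    then have N: "hilbert_subspace N" unfolding N_def
      by (rule hilbert_subspace_vimage) (auto simp: hilbert_subspace_def cvec.subspace_single_0)
    have iff: "g \<in> N \<longleftrightarrow> Rep_l2 g True = R (Rep_l2 g False)" for g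
      by (simp add: N_def scaleC_minus_one)
    have H: "hsum UNIV (\<lambda>_. UNIV) = UNIV" by (auto simp: hsum_def)
    have "hsum_op UNIV (\<lambda>_. X) (tuple UNIV (\<lambda>b. if b then R f else f)) \<in> N"
      by (rule L_alg_invariant[OF _ N _ _ X]) (auto simp: H iff L)
    then show ?thesis by (simp add: iff)
  qed
  then show ?thesis using R by (auto simp: R_alg_def)
qed

lemma R_mul_R_alg: "R_mul w \<in> R_alg"
  by (rule R_algI[OF R_mul_bounded]) (rule L_op_R_mul[symmetric])

text \<open>The point is the uniqueness in the definite description: the set where two candidates
  agree is a closed subspace containing every basis vector.\<close>

lemma R_op_xi: "R_op (\<xi> w) = R_mul w"
  unfolding R_op_def
proof (rule the_equality)
  show "R_mul w \<in> R_alg \<and> isometry_on UNIV UNIV (R_mul w) \<and> (\<forall>u. R_mul w (\<xi> u) = word_op L_op u (\<xi> w))"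
    by (auto simp: R_mul_R_alg isometry_R_mul R_mul_xi word_L_xi)
  fix R assume R: "R \<in> R_alg \<and> isometry_on UNIV UNIV R \<and> (\<forall>u. R (\<xi> u) = word_op L_op u (\<xi> w))"
  then have RB: "R \<in> bounded_ops UNIV UNIV" by (auto simp: isometry_on_def)
  have "(\<lambda>x. R x + (- 1) *\<^sub>C R_mul w x) \<in> bounded_ops UNIV UNIV"
    by (intro bounded_ops_add bounded_ops_scaleC RB R_mul_bounded) auto
  then have "hilbert_subspace {x \<in> UNIV. R x + (- 1) *\<^sub>C R_mul w x \<in> {0}}"
    by (rule hilbert_subspace_vimage) (auto simp: hilbert_subspace_def cvec.subspace_single_0)
  then have "{x \<in> UNIV. R x + (- 1) *\<^sub>C R_mul w x \<in> {0}} = UNIV"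
    by (rule fock_dense) (use R in \<open>auto simp: R_mul_xi word_L_xi scaleC_minus_one\<close>)
  then show "R = R_mul w" by (auto simp: scaleC_minus_one)
qed

lemma wandering_xi: "wandering (\<xi> w)"
  by (auto simp: wandering_def word_L_xi cinner_xi \<xi>.rep_eq)

lemma range_R_mul_Lat: "range (R_mul w) \<in> Lat_L"
  by (rule Lat_LI[OF isometry_on_image_hilbert[OF isometry_R_mul]]) (auto simp: L_op_R_mul)

section \<open>Amplifications and co-invariant embeddings\<close>

text \<open>\<open>L_alg_invariant\<close> speaks about \<open>L_alg\<close> and not about its
  adjoints. The complement of K in the amplified space is invariant for the shifts, hence for X, and
  taking the complement once more returns to K.\<close>

lemma coinvariant_L_alg:
  assumes I: "finite I" and K: "hilbert_subspace K" "K \<subseteq> hsum I (\<lambda>_. UNIV)"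
    and L: "\<And>i f. f \<in> K \<Longrightarrow> hsum_op I (\<lambda>_. Ls i) f \<in> K"
    and X: "X \<in> L_alg" and f: "f \<in> K"
  shows "hsum_op I (\<lambda>_. adj UNIV X) f \<in> K"
proof -
  let ?H = "hsum I (\<lambda>_. UNIV) :: ('a, 'b fock) l2 set"
  have H: "hilbert_subspace ?H" by (rule hilbert_subspace_hsum) simp
  have adj': "cinner (hsum_op I (\<lambda>_. adj UNIV Y) g) h = cinner g (hsum_op I (\<lambda>_. Y) h)"
    "cinner h (hsum_op I (\<lambda>_. adj UNIV Y) g) = cinner (hsum_op I (\<lambda>_. Y) h) g"
    if "Y \<in> bounded_ops UNIV UNIV" "g \<in> ?H" "h \<in> ?H" for Y g h
    using that I by (simp_all add: cinner_hsum cinner_l2_finite adj[OF hilbert_subspace_UNIV])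
  have op: "hsum_op I T g \<in> ?H" for T g using I by (auto simp: hsum_def)
  define N where "N = ?H \<ominus> K"
  have N: "hilbert_subspace N" unfolding N_def by (rule hilbert_subspace_ocompl[OF H])
  have XN: "hsum_op I (\<lambda>_. X) g \<in> N" if "g \<in> N" for g
  proof (rule L_alg_invariant[OF I N _ _ X that])
    fix i h assume h: "h \<in> N"
    have "cinner (hsum_op I (\<lambda>_. L_op i) h) k = 0" if "k \<in> K" for k
      using adj'(2)[of "L_op i" k h] h that K(2) L[OF that] by (auto simp: N_def ocompl_in_def)
    then show "hsum_op I (\<lambda>_. L_op i) h \<in> N" by (simp add: N_def ocompl_in_def op)
  qed (auto simp: N_def ocompl_in_def)
  have XB: "X \<in> bounded_ops UNIV UNIV" using X L_alg_bounded by blast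
  have "cinner (hsum_op I (\<lambda>_. adj UNIV X) f) g = 0" if g: "g \<in> N" for g
  proof -
    have "cinner (hsum_op I (\<lambda>_. X) g) f = 0" using XN[OF g] f by (simp add: N_def ocompl_in_def)
    then show ?thesis using adj'(1)[OF XB, of f g] f K(2) g
      cinner_eq_zero_commute[of "hsum_op I (\<lambda>_. X) g" f] by (auto simp: N_def ocompl_in_def)
  qed
  then have "hsum_op I (\<lambda>_. adj UNIV X) f \<in> ?H \<ominus> N" by (simp add: ocompl_in_def op)
  then show ?thesis unfolding N_def using ocompl_ocompl[OF H K] by simp
qed

section \<open>Amplified left shifts\<close>

lemma fock_sum_hilbert: "hilbert_subspace (fock_sum r)"
  unfolding fock_sum_def by (rule hilbert_subspace_hsum) simp

lemma fock_sum_iff: "f \<in> fock_sum r \<longleftrightarrow> (\<forall>k. k \<notin> {1..r} \<longrightarrow> Rep_l2 f k = 0)"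
  by (auto simp: fock_sum_def hsum_def)

lemma fock_sum_eqI:
  "f \<in> fock_sum r \<Longrightarrow> g \<in> fock_sum r \<Longrightarrow> (\<And>k. k \<in> {1..r} \<Longrightarrow> Rep_l2 f k = Rep_l2 g k) \<Longrightarrow> f = g"
  by (rule l2_eqI) (metis fock_sum_iff)

lemma Rep_ampl: "Rep_l2 (ampl r X f) k = (if k \<in> {1..r} then X (Rep_l2 f k) else 0)"
  by (simp add: ampl_def)

lemma ampl_in_fock_sum [simp]: "ampl r X f \<in> fock_sum r"
  unfolding fock_sum_iff by (simp add: Rep_ampl)

lemma tuple_in_fock_sum [simp]: "tuple {1..r} f \<in> fock_sum r"
  unfolding fock_sum_iff by simp

lemma cinner_fock_sum:
  "f \<in> fock_sum r \<Longrightarrow> cinner f g = (\<Sum>k\<in>{1..r}. cinner (Rep_l2 f k) (Rep_l2 g k))"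
  unfolding fock_sum_def by (rule cinner_hsum) auto

lemma cinner_ampl: "cinner (ampl r X f) g = (\<Sum>k\<in>{1..r}. cinner (X (Rep_l2 f k)) (Rep_l2 g k))"
  by (subst cinner_fock_sum[OF ampl_in_fock_sum]) (simp add: Rep_ampl)

lemma isometry_ampl_L: "isometry_on (fock_sum r) (fock_sum r) (ampl r (L_op i))"
proof -
  have n: "norm (ampl r (L_op i) f) = norm f" if f: "f \<in> fock_sum r" for f
    using f by (intro norm_square_eqI)
      (simp add: cinner_ampl cinner_fock_sum Rep_ampl isometry_on_cinner[OF isometry_L_op])
  have "ampl r (L_op i) \<in> bounded_ops (fock_sum r) (fock_sum r)"
    by (rule bounded_opsI[where K = 1]) (auto simp: n Rep_ampl bounded_opsD[OF L_op_bounded] intro!: l2_eqI)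
  with n show ?thesis by (simp add: isometry_on_def)
qed

lemma adj_ampl_L: "adj (fock_sum r) (ampl r (L_op i)) f = ampl r (Ls i) f"
  by (rule adj_eqI[OF fock_sum_hilbert]) (simp_all add: cinner_ampl cinner_fock_sum Rep_ampl cinner_Ls)

lemma word_ampl: "f \<in> fock_sum r \<Longrightarrow> word_op (\<lambda>i. ampl r (L_op i)) w f = ampl r (word_op L_op w) f"
proof (induction w)
  case Nil then show ?case by (intro l2_eqI) (simp add: Rep_ampl fock_sum_iff)
next
  case (Cons i w) then show ?case by (intro l2_eqI) (simp add: Rep_ampl)
qed

text \<open>The intertwining condition of a dilation read component by component, since the spaces
  \<open>M j\<close> are built from single components of \<open>J v\<close>.\<close>

definition coinv_embedding ::
    "'v::chilbert_space set \<Rightarrow> ('n::finite \<Rightarrow> 'v \<Rightarrow> 'v) \<Rightarrow> nat \<Rightarrow> ('v \<Rightarrow> (nat, 'n fock) l2) \<Rightarrow> bool" where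
  "coinv_embedding V A r J \<longleftrightarrow> isometry_on V (fock_sum r) J \<and>
     (\<forall>i. \<forall>v\<in>V. \<forall>k\<in>{1..r}. Ls i (Rep_l2 (J v) k) = Rep_l2 (J (adj V (A i) v)) k)"

lemma coinv_embeddingD:
  assumes "coinv_embedding V A r J"
  shows "isometry_on V (fock_sum r) J" "J \<in> bounded_ops V (fock_sum r)" "v \<in> V \<Longrightarrow> J v \<in> fock_sum r"
    "v \<in> V \<Longrightarrow> k \<in> {1..r} \<Longrightarrow> Ls i (Rep_l2 (J v) k) = Rep_l2 (J (adj V (A i) v)) k"
  using assms bounded_opsD(1)[of J V "fock_sum r"] by (auto simp: coinv_embedding_def isometry_on_def)

text \<open>The vacuum components of \<open>J v\<close> determine \<open>J v\<close> up to the ranges of the \<open>ampl r (L_op i)\<close>, so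
  minimality of the dilation amounts to surjectivity of \<open>v \<mapsto> (Rep_l2 (Rep_l2 (J v) k) [])\<^sub>k\<close>.\<close>

definition vacuum_onto :: "'v set \<Rightarrow> nat \<Rightarrow> ('v \<Rightarrow> (nat, 'n fock) l2) \<Rightarrow> bool" where
  "vacuum_onto V r J \<longleftrightarrow> (\<forall>c. \<exists>v\<in>V. \<forall>k\<in>{1..r}. Rep_l2 (Rep_l2 (J v) k) [] = c k)"

lemma coinv_embedding_iff:
  assumes V: "hilbert_subspace V" and A: "\<And>i. A i \<in> bounded_ops V V"
  shows "coinv_embedding V A r J \<longleftrightarrow> isometry_on V (fock_sum r) J \<and>
    (\<forall>i. \<forall>v\<in>V. adj (fock_sum r) (ampl r (L_op i)) (J v) = J (adj V (A i) v))"
proof -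
  have "(\<forall>k\<in>{1..r}. Ls i (Rep_l2 (J v) k) = Rep_l2 (J (adj V (A i) v)) k) \<longleftrightarrow>
      adj (fock_sum r) (ampl r (L_op i)) (J v) = J (adj V (A i) v)"
    if J: "isometry_on V (fock_sum r) J" and v: "v \<in> V" for i v
  proof
    have "J (adj V (A i) v) \<in> fock_sum r"
      using bounded_opsD(1)[OF isometry_onD(1)[OF J]] adj(1)[OF V A] by blast
    moreover assume "\<forall>k\<in>{1..r}. Ls i (Rep_l2 (J v) k) = Rep_l2 (J (adj V (A i) v)) k"
    ultimately show "adj (fock_sum r) (ampl r (L_op i)) (J v) = J (adj V (A i) v)"
      unfolding adj_ampl_L by (intro fock_sum_eqI[of _ r]) (auto simp: Rep_ampl)
  next
    assume "adj (fock_sum r) (ampl r (L_op i)) (J v) = J (adj V (A i) v)"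
    then show "\<forall>k\<in>{1..r}. Ls i (Rep_l2 (J v) k) = Rep_l2 (J (adj V (A i) v)) k"
      unfolding adj_ampl_L by (metis Rep_ampl)
  qed
  then show ?thesis unfolding coinv_embedding_def by blast
qed

lemma coinv_embedding_minimal:
  assumes V: "hilbert_subspace V" and A: "\<And>i. A i \<in> bounded_ops V V"
    and J: "coinv_embedding V A r J" and onto: "vacuum_onto V r J"
  shows "min_isom_dilation V A (fock_sum r) (\<lambda>i. ampl r (L_op i)) J"
proof -
  note JD = coinv_embeddingD[OF J]
  let ?S = "\<lambda>w. word_op (\<lambda>i. ampl r (L_op i)) w"
  define N where "N = closed_cspan {?S w (J v) |w v. v \<in> V}"
  have N: "hilbert_subspace N" unfolding N_def by (rule hilbert_subspace_closed_cspan)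
  have SN: "?S w (J v) \<in> N" if "v \<in> V" for w v
    unfolding N_def by (rule subsetD[OF subset_closed_cspan]) (use that in blast)
  have "N = fock_sum r"
  proof (rule hilbert_subspace_eqI[OF fock_sum_hilbert N])
    show "N \<subseteq> fock_sum r" unfolding N_def
      by (rule closed_cspan_minimal[OF fock_sum_hilbert]) (auto simp: word_ampl JD(3))
    fix f assume f: "f \<in> fock_sum r" "\<And>y. y \<in> N \<Longrightarrow> cinner f y = 0"
    have "Rep_l2 (Rep_l2 f k) w = 0" if k: "k \<in> {1..r}" for k w
    proof -
      obtain v where v: "v \<in> V" "\<forall>l\<in>{1..r}. Rep_l2 (Rep_l2 (J v) l) [] = (if l = k then 1 else 0)"
        using onto[unfolded vacuum_onto_def, rule_format, of "\<lambda>l. if l = k then 1 else 0"] by blast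
      have Av: "adj V (A i) v \<in> V" for i by (rule adj(1)[OF V A])
      \<comment> \<open>By co-invariance the sum is \<open>word_op L_op w\<close> applied in each
        slot to the sum of \<open>L_op i \<circ> Ls i\<close>. What remains is this word applied to
        the vacuum part of \<open>J v\<close>, and v was chosen so that this part is the k-th unit
        vector.\<close>
      have "l2_single k (\<xi> w) = ?S w (J v) - (\<Sum>i\<in>UNIV. ?S (w @ [i]) (J (adj V (A i) v)))" (is "_ = ?R")
      proof (rule fock_sum_eqI)
        show "?R \<in> fock_sum r" unfolding fock_sum_iff using v(1) Av by (auto simp: word_ampl JD(3) Rep_ampl)
        show "l2_single k (\<xi> w) \<in> fock_sum r" unfolding fock_sum_iff using k by auto
        fix l assume l: "l \<in> {1..r}"
        note W = word_L_bounded[of w]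
        have "Rep_l2 ?R l = word_op L_op w (Rep_l2 (J v) l - (\<Sum>i\<in>UNIV. L_op i (Ls i (Rep_l2 (J v) l))))"
          using l v(1) Av by (simp add: word_ampl JD Rep_ampl word_op_append bounded_ops_diff[OF W]
              bounded_ops_sum[OF W])
        also have "Rep_l2 (J v) l - (\<Sum>i\<in>UNIV. L_op i (Ls i (Rep_l2 (J v) l))) = (if l = k then \<xi> [] else 0)"
          using v(2) l by (subst (1) fock_expand) auto
        also have "word_op L_op w (if l = k then \<xi> [] else 0) = (if l = k then \<xi> w else 0)"
          using bounded_ops_zero[OF W] by (simp add: word_L_xi)
        finally show "Rep_l2 (l2_single k (\<xi> w)) l = Rep_l2 ?R l" by simp
      qed
      also have "\<dots> \<in> N" by (intro SN v(1) Av hilbert_subspaceD(5)[OF N] cvec.subspace_sum[OF hilbert_subspaceD(1)[OF N]])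
      finally have "cinner f (l2_single k (\<xi> w)) = 0" using f(2) by blast
      then show ?thesis by (simp add: cinner_l2_single cinner_xi)
    qed
    then have "Rep_l2 f k = 0" if "k \<in> {1..r}" for k using that by (intro l2_eqI) simp
    with f(1) show "f = 0" by (intro fock_sum_eqI[of _ r]) (auto simp: fock_sum_iff)
  qed
  moreover have "orthogonal_sets (ampl r (L_op i) ` fock_sum r) (ampl r (L_op j) ` fock_sum r)" if "i \<noteq> j" for i j :: 'b
    using that by (auto simp: orthogonal_sets_def cinner_ampl Rep_ampl cinner_L_op_neq)
  moreover from J have "isometry_on V (fock_sum r) J"
    "\<forall>i. \<forall>v\<in>V. adj (fock_sum r) (ampl r (L_op i)) (J v) = J (adj V (A i) v)"
    unfolding coinv_embedding_iff[OF V, of A, OF A] by (rule conjunct1, rule conjunct2)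
  ultimately show ?thesis
    unfolding min_isom_dilation_def N_def by (intro conjI allI impI fock_sum_hilbert isometry_ampl_L) simp_all
qed

text \<open>A vector c orthogonal to all vacuum parts gives a vector g, supported on the empty word,
  that is orthogonal to all translates of \<open>J v\<close>: for nonempty w the translate has no
  vacuum part, and for empty w the pairing is the one with c. Minimality then forces g = 0. Since
  the vacuum parts form a linear image of V, the multiplicity is at most d.\<close>

lemma min_isom_dilation_vacuum:
  fixes A :: "'n::finite \<Rightarrow> 'v::chilbert_space \<Rightarrow> 'v"
  assumes V: "has_cdim V d" and A: "\<And>i. A i \<in> bounded_ops V V"
    and D: "min_isom_dilation V A (fock_sum r) (\<lambda>i. ampl r (L_op i)) J"
  shows "coinv_embedding V A r J" "vacuum_onto V r J" "r \<le> d"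
proof -
  note VH = has_cdim_hilbert_subspace[OF V]
  show J: "coinv_embedding V A r J"
    using D unfolding min_isom_dilation_def coinv_embedding_iff[OF VH, of A, OF A] by (elim conjE) (intro conjI)
  note JD = coinv_embeddingD[OF J]
  define ev where "ev v = tuple {1..r} (\<lambda>k. Rep_l2 (Rep_l2 (J v) k) [])" for v
  have ev_add: "ev (x + y) = ev x + ev y" if "x \<in> V" "y \<in> V" for x y
    using that by (intro l2_eqI) (simp add: ev_def bounded_opsD[OF JD(2)])
  have ev_sc: "ev (c *\<^sub>C x) = c *\<^sub>C ev x" if "x \<in> V" for c x
    using that by (intro l2_eqI) (simp add: ev_def bounded_opsD[OF JD(2)])
  obtain m where m: "m \<le> d" "has_cdim (ev ` V) m"
    using has_cdim_image[OF V, of ev] ev_add ev_sc by blast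
  let ?C = "hsum {1..r} (\<lambda>_. UNIV) :: (nat, complex) l2 set"
  have C: "hilbert_subspace ?C" by (rule hilbert_subspace_hsum) simp
  have evV: "ev ` V = ?C"
  proof (rule hilbert_subspace_eqI[OF C has_cdim_hilbert_subspace[OF m(2)]])
    show "ev ` V \<subseteq> ?C" by (auto simp: ev_def hsum_def)
    fix c assume c: "c \<in> ?C" "\<And>y. y \<in> ev ` V \<Longrightarrow> cinner c y = 0"
    define g :: "(nat, 'n fock) l2" where "g = tuple {1..r} (\<lambda>k. Rep_l2 c k *\<^sub>C \<xi> [])"
    have Rg: "Rep_l2 (Rep_l2 g k) [] = Rep_l2 c k" if "k \<in> {1..r}" for k
      using that by (simp add: g_def \<xi>.rep_eq scaleC_complex_def)
    have "word_op (\<lambda>i. ampl r (L_op i)) w (J v) \<in> {x. \<forall>y\<in>{g}. cinner x y = 0}" if v: "v \<in> V" for w v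
    proof -
      have "cinner (word_op L_op w (Rep_l2 (J v) k)) (Rep_l2 c k *\<^sub>C \<xi> [])
        = (if w = [] then cinner (Rep_l2 (ev v) k) (Rep_l2 c k) else 0)" if k: "k \<in> {1..r}" for k
        using k by (cases w) (auto simp: cinner_scaleC_right cinner_xi ev_def cinner_complex_def)
      then have "cinner (word_op (\<lambda>i. ampl r (L_op i)) w (J v)) g
        = (if w = [] then \<Sum>k\<in>{1..r}. cinner (Rep_l2 (ev v) k) (Rep_l2 c k) else 0)"
        using v by (simp add: word_ampl JD(3) cinner_ampl g_def)
      also have "(\<Sum>k\<in>{1..r}. cinner (Rep_l2 (ev v) k) (Rep_l2 c k)) = cinner (ev v) c"
        by (subst cinner_l2_finite[of "{1..r}"]) (auto simp: ev_def)
      also have "\<dots> = 0" using c(2)[of "ev v"] v by (blast intro: cinner_eq_zero_commute)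
      finally show ?thesis by simp
    qed
    then have "closed_cspan {word_op (\<lambda>i. ampl r (L_op i)) w (J v) |w v. v \<in> V} \<subseteq> {x. \<forall>y\<in>{g}. cinner x y = 0}"
      by (intro closed_cspan_minimal hilbert_subspace_ortho) auto
    moreover have "g \<in> fock_sum r" by (simp only: g_def tuple_in_fock_sum)
    moreover have "closed_cspan {word_op (\<lambda>i. ampl r (L_op i)) w (J v) |w v. v \<in> V} = fock_sum r"
      using D by (simp add: min_isom_dilation_def)
    ultimately have "cinner g g = 0" by blast
    then have "g = 0" by simp
    then have "Rep_l2 c k = 0" if "k \<in> {1..r}" for k using Rg[OF that] by simp
    moreover have "Rep_l2 c k = 0" if "k \<notin> {1..r}" for k using c(1) that by (auto simp: hsum_def split: if_splits)
    ultimately show "c = 0" by (intro l2_eqI) (metis zero_l2.rep_eq)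
  qed
  show "vacuum_onto V r J"
    unfolding vacuum_onto_def
  proof
    fix c
    have "tuple {1..r} c \<in> ev ` V" unfolding evV by (auto simp: hsum_def)
    then obtain v where "v \<in> V" "tuple {1..r} c = ev v" by blast
    have "Rep_l2 (Rep_l2 (J v) k) [] = c k" if k: "k \<in> {1..r}" for k
    proof -
      have "Rep_l2 (ev v) k = Rep_l2 (tuple {1..r} c) k" using \<open>tuple {1..r} c = ev v\<close> by simp
      then show ?thesis using k by (simp add: ev_def)
    qed
    then show "\<exists>v\<in>V. \<forall>k\<in>{1..r}. Rep_l2 (Rep_l2 (J v) k) [] = c k" using \<open>v \<in> V\<close> by blast
  qed
  let ?e = "\<lambda>k. l2_single k (1 :: complex)"
  have inj: "inj_on ?e {1..r}"
    by (rule inj_onI) (metis l2_single.rep_eq zero_neq_one)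
  have "cindependent (?e ` {1..r})"
  proof (rule ccontr)
    assume "\<not> cindependent (?e ` {1..r})"
    then obtain u l where u: "l \<in> {1..r}" "u (?e l) \<noteq> 0" "(\<Sum>v\<in>?e ` {1..r}. u v *\<^sub>C v) = 0"
      by (simp only: cindependent_def not_not) (subst (asm) cvec.dependent_finite, auto)
    have "(\<Sum>k\<in>{1..r}. u (?e k) *\<^sub>C ?e k) = 0" using u(3) inj by (simp add: sum.reindex)
    then have "Rep_l2 (\<Sum>k\<in>{1..r}. u (?e k) *\<^sub>C ?e k) l = 0" by simp
    then have "(\<Sum>k\<in>{1..r}. if l = k then u (?e k) else 0) = 0"
      by (simp add: scaleC_complex_def if_distrib cong: if_cong)
    then show False using u(1,2) by simp
  qed
  moreover have "?e ` {1..r} \<subseteq> ev ` V" unfolding evV by (auto simp: hsum_def)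
  ultimately have "card (?e ` {1..r}) \<le> m" by (rule independent_card_le_cdim(2)[OF m(2)])
  then show "r \<le> d" using m(1) card_image[OF inj] by simp
qed

section \<open>Sums over words\<close>

lemma finite_words: "finite {w :: 'n::finite list. length w = m}" "finite {w :: 'n::finite list. length w < m}"
proof -
  show *: "finite {w :: 'n::finite list. length w = m}" for m
    using finite_lists_length_eq[of "UNIV :: 'n set" m] by simp
  have "{w :: 'n list. length w < m} = (\<Union>k<m. {w. length w = k})" by auto
  then show "finite {w :: 'n::finite list. length w < m}" using * by simp
qed

lemma sum_words_Suc:
  "(\<Sum>w\<in>{w :: 'n::finite list. length w = Suc m}. f w) = (\<Sum>w\<in>{w. length w = m}. \<Sum>i\<in>UNIV. f (w @ [i]))"
proof -
  have "(\<Sum>w\<in>{w. length w = m}. \<Sum>i\<in>UNIV. f (w @ [i :: 'n])) = (\<Sum>p\<in>{w. length w = m} \<times> UNIV. f (fst p @ [snd p]))"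
    by (simp add: sum.cartesian_product case_prod_unfold)
  also have "\<dots> = (\<Sum>w\<in>{w. length w = Suc m}. f w)"
    by (rule sum.reindex_bij_witness[where j = "\<lambda>p. fst p @ [snd p]" and i = "\<lambda>w. (butlast w, last w)"])
      (auto simp: append_butlast_last_id length_Suc_conv_rev)
  finally show ?thesis by simp
qed

text \<open>Words grow on the right because the adjoint of \<open>word_op A (w @ [i])\<close> is the
  adjoint of \<open>A i\<close> applied after that of \<open>word_op A w\<close>. So f w is the
  defect lost when w is prolonged by one letter.\<close>

lemma sum_words_telescope:
  fixes f g :: "'n::finite list \<Rightarrow> 'a::ab_group_add"
  assumes "\<And>w. f w = g w - (\<Sum>i\<in>UNIV. g (w @ [i]))"
  shows "(\<Sum>w\<in>{w. length w < m}. f w) = g [] - (\<Sum>w\<in>{w. length w = m}. g w)"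
proof (induction m)
  case (Suc m)
  have "{w :: 'n list. length w < Suc m} = {w. length w < m} \<union> {w. length w = m}" by auto
  then have "(\<Sum>w\<in>{w. length w < Suc m}. f w) = (\<Sum>w\<in>{w. length w < m}. f w) + (\<Sum>w\<in>{w. length w = m}. f w)"
    by (simp add: sum.union_disjoint finite_words disjoint_iff)
  moreover have "(\<Sum>w\<in>{w. length w = m}. f w) = (\<Sum>w\<in>{w. length w = m}. g w) - (\<Sum>w\<in>{w. length w = Suc m}. g w)"
    unfolding sum_words_Suc by (simp add: assms sum_subtractf)
  ultimately show ?case by (simp add: Suc)
qed simp

lemma has_sum_words_limit:
  fixes f :: "'n::finite list \<Rightarrow> 'a::{comm_monoid_add, topological_space}"
  assumes "(f has_sum s) UNIV"
  shows "(\<lambda>m. \<Sum>w\<in>{w. length w < m}. f w) \<longlonglongrightarrow> s"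
proof -
  have "filterlim (\<lambda>m. {w :: 'n list. length w < m}) (finite_subsets_at_top UNIV) sequentially"
    unfolding filterlim_finite_subsets_at_top
  proof (intro allI impI)
    fix X :: "'n list set" assume X: "finite X \<and> X \<subseteq> UNIV"
    then have "finite (length ` X)" by simp
    then obtain N where "\<forall>w\<in>X. length w < N" using finite_nat_set_iff_bounded by auto
    then have "X \<subseteq> {w. length w < m}" if "m \<ge> N" for m using that by force
    then show "\<forall>\<^sub>F m in sequentially. finite {w :: 'n list. length w < m} \<and> X \<subseteq> {w. length w < m} \<and> {w :: 'n list. length w < m} \<subseteq> UNIV"
      using finite_words(2) by (auto simp: eventually_sequentially)
  qed
  with assms show ?thesis unfolding has_sum_def by (rule filterlim_compose)
qed

text \<open>For nonnegative terms, summation by length decides unordered summability: every finite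
  set of words lies below some length.\<close>

lemma has_sum_wordsI:
  fixes f :: "'n::finite list \<Rightarrow> real"
  assumes "\<And>w. f w \<ge> 0" and "(\<lambda>m. \<Sum>w\<in>{w. length w < m}. f w) \<longlonglongrightarrow> s"
  shows "(f has_sum s) UNIV"
proof -
  have mono: "(\<Sum>w\<in>{w. length w < m}. f w) \<le> (\<Sum>w\<in>{w. length w < k}. f w)" if "m \<le> k" for m k
    using that assms(1) by (intro sum_mono2 finite_words) auto
  have le: "(\<Sum>w\<in>{w. length w < m}. f w) \<le> s" for m
    by (rule incseq_le[OF _ assms(2)]) (auto simp: incseq_def mono)
  have "sum f F \<le> s" if "finite F" for F
  proof -
    have "finite (length ` F)" using that by simp
    then obtain N where "\<forall>w\<in>F. length w < N" using finite_nat_set_iff_bounded by auto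
    then have "sum f F \<le> (\<Sum>w\<in>{w. length w < N}. f w)" using assms(1) by (intro sum_mono2 finite_words) auto
    also note le
    finally show ?thesis .
  qed
  then have "f summable_on UNIV" using assms(1)
    by (intro nonneg_bdd_above_summable_on) (auto simp: bdd_above_def)
  then have sm: "(f has_sum infsum f UNIV) UNIV" by (rule has_sum_infsum)
  with has_sum_words_limit[OF sm] assms(2) show ?thesis using LIMSEQ_unique by blast
qed

lemma has_sum_finite_sum:
  fixes f :: "'k \<Rightarrow> 'i \<Rightarrow> 'a::topological_comm_monoid_add"
  assumes "\<And>k. k \<in> I \<Longrightarrow> (f k has_sum s k) A"
  shows "((\<lambda>i. \<Sum>k\<in>I. f k i) has_sum (\<Sum>k\<in>I. s k)) A"
  using assms by (induction I rule: infinite_finite_induct) (auto intro: has_sum_add)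

section \<open>The minimal isometric dilation of a \<open>C\<^sub>0\<close>-contraction\<close>

text \<open>Both operator conditions are evaluated on the diagonal, where they become statements
  about sums of squared norms.\<close>

lemma C0_contractionD:
  assumes A: "C0_contraction V A"
  shows "hilbert_subspace V" "A i \<in> bounded_ops V V"
    "v \<in> V \<Longrightarrow> (\<lambda>k. \<Sum>w\<in>{w. length w = k}. (norm (adj V (word_op A w) v))\<^sup>2) \<longlonglongrightarrow> 0"
    "v \<in> V \<Longrightarrow> (\<Sum>i\<in>UNIV. (norm (adj V (A i) v))\<^sup>2) \<le> (norm v)\<^sup>2"
proof -
  show V: "hilbert_subspace V" and AB: "A i \<in> bounded_ops V V" for i
    using A by (auto simp: C0_contraction_def contractive_def)
  have sq: "cinner (T (adj V T v)) v = of_real ((norm (adj V T v))\<^sup>2)" if "T \<in> bounded_ops V V" "v \<in> V" for T v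
    using adj(2)[OF V that(1), where v = "adj V T v" and y = v] adj(1)[OF V that(1), of v] by (simp add: cinner_self del: of_real_power)
  {
    assume v: "v \<in> V"
    have "(\<lambda>k. cinner (\<Sum>w\<in>{w. length w = k}. word_op A w (adj V (word_op A w) v)) v) \<longlonglongrightarrow> cinner 0 v"
      using A v unfolding C0_contraction_def limitin_wot by blast
    then have "(\<lambda>k. complex_of_real (\<Sum>w\<in>{w. length w = k}. (norm (adj V (word_op A w) v))\<^sup>2)) \<longlonglongrightarrow> of_real 0"
      by (simp add: cinner_sum_left sq[OF word_op_bounded[OF AB] v] del: of_real_power)
    then show "(\<lambda>k. \<Sum>w\<in>{w. length w = k}. (norm (adj V (word_op A w) v))\<^sup>2) \<longlonglongrightarrow> 0"
      by (simp only: tendsto_of_real_iff)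
    have "cinner (id v - (\<Sum>i\<in>UNIV. A i (adj V (A i) v))) v \<in> \<real>\<^sub>\<ge>\<^sub>0"
      using A v unfolding C0_contraction_def contractive_def op_le_def by blast
    then have "complex_of_real ((norm v)\<^sup>2 - (\<Sum>i\<in>UNIV. (norm (adj V (A i) v))\<^sup>2)) \<in> \<real>\<^sub>\<ge>\<^sub>0"
      by (simp add: cinner_diff_left cinner_sum_left sq[OF AB v] cinner_self del: of_real_power)
    then show "(\<Sum>i\<in>UNIV. (norm (adj V (A i) v))\<^sup>2) \<le> (norm v)\<^sup>2"
      by (simp only: nonneg_Reals_of_real_iff)
  }
qed

text \<open>The dilation is the Poisson transform: the components of \<open>J v\<close> at the word \<open>w\<close> are the
  coordinates of \<open>A\<^sub>w\<^sup>* v\<close> in an orthonormal family for the defect form, and telescoping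
  the defect over all words shows that \<open>J\<close> is isometric.\<close>

lemma min_isom_dilation_exists:
  fixes A :: "'n::finite \<Rightarrow> 'v::chilbert_space \<Rightarrow> 'v"
  assumes A: "C0_contraction V A" and d: "has_cdim V d"
  shows "\<exists>r J. min_isom_dilation V A (fock_sum r) (\<lambda>i. ampl r (L_op i)) J"
proof -
  note V = C0_contractionD(1)[OF A] and AB = C0_contractionD(2)[OF A]
  define As where "As i = adj V (A i)" for i
  have AsV: "As i v \<in> V" for i v unfolding As_def by (rule adj(1)[OF V AB])
  have As_lin: "As i (x + y) = As i x + As i y" "As i (c *\<^sub>C x) = c *\<^sub>C As i x" for i x y c
    unfolding As_def using bounded_opsD(2,3)[OF adj_bounded[OF V AB]] by auto
  \<comment> \<open>q is the form of the defect operator, the identity minus the sum of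
    \<open>A i \<circ> As i\<close>. It is positive semidefinite on V by contractivity and may have
    a kernel.\<close>
  define q where "q x y = cinner x y - (\<Sum>i\<in>UNIV. cinner (As i x) (As i y))" for x y
  have q_add: "q (x + y) z = q x z + q y z" for x y z
    by (simp add: q_def As_lin cinner_add_left sum.distrib)
  have q_sc: "q (c *\<^sub>C x) z = c * q x z" for x z c
    by (simp add: q_def As_lin cinner_scaleC_left sum_distrib_left right_diff_distrib)
  have q_herm: "q x y = cnj (q y x)" for x y
    by (simp add: q_def cinner_commute[of x y] cinner_commute[of "As _ x" "As _ y"])
  have q_self: "q x x = of_real ((norm x)\<^sup>2 - (\<Sum>i\<in>UNIV. (norm (As i x))\<^sup>2))" for x
    by (simp add: q_def cinner_self del: of_real_power)
  have q_pos: "0 \<le> Re (q x x)" if "x \<in> V" for x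
    using C0_contractionD(4)[OF A that] by (simp add: q_self As_def del: of_real_power)
  obtain r e where e: "r \<le> d" "\<And>k. k \<in> {1..r} \<Longrightarrow> e k \<in> V"
    "\<And>k l. k \<in> {1..r} \<Longrightarrow> l \<in> {1..r} \<Longrightarrow> q (e k) (e l) = (if k = l then 1 else 0)"
    "\<And>v. v \<in> V \<Longrightarrow> q v v = of_real (\<Sum>k=1..r. (norm (q v (e k)))\<^sup>2)"
    by (rule psd_form_orthonormal[OF d, of q, OF q_add q_sc q_herm q_pos]) auto
  \<comment> \<open>\<open>fold\<close> applies the adjoint of the first letter first, which is the
    order in which the adjoint of \<open>word_op A w\<close> acts.\<close>
  define W where "W w v = fold As w v" for w v
  have W: "W [] v = v" "W (i # w) v = W w (As i v)" "W (w @ [i]) v = As i (W w v)" for w v i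
    by (simp_all add: W_def)
  have WV: "W w v \<in> V" if "v \<in> V" for w v
    using that by (induction w arbitrary: v) (auto simp: W AsV)
  have W_lin: "W w (x + y) = W w x + W w y" "W w (c *\<^sub>C x) = c *\<^sub>C W w x" for w x y c
    by (induction w arbitrary: x y) (auto simp: W As_lin)
  have W_adj: "W w v = adj V (word_op A w) v" if "v \<in> V" for w v
    using that
  proof (induction w arbitrary: v)
    case Nil then show ?case by (auto simp: W intro!: adj_eqI[OF V, symmetric])
  next
    case (Cons i w)
    then show ?case
      unfolding word_op_simps adj_comp[OF V AB word_op_bounded[OF AB]] As_def[symmetric] W(2) using AsV by simp
  qed
  have t_sum: "((\<lambda>w. \<Sum>k=1..r. (norm (q (W w v) (e k)))\<^sup>2) has_sum (norm v)\<^sup>2) UNIV" if v: "v \<in> V" for v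
  proof (rule has_sum_wordsI)
    have "(\<Sum>k=1..r. (norm (q (W w v) (e k)))\<^sup>2) = (norm (W w v))\<^sup>2 - (\<Sum>i\<in>UNIV. (norm (W (w @ [i]) v))\<^sup>2)" for w
      using e(4)[OF WV[OF v]] unfolding q_self of_real_eq_iff W(3) by metis
    from sum_words_telescope[of "\<lambda>w. \<Sum>k=1..r. (norm (q (W w v) (e k)))\<^sup>2", OF this]
    have "(\<Sum>w\<in>{w. length w < m}. \<Sum>k=1..r. (norm (q (W w v) (e k)))\<^sup>2)
        = (norm v)\<^sup>2 - (\<Sum>w\<in>{w. length w = m}. (norm (adj V (word_op A w) v))\<^sup>2)" for m
      using v by (simp add: W(1) W_adj)
    then show "(\<lambda>m. \<Sum>w\<in>{w. length w < m}. \<Sum>k=1..r. (norm (q (W w v) (e k)))\<^sup>2) \<longlonglongrightarrow> (norm v)\<^sup>2"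
      using tendsto_diff[OF tendsto_const C0_contractionD(3)[OF A v], of "(norm v)\<^sup>2"] by simp
  qed (simp add: sum_nonneg)
  have smb: "(\<lambda>w. (norm (q (W w v) (e k)))\<^sup>2) summable_on UNIV" if v: "v \<in> V" and k: "k \<in> {1..r}" for v k
  proof (rule summable_on_comparison_test[OF has_sum_imp_summable[OF t_sum[OF v]]])
    fix w :: "'n list"
    show "(norm (q (W w v) (e k)))\<^sup>2 \<le> (\<Sum>k=1..r. (norm (q (W w v) (e k)))\<^sup>2)"
      using k by (intro member_le_sum) auto
  qed auto
  define F :: "nat \<Rightarrow> 'v \<Rightarrow> 'n fock" where "F k v = Abs_l2 (\<lambda>w. q (W w v) (e k))" for k v
  have F: "Rep_l2 (F k v) w = q (W w v) (e k)" if "v \<in> V" "k \<in> {1..r}" for v k w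
    unfolding F_def using smb[OF that] by (simp add: Abs_l2_inverse)
  define J where "J v = tuple {1..r} (\<lambda>k. F k v)" for v
  have J: "Rep_l2 (J v) k = F k v" if "k \<in> {1..r}" for v k using that by (simp add: J_def)
  have Jf: "J v \<in> fock_sum r" for v by (simp only: J_def tuple_in_fock_sum)
  have nJ: "norm (J v) = norm v" if v: "v \<in> V" for v
  proof -
    have "(\<Sum>\<^sub>\<infinity>w. (norm (q (W w v) (e k)))\<^sup>2) = (norm (F k v))\<^sup>2" if "k \<in> {1..r}" for k
      unfolding norm_l2.rep_eq F[OF v that] by (simp add: infsum_nonneg)
    then have "((\<lambda>w. (norm (q (W w v) (e k)))\<^sup>2) has_sum (norm (F k v))\<^sup>2) UNIV" if "k \<in> {1..r}" for k
      using has_sum_infsum[OF smb[OF v that]] that by simp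
    then have "((\<lambda>w. \<Sum>k=1..r. (norm (q (W w v) (e k)))\<^sup>2) has_sum (\<Sum>k=1..r. (norm (F k v))\<^sup>2)) UNIV"
      by (rule has_sum_finite_sum)
    then have "(\<Sum>k=1..r. (norm (F k v))\<^sup>2) = (norm v)\<^sup>2" using has_sum_unique[OF _ t_sum[OF v]] by blast
    moreover have "(norm (J v))\<^sup>2 = (\<Sum>k=1..r. (norm (F k v))\<^sup>2)"
      using norm_square_hsum[OF _ Jf[unfolded fock_sum_def], of v] J by simp
    ultimately show ?thesis by simp
  qed
  have "coinv_embedding V A r J"
    unfolding coinv_embedding_def
  proof (intro conjI allI ballI)
    have "J \<in> bounded_ops V (fock_sum r)"
    proof (rule bounded_opsI[where K = 1])
      fix x y c assume x: "x \<in> V"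
      show "J (c *\<^sub>C x) = c *\<^sub>C J x"
        using x hilbert_subspaceD(6)[OF V x]
        by (intro fock_sum_eqI[of _ r] Jf hilbert_subspaceD(6)[OF fock_sum_hilbert] l2_eqI)
          (simp add: J F W_lin q_sc scaleC_complex_def)
      assume y: "y \<in> V"
      show "J (x + y) = J x + J y"
        using x y hilbert_subspaceD(4)[OF V x y]
        by (intro fock_sum_eqI[of _ r] Jf hilbert_subspaceD(4)[OF fock_sum_hilbert] l2_eqI)
          (simp add: J F W_lin q_add)
    qed (auto simp: Jf nJ)
    then show "isometry_on V (fock_sum r) J" by (simp add: isometry_on_def nJ)
    fix i v k assume "v \<in> V" "k \<in> {1..r}"
    then show "Ls i (Rep_l2 (J v) k) = Rep_l2 (J (adj V (A i) v)) k"
      using AsV by (intro l2_eqI) (simp add: J F W flip: As_def)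
  qed
  moreover have "vacuum_onto V r J"
    unfolding vacuum_onto_def
  proof
    fix c :: "nat \<Rightarrow> complex"
    \<comment> \<open>The vacuum coefficient of slot k of \<open>J v\<close> is q v (e k), so the
      prescribed values c serve as coordinates in the family e.\<close>
    define v where "v = (\<Sum>l=1..r. c l *\<^sub>C e l)"
    have v: "v \<in> V" unfolding v_def using e(2) hilbert_subspaceD(6)[OF V]
      by (intro cvec.subspace_sum hilbert_subspaceD(1)[OF V]) auto
    have q0: "q 0 z = 0" for z using q_sc[of 0 0 z] by simp
    have q_sum: "q (sum f S) z = (\<Sum>s\<in>S. q (f s) z)" for f and S :: "nat set" and z
      by (induction S rule: infinite_finite_induct) (auto simp: q0 q_add)
    have "Rep_l2 (Rep_l2 (J v) k) [] = c k" if k: "k \<in> {1..r}" for k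
    proof -
      have "Rep_l2 (Rep_l2 (J v) k) [] = (\<Sum>l=1..r. c l * q (e l) (e k))"
        using v k by (simp add: J F W) (simp add: v_def q_sum q_sc)
      also have "\<dots> = (\<Sum>l\<in>{1..r}. if l = k then c l else 0)" using e(3) k by (intro sum.cong) auto
      finally show ?thesis using k by simp
    qed
    with v show "\<exists>v\<in>V. \<forall>k\<in>{1..r}. Rep_l2 (Rep_l2 (J v) k) [] = c k" by blast
  qed
  ultimately show ?thesis using coinv_embedding_minimal[OF V, of A, OF AB] by blast
qed

text \<open>The choice inside \<open>Phi\<close> is not under control; existence of some dilation
  only guarantees that the chosen pair is one.\<close>

lemma Phi_dilation:
  fixes A :: "'n::finite \<Rightarrow> 'v::chilbert_space \<Rightarrow> 'v"
  assumes "C0_contraction V A" and "has_cdim V d"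
  obtains r J where "min_isom_dilation V A (fock_sum r) (\<lambda>i. ampl r (L_op i)) J"
    "Phi V A = (\<lambda>X v. adj V J (ampl r X (J v)))"
proof -
  define P where "P = (\<lambda>(r, J). min_isom_dilation V A (fock_sum r) (\<lambda>i. ampl r (L_op i)) J)"
  obtain r J where rJ: "(SOME p. P p) = (r, J)" by fastforce
  have "\<exists>p. P p" using min_isom_dilation_exists[OF assms] by (auto simp: P_def)
  then have "P (SOME p. P p)" by (rule someI_ex)
  then have "min_isom_dilation V A (fock_sum r) (\<lambda>i. ampl r (L_op i)) J" by (simp add: rJ) (simp add: P_def)
  moreover have "Phi V A = (\<lambda>X v. adj V J (ampl r X (J v)))"
    unfolding Phi_def P_def[symmetric] rJ by simp
  ultimately show ?thesis by (rule that)
qed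

section \<open>Compressions to co-invariant subspaces of the Fock space\<close>

lemma proj_bounded:
  assumes M: "hilbert_subspace M"
  shows "proj M \<in> bounded_ops UNIV M"
proof (rule bounded_opsI[where K = 1])
  fix x y c
  show "proj M (x + y) = proj M x + proj M y" "proj M (c *\<^sub>C x) = c *\<^sub>C proj M x"
    by (intro proj_eqI M; simp add: proj[OF M] hilbert_subspaceD[OF M] cinner_add_left cinner_scaleC_left)+
  have "(norm (proj M x))\<^sup>2 = Re (cinner x (proj M x))"
    using proj(1,2)[OF M] by (metis Re_cinner_self)
  also have "\<dots> \<le> norm x * norm (proj M x)"
    using cinner_Cauchy_Schwarz complex_Re_le_cmod order_trans by blast
  finally show "norm (proj M x) \<le> 1 * norm x"
    by (cases "norm (proj M x) = 0") (auto simp: power2_eq_square)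
qed (rule proj(1)[OF M])

lemma bounded_ops_finite_sum:
  assumes "\<And>i. i \<in> I \<Longrightarrow> T i \<in> bounded_ops V W" "csubspace W"
  shows "(\<lambda>x. \<Sum>i\<in>I. T i x) \<in> bounded_ops V W"
  using assms
proof (induction I rule: infinite_finite_induct)
  case (insert i I)
  then have "(\<lambda>x. T i x + (\<Sum>i\<in>I. T i x)) \<in> bounded_ops V W" by (intro bounded_ops_add) auto
  with insert show ?case by simp
qed (auto simp: cvec.subspace_0 intro!: bounded_opsI[where K = 0])

lemma adj_id: "hilbert_subspace V \<Longrightarrow> x \<in> V \<Longrightarrow> adj V id x = x"
  by (rule adj_eqI) auto

lemma norm_fock_expand:
  "(norm f)\<^sup>2 = (norm (Rep_l2 f []))\<^sup>2 + (\<Sum>i\<in>UNIV. (norm (Ls i f))\<^sup>2)" for f :: "'n::finite fock"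
proof -
  have "cinner f f = cinner (Rep_l2 f [] *\<^sub>C \<xi> [] + (\<Sum>i\<in>UNIV. L_op i (Ls i f))) f"
    by (subst (1) fock_expand) simp
  also have "\<dots> = Rep_l2 f [] * cnj (Rep_l2 f []) + (\<Sum>i\<in>UNIV. cinner (Ls i f) (Ls i f))"
    by (simp add: cinner_add_left cinner_sum_left cinner_scaleC_left cinner_Ls(1)
        cinner_commute[of "\<xi> []"] cinner_xi)
  also have "\<dots> = of_real ((norm (Rep_l2 f []))\<^sup>2 + (\<Sum>i\<in>UNIV. (norm (Ls i f))\<^sup>2))"
    by (simp only: cinner_self complex_norm_square of_real_add of_real_sum)
  finally show ?thesis by (simp only: cinner_self of_real_eq_iff)
qed

text \<open>The sum over words of length k is the squared norm of x minus the contribution of the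
  coefficients at words shorter than k, that is, a tail of a convergent series.\<close>

lemma word_L_adj_limit:
  "(\<lambda>k. \<Sum>w\<in>{w. length w = k}. (norm (adj UNIV (word_op L_op w) x))\<^sup>2) \<longlonglongrightarrow> 0"
  for x :: "'n::finite fock"
proof -
  let ?g = "\<lambda>w. (norm (adj UNIV (word_op L_op w) x))\<^sup>2"
  have *: "Ls i (adj UNIV (word_op L_op w) x) = adj UNIV (word_op L_op (w @ [i])) x" for i w
    by (intro l2_eqI) (simp add: Rep_word_L_adj)
  have "(norm (Rep_l2 x w))\<^sup>2 = ?g w - (\<Sum>i\<in>UNIV. ?g (w @ [i]))" for w
    using norm_fock_expand[of "adj UNIV (word_op L_op w) x"] by (simp add: * Rep_word_L_adj)
  note tel = sum_words_telescope[of "\<lambda>w. (norm (Rep_l2 x w))\<^sup>2" ?g, OF this]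
  have eq: "(\<Sum>w\<in>{w. length w = k}. ?g w) = (norm x)\<^sup>2 - (\<Sum>w\<in>{w. length w < k}. (norm (Rep_l2 x w))\<^sup>2)" for k
    using tel[of k] by (simp add: adj_id)
  have "(\<Sum>\<^sub>\<infinity>w. (norm (Rep_l2 x w))\<^sup>2) = (norm x)\<^sup>2" by (simp add: norm_l2.rep_eq infsum_nonneg)
  then have "((\<lambda>w. (norm (Rep_l2 x w))\<^sup>2) has_sum (norm x)\<^sup>2) UNIV"
    using has_sum_infsum[of "\<lambda>w. (norm (Rep_l2 x w))\<^sup>2" UNIV] Rep_l2[of x] by simp
  from tendsto_diff[OF tendsto_const has_sum_words_limit[OF this], of "(norm x)\<^sup>2"]
  show ?thesis unfolding eq by simp
qed

locale coinv_subspace =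
  fixes M :: "'n::finite fock set"
  assumes M: "hilbert_subspace M" and coinv: "\<And>i m. m \<in> M \<Longrightarrow> Ls i m \<in> M"
begin

abbreviation B :: "'n \<Rightarrow> 'n fock \<Rightarrow> 'n fock" where "B i \<equiv> compression M (L_op i)"

lemma B_bounded: "B i \<in> bounded_ops M M"
  using bounded_ops_mono[OF bounded_ops_comp[OF L_op_bounded proj_bounded[OF M], of i] subset_UNIV subset_refl]
  by (simp add: compression_def[abs_def] o_def)

lemma cinner_B: "m \<in> M \<Longrightarrow> cinner (B i x) m = cinner x (Ls i m)" "m \<in> M \<Longrightarrow> cinner m (B i x) = cinner (Ls i m) x"
  by (simp_all add: compression_def proj[OF M] cinner_Ls)

text \<open>Co-invariance makes the projection disappear on the adjoint side, so that the
  compression inherits its properties from the shifts on the whole Fock space.\<close>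

lemma adj_B: "m \<in> M \<Longrightarrow> adj M (B i) m = Ls i m"
  by (intro adj_eqI M coinv cinner_B)

lemma adj_word_B: "m \<in> M \<Longrightarrow> adj M (word_op B w) m = adj UNIV (word_op L_op w) m"
proof (induction w arbitrary: m)
  case Nil then show ?case by (simp only: word_op_simps adj_id M hilbert_subspace_UNIV UNIV_I)
next
  case (Cons i w)
  have "adj UNIV (word_op L_op (i # w)) m = adj UNIV (word_op L_op w) (Ls i m)"
    by (intro l2_eqI) (simp only: Rep_word_L_adj Rep_Ls append_Cons)
  with Cons show ?case
    unfolding word_op_simps adj_comp[OF M B_bounded word_op_bounded[of B, OF B_bounded]]
    by (simp only: adj_B coinv)
qed

text \<open>On M the adjoints of words in B are those of words in the shifts. Contractivity is
  therefore the nonnegativity of the vacuum coefficient in \<open>norm_fock_expand\<close>, and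
  off-diagonal matrix coefficients are dominated by the diagonal sums that tend to 0.\<close>

lemma C0_contraction_B: "C0_contraction M B"
proof -
  have op: "op_le M (\<lambda>x. \<Sum>i\<in>UNIV. B i (adj M (B i) x)) id"
    unfolding op_le_def
  proof
    fix x assume x: "x \<in> M"
    have "cinner (id x - (\<Sum>i\<in>UNIV. B i (adj M (B i) x))) x
        = of_real ((norm x)\<^sup>2 - (\<Sum>i\<in>UNIV. (norm (Ls i x))\<^sup>2))"
      using x by (simp add: cinner_diff_left cinner_sum_left cinner_B adj_B cinner_self del: of_real_power)
    also have "\<dots> = of_real ((norm (Rep_l2 x []))\<^sup>2)" by (simp only: norm_fock_expand[of x]) simp
    finally show "cinner (id x - (\<Sum>i\<in>UNIV. B i (adj M (B i) x))) x \<in> \<real>\<^sub>\<ge>\<^sub>0"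
      by (simp only: nonneg_Reals_of_real_iff) simp
  qed
  let ?T = "\<lambda>k x. \<Sum>w\<in>{w. length w = k}. word_op B w (adj M (word_op B w) x)"
  have wB: "word_op B w \<in> bounded_ops M M" for w by (rule word_op_bounded[OF B_bounded])
  have "limitin (wot M) ?T (\<lambda>_. 0) sequentially"
    unfolding limitin_wot
  proof (intro conjI ballI)
    show "(\<lambda>_. 0) \<in> bounded_ops M M" using hilbert_subspaceD(3)[OF M] by (intro bounded_opsI[where K = 0]) auto
    have "?T k \<in> bounded_ops M M" for k
      using bounded_ops_comp[OF bounded_ops_mono[OF adj_bounded[OF M wB] subset_UNIV subset_refl] wB]
      by (intro bounded_ops_finite_sum hilbert_subspaceD(1)[OF M]) (simp add: o_def)
    then show "\<forall>\<^sub>F k in sequentially. ?T k \<in> bounded_ops M M" by simp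
    fix x y assume xy: "x \<in> M" "y \<in> M"
    let ?a = "\<lambda>w x. (norm (adj UNIV (word_op L_op w) x))\<^sup>2"
    have est: "norm (cinner (?T k x) y) \<le> (\<Sum>w\<in>{w. length w = k}. ?a w x) + (\<Sum>w\<in>{w. length w = k}. ?a w y)" for k
    proof -
      have "cinner (?T k x) y = (\<Sum>w\<in>{w. length w = k}. cinner (adj UNIV (word_op L_op w) x) (adj UNIV (word_op L_op w) y))"
        unfolding cinner_sum_left
      proof (intro sum.cong refl)
        fix w
        show "cinner (word_op B w (adj M (word_op B w) x)) y
            = cinner (adj UNIV (word_op L_op w) x) (adj UNIV (word_op L_op w) y)"
          using adj(2)[OF M wB[of w] adj(1)[OF M wB[of w], of x], of y] by (simp only: adj_word_B xy)
      qed
      also have "norm \<dots> \<le> (\<Sum>w\<in>{w. length w = k}. ?a w x + ?a w y)"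
      proof (intro order_trans[OF norm_sum] sum_mono)
        fix w
        let ?p = "norm (adj UNIV (word_op L_op w) x)" and ?q = "norm (adj UNIV (word_op L_op w) y)"
        have "norm (cinner (adj UNIV (word_op L_op w) x) (adj UNIV (word_op L_op w) y)) \<le> ?p * ?q"
          by (rule cinner_Cauchy_Schwarz)
        also have "\<dots> \<le> 2 * ?p * ?q" by simp
        also have "\<dots> \<le> ?a w x + ?a w y" by (rule sum_squares_bound)
        finally show "norm (cinner (adj UNIV (word_op L_op w) x) (adj UNIV (word_op L_op w) y)) \<le> ?a w x + ?a w y" .
      qed
      finally show ?thesis by (simp only: sum.distrib)
    qed
    have "(\<lambda>k. cinner (?T k x) y) \<longlonglongrightarrow> 0"
      by (rule Lim_null_comparison[OF always_eventually[OF allI[OF est]]])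
        (use tendsto_add[OF word_L_adj_limit[of x] word_L_adj_limit[of y]] in simp)
    then show "(\<lambda>k. cinner (?T k x) y) \<longlonglongrightarrow> cinner 0 y" by simp
  qed
  with op M B_bounded show ?thesis by (simp add: C0_contraction_def contractive_def)
qed

text \<open>The inclusion of M into one copy of the Fock space is a co-invariant embedding. One
  vector with nonzero vacuum coefficient already makes it minimal, and the defect of the single
  shift is the projection onto the vacuum line.\<close>

lemma has_pure_rank_B:
  assumes m: "m \<in> M" "Rep_l2 m [] \<noteq> 0"
  shows "has_pure_rank M B 1"
proof -
  let ?J = "l2_single (1::nat) :: 'n fock \<Rightarrow> _"
  have Jf: "?J x \<in> fock_sum 1" for x by (simp add: fock_sum_iff)
  have nJ: "norm (?J x) = norm x" for x
    by (rule norm_square_eqI) (simp add: cinner_l2_single)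
  have "coinv_embedding M B 1 ?J"
    unfolding coinv_embedding_def isometry_on_def
  proof (intro conjI allI ballI)
    show "?J \<in> bounded_ops M (fock_sum 1)"
    proof (rule bounded_opsI[where K = 1])
      show "norm (?J x) \<le> 1 * norm x" for x by (simp only: nJ mult_1 order_refl)
    qed (rule Jf, auto intro!: l2_eqI)
    show "norm (?J x) = norm x" for x by (rule nJ)
  qed (auto simp: adj_B)
  moreover have "vacuum_onto M 1 ?J"
    unfolding vacuum_onto_def
  proof
    fix c :: "nat \<Rightarrow> complex"
    have "(c 1 / Rep_l2 m []) *\<^sub>C m \<in> M" using m(1) M by (simp add: hilbert_subspaceD)
    moreover have "Rep_l2 ((c 1 / Rep_l2 m []) *\<^sub>C m) [] = c 1" using m(2) by (simp add: scaleC_complex_def)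
    ultimately show "\<exists>v\<in>M. \<forall>k\<in>{1..1}. Rep_l2 (Rep_l2 (?J v) k) [] = c k"
      by (intro bexI[of _ "(c 1 / Rep_l2 m []) *\<^sub>C m"] ballI) auto
  qed
  ultimately have D: "min_isom_dilation M B (fock_sum 1) (\<lambda>i. ampl 1 (L_op i)) ?J"
    by (rule coinv_embedding_minimal[OF M B_bounded])
  let ?z = "?J (\<xi> [])"
  define E :: "(nat, 'n fock) l2 \<Rightarrow> (nat, 'n fock) l2"
    where "E = (\<lambda>x. x - (\<Sum>i\<in>UNIV. ampl 1 (L_op i) (adj (fock_sum 1) (ampl 1 (L_op i)) x)))"
  have defect: "E x = Rep_l2 (Rep_l2 x 1) [] *\<^sub>C ?z"
    if x: "x \<in> fock_sum 1" for x
    unfolding E_def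
  proof (rule l2_eqI)
    fix k
    have "Rep_l2 x 1 - (\<Sum>i\<in>UNIV. L_op i (Ls i (Rep_l2 x 1))) = Rep_l2 (Rep_l2 x 1) [] *\<^sub>C \<xi> []"
      by (subst (1) fock_expand) simp
    then show "Rep_l2 (x - (\<Sum>i\<in>UNIV. ampl 1 (L_op i) (adj (fock_sum 1) (ampl 1 (L_op i)) x))) k
        = Rep_l2 (Rep_l2 (Rep_l2 x 1) [] *\<^sub>C ?z) k"
      using x unfolding adj_ampl_L by (cases "k = 1") (auto simp: Rep_ampl fock_sum_iff)
  qed
  have "E ` fock_sum 1 = cspan {?z}"
  proof -
    have "(\<lambda>x. Rep_l2 (Rep_l2 x 1) [] *\<^sub>C ?z) ` (fock_sum 1 :: (nat, 'n fock) l2 set) = range (\<lambda>c. c *\<^sub>C ?z)"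
    proof
      show "range (\<lambda>c. c *\<^sub>C ?z) \<subseteq> (\<lambda>x. Rep_l2 (Rep_l2 x 1) [] *\<^sub>C ?z) ` (fock_sum 1 :: (nat, 'n fock) l2 set)"
      proof clarify
        fix c
        have "c *\<^sub>C ?z \<in> fock_sum 1" by (intro hilbert_subspaceD(6)[OF fock_sum_hilbert] Jf)
        then show "c *\<^sub>C ?z \<in> (\<lambda>x. Rep_l2 (Rep_l2 x 1) [] *\<^sub>C ?z) ` (fock_sum 1 :: (nat, 'n fock) l2 set)"
          by (intro image_eqI[where x = "c *\<^sub>C ?z"]) (simp_all add: \<xi>.rep_eq scaleC_complex_def)
      qed
    qed auto
    then show ?thesis using defect by (simp add: cvec.span_singleton cong: image_cong)
  qed
  moreover have "has_cdim (cspan {?z}) 1"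
  proof -
    have "?z \<noteq> 0" using nJ[of "\<xi> []"] by auto
    then have "cindependent {?z}" unfolding cindependent_def by (simp add: cvec.dependent_single)
    then show ?thesis unfolding has_cdim_def by (intro exI[of _ "{?z}"]) simp
  qed
  ultimately have "has_cdim (E ` fock_sum 1) 1" by simp
  with D show ?thesis unfolding has_pure_rank_def E_def by blast
qed

text \<open>\<open>Phi\<close> is defined by some choice of dilation; the choice is compared with the inclusion of \<open>M\<close>
  by means of the co-invariance of the joint graph \<open>{(m, J m)}\<close>, where slot \<open>0\<close> holds \<open>m\<close>.\<close>

lemma ker_Phi_B:
  assumes fin: "has_cdim M k" and X: "X \<in> L_alg" and 0: "\<And>m. m \<in> M \<Longrightarrow> adj UNIV X m = 0"
  shows "X \<in> ker_Phi M B"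
proof -
  obtain r J where D: "min_isom_dilation M B (fock_sum r) (\<lambda>i. ampl r (L_op i)) J"
    and Phi: "Phi M B = (\<lambda>X v. adj M J (ampl r X (J v)))"
    using Phi_dilation[OF C0_contraction_B fin] by metis
  have J: "coinv_embedding M B r J" by (rule min_isom_dilation_vacuum(1)[OF fin B_bounded D])
  note JD = coinv_embeddingD[OF J]
  have XB: "X \<in> bounded_ops UNIV UNIV" using X L_alg_bounded by blast
  define G where "G m = tuple {0..r} (\<lambda>k. if k = 0 then m else Rep_l2 (J m) k)" for m
  have G: "Rep_l2 (G m) 0 = m" "k \<in> {1..r} \<Longrightarrow> Rep_l2 (G m) k = Rep_l2 (J m) k" for m k
    by (simp_all add: G_def)
  have "\<exists>l\<le>k. has_cdim (G ` M) l"
  proof (rule has_cdim_image[OF fin])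
    fix x y c assume x: "x \<in> M"
    show "G (c *\<^sub>C x) = c *\<^sub>C G x"
      using x by (intro l2_eqI) (simp add: G_def bounded_opsD[OF JD(2)])
    assume y: "y \<in> M"
    show "G (x + y) = G x + G y"
      using x y by (intro l2_eqI) (simp add: G_def bounded_opsD[OF JD(2)])
  qed
  then have GM: "hilbert_subspace (G ` M)" using has_cdim_hilbert_subspace by blast
  have LsG: "hsum_op {0..r} (\<lambda>_. Ls i) (G m) = G (Ls i m)" if "m \<in> M" for i m
    using that JD(4)[OF that] by (auto intro!: l2_eqI[of "hsum_op _ _ _"] simp: G_def adj_B simp del: Rep_Ls)
  have XG: "\<exists>t\<in>M. hsum_op {0..r} (\<lambda>_. adj UNIV X) (G m) = G t" if m: "m \<in> M" for m
  proof -
    have "hsum_op {0..r} (\<lambda>_. adj UNIV X) (G m) \<in> G ` M"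
    proof (rule coinvariant_L_alg[OF _ GM _ _ X])
      show "G ` M \<subseteq> hsum {0..r} (\<lambda>_. UNIV)" by (auto simp: G_def hsum_def)
    qed (use m LsG coinv in auto)
    then show ?thesis by blast
  qed
  have "adj M J (ampl r X (J v)) = 0" if v: "v \<in> M" for v
  proof (rule adj_eqI[OF M hilbert_subspaceD(3)[OF M]])
    fix m assume m: "m \<in> M"
    obtain t where t: "t \<in> M" "hsum_op {0..r} (\<lambda>_. adj UNIV X) (G m) = G t" using XG[OF m] by blast
    have tk: "Rep_l2 (hsum_op {0..r} (\<lambda>_. adj UNIV X) (G m)) k = Rep_l2 (G t) k" for k using t(2) by simp
    \<comment> \<open>Slot 0 determines t, and with t = 0 the other slots say that the adjoint of X
      kills all components of \<open>J m\<close>.\<close>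
    have "t = 0" using tk[of 0] 0[OF m] by (simp add: G)
    have Xm: "adj UNIV X (Rep_l2 (J m) k) = 0" if "k \<in> {1..r}" for k
      using tk[of k] that bounded_ops_zero[OF JD(2) hilbert_subspaceD(3)[OF M]] by (simp add: G_def \<open>t = 0\<close>)
    have "cinner (J m) (ampl r X (J v)) = (\<Sum>k\<in>{1..r}. cinner (adj UNIV X (Rep_l2 (J m) k)) (Rep_l2 (J v) k))"
      unfolding cinner_fock_sum[OF JD(3)[OF m]]
      by (intro sum.cong) (simp_all add: Rep_ampl adj[OF hilbert_subspace_UNIV XB])
    then show "cinner (J m) (ampl r X (J v)) = cinner m 0" using Xm by simp
  qed
  then show ?thesis using X by (simp add: ker_Phi_def Phi)
qed

end

section \<open>The model inside a single Fock space\<close>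

lemma closed_cspan_invariant:
  assumes T: "T \<in> bounded_ops UNIV UNIV" and E: "\<And>x. x \<in> E \<Longrightarrow> T x \<in> E" and x: "x \<in> closed_cspan E"
  shows "T x \<in> closed_cspan E"
proof -
  have "closed_cspan E \<subseteq> {x \<in> UNIV. T x \<in> closed_cspan E}"
  proof (rule closed_cspan_minimal)
    show "hilbert_subspace {x \<in> UNIV. T x \<in> closed_cspan E}"
      by (intro hilbert_subspace_vimage[OF T] hilbert_subspace_closed_cspan hilbert_subspace_UNIV)
    show "E \<subseteq> {x \<in> UNIV. T x \<in> closed_cspan E}" using subsetD[OF subset_closed_cspan E] by blast
  qed
  with x show ?thesis by blast
qed

text \<open>The words \<open>b a\<^sup>j\<close> have no common left multiples, so right multiplication by them embeds the
  amplified Fock space isometrically into the Fock space, intertwining the left shifts.\<close>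

locale fock_model =
  fixes V :: "'v::chilbert_space set" and A :: "'n::finite \<Rightarrow> 'v \<Rightarrow> 'v"
    and d r :: nat and J :: "'v \<Rightarrow> (nat, 'n fock) l2" and a b :: 'n
  assumes dim: "has_cdim V d" and AB: "A i \<in> bounded_ops V V"
    and J: "coinv_embedding V A r J" and onto: "vacuum_onto V r J" and ab: "a \<noteq> b"
begin

lemmas V = has_cdim_hilbert_subspace[OF dim]
lemmas JD = coinv_embeddingD[OF J]

abbreviation As :: "'n \<Rightarrow> 'v \<Rightarrow> 'v" where "As i \<equiv> adj V (A i)"

abbreviation wd :: "nat \<Rightarrow> 'n list" where "wd j \<equiv> b # replicate j a"

lemma As_in: "As i v \<in> V" by (rule adj(1)[OF V AB])

lemma cinner_As: "x \<in> V \<Longrightarrow> cinner x (As i v) = cinner (A i x) v" "x \<in> V \<Longrightarrow> cinner (As i v) x = cinner v (A i x)"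
  by (auto simp: adj[OF V AB])

lemma cinner_J: "x \<in> V \<Longrightarrow> y \<in> V \<Longrightarrow> (\<Sum>j\<in>{1..r}. cinner (Rep_l2 (J x) j) (Rep_l2 (J y) j)) = cinner x y"
  unfolding cinner_fock_sum[OF JD(3), symmetric] by (rule isometry_on_cinner[OF JD(1) V])

lemma wd_neq: "j \<noteq> k \<Longrightarrow> u @ wd j \<noteq> v @ wd k"
proof
  assume "j \<noteq> k" "u @ wd j = v @ wd k"
  \<comment> \<open>Read from the right, \<open>u @ wd j\<close> begins with exactly j letters a
    followed by b, so the word determines j.\<close>
  then have "takeWhile ((=) a) (rev (u @ wd j)) = takeWhile ((=) a) (rev (v @ wd k))" by simp
  then have "replicate j a = replicate k a" using ab by (simp add: takeWhile_append)
  with \<open>j \<noteq> k\<close> show False by (metis length_replicate)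
qed

lemma R_orthogonal: "j \<noteq> k \<Longrightarrow> cinner (R_mul (wd j) f) (R_mul (wd k) g) = 0"
  by (rule cinner_R_mul_orthogonal) (rule wd_neq)

lemma R_cinner: "cinner (R_mul (wd j) f) (R_mul (wd k) g) = (if j = k then cinner f g else 0)"
  using R_orthogonal isometry_on_cinner[OF isometry_R_mul] by auto

section \<open>The embedding of the amplification into one Fock space\<close>

definition \<Psi> :: "(nat, 'n fock) l2 \<Rightarrow> 'n fock" where
  "\<Psi> f = (\<Sum>j\<in>{1..r}. R_mul (wd j) (Rep_l2 f j))"

lemma cinner_\<Psi>: "f \<in> fock_sum r \<Longrightarrow> cinner (\<Psi> f) (\<Psi> g) = cinner f g"
  by (simp add: \<Psi>_def cinner_sum_left cinner_sum_right R_cinner cinner_fock_sum)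

lemma isometry_\<Psi>: "isometry_on (fock_sum r) UNIV \<Psi>"
proof -
  have n: "norm (\<Psi> f) = norm f" if "f \<in> fock_sum r" for f
    by (rule norm_square_eqI) (rule cinner_\<Psi>[OF that])
  have "\<Psi> \<in> bounded_ops (fock_sum r) UNIV"
  proof (rule bounded_opsI[where K = 1])
    show "norm (\<Psi> f) \<le> 1 * norm f" if "f \<in> fock_sum r" for f by (simp add: n[OF that])
  qed (auto simp: \<Psi>_def bounded_opsD[OF R_mul_bounded] sum.distrib cvec.scale_sum_right)
  with n show ?thesis by (simp add: isometry_on_def)
qed

lemma adj_R_\<Psi>: "j \<in> {1..r} \<Longrightarrow> adj UNIV (R_mul (wd j)) (\<Psi> f) = Rep_l2 f j"
  by (rule adj_eqI) (auto simp: \<Psi>_def cinner_sum_right R_cinner)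

lemma L_alg_\<Psi>:
  assumes X: "X \<in> L_alg"
  shows "X (\<Psi> f) = \<Psi> (ampl r X f)"
proof -
  have XB: "X \<in> bounded_ops UNIV UNIV" using X L_alg_bounded by blast
  have "X (R_mul w g) = R_mul w (X g)" for w g
    using R_mul_R_alg[of w] X unfolding R_alg_def by (auto simp: fun_eq_iff)
  then show ?thesis by (simp add: \<Psi>_def bounded_ops_sum[OF XB] Rep_ampl)
qed

definition U :: "'v \<Rightarrow> 'n fock" where "U v = \<Psi> (J v)"
definition S :: "'n fock set" where "S = U ` V"
definition N1 :: "'n fock set" where "N1 = \<Psi> ` fock_sum r"
definition N2 :: "'n fock set" where "N2 = N1 \<ominus> S"
definition M :: "nat \<Rightarrow> 'n fock set" where "M j = adj UNIV (R_mul (wd j)) ` S"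

lemma isometry_U: "isometry_on V S U"
proof -
  have "\<Psi> \<circ> J \<in> bounded_ops V UNIV" by (rule bounded_ops_comp[OF JD(2) isometry_onD(1)[OF isometry_\<Psi>]])
  then have "U \<in> bounded_ops V S" unfolding bounded_ops_def S_def by (auto simp: U_def)
  then show ?thesis
    using isometry_onD(2)[OF isometry_\<Psi>] isometry_onD(2)[OF JD(1)] JD(3) by (simp add: isometry_on_def U_def)
qed

lemma cinner_U: "v \<in> V \<Longrightarrow> w \<in> V \<Longrightarrow> cinner (U v) (U w) = cinner v w"
  by (rule isometry_on_cinner[OF isometry_U V])

lemma S_hilbert: "hilbert_subspace S"
  unfolding S_def by (rule isometry_on_image_hilbert[OF isometry_U V])

lemma S_subset: "S \<subseteq> N1"
  using JD(3) by (auto simp: S_def N1_def U_def)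

lemma M_eq: "j \<in> {1..r} \<Longrightarrow> M j = (\<lambda>v. Rep_l2 (J v) j) ` V"
  by (auto simp: M_def S_def U_def adj_R_\<Psi> image_image)

lemma comp_lin:
  "x \<in> V \<Longrightarrow> y \<in> V \<Longrightarrow> Rep_l2 (J (x + y)) j = Rep_l2 (J x) j + Rep_l2 (J y) j"
  "x \<in> V \<Longrightarrow> Rep_l2 (J (c *\<^sub>C x)) j = c *\<^sub>C Rep_l2 (J x) j"
  by (simp_all add: bounded_opsD[OF JD(2)])

lemma M_cdim: "j \<in> {1..r} \<Longrightarrow> \<exists>k\<le>d. has_cdim (M j) k"
  unfolding M_eq by (rule has_cdim_image[OF dim]) (auto simp: comp_lin)

lemma M_hilbert: "j \<in> {1..r} \<Longrightarrow> hilbert_subspace (M j)"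
  using M_cdim has_cdim_hilbert_subspace by blast

lemma M_coinv: "j \<in> {1..r} \<Longrightarrow> coinv_subspace (M j)"
proof
  show "j \<in> {1..r} \<Longrightarrow> hilbert_subspace (M j)" by (rule M_hilbert)
qed (auto simp: M_eq JD(4) As_in simp del: Rep_Ls)

abbreviation B :: "nat \<Rightarrow> 'n \<Rightarrow> 'n fock \<Rightarrow> 'n fock" where "B j i \<equiv> compression (M j) (L_op i)"

lemma adj_L_alg:
  assumes X: "X \<in> L_alg" and v: "v \<in> V"
  shows "\<exists>t\<in>V. \<forall>j\<in>{1..r}. adj UNIV X (Rep_l2 (J v) j) = Rep_l2 (J t) j"
proof -
  have "hsum_op {1..r} (\<lambda>_. adj UNIV X) (J v) \<in> J ` V"
  proof (rule coinvariant_L_alg[OF _ _ _ _ X])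
    show "hilbert_subspace (J ` V)" by (rule isometry_on_image_hilbert[OF JD(1) V])
    show "J ` V \<subseteq> hsum {1..r} (\<lambda>_. UNIV)" using JD(3) by (auto simp: fock_sum_def)
    fix i f assume "f \<in> J ` V"
    then obtain v where v: "v \<in> V" "f = J v" by blast
    have "hsum_op {1..r} (\<lambda>_. Ls i) (J v) = J (As i v)"
    proof (rule fock_sum_eqI)
      show "hsum_op {1..r} (\<lambda>_. Ls i) (J v) \<in> fock_sum r" by (simp only: fock_sum_iff) simp
    qed (auto simp: JD As_in v simp del: Rep_Ls)
    then show "hsum_op {1..r} (\<lambda>_. Ls i) f \<in> J ` V" using v As_in by simp
  qed (use v in auto)
  then obtain t where t: "t \<in> V" "hsum_op {1..r} (\<lambda>_. adj UNIV X) (J v) = J t" by blast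
  have "Rep_l2 (hsum_op {1..r} (\<lambda>_. adj UNIV X) (J v)) j = Rep_l2 (J t) j" for j using t(2) by simp
  then have "\<forall>j\<in>{1..r}. adj UNIV X (Rep_l2 (J v) j) = Rep_l2 (J t) j" by (metis Rep_hsum_op finite_atLeastAtMost)
  with t(1) show ?thesis ..
qed

lemma cinner_ampl_J:
  assumes X: "X \<in> L_alg" and v: "v \<in> V"
  shows "cinner (ampl r X f) (J v) = (\<Sum>j\<in>{1..r}. cinner (Rep_l2 f j) (adj UNIV X (Rep_l2 (J v) j)))"
proof -
  have XB: "X \<in> bounded_ops UNIV UNIV" using X L_alg_bounded by blast
  show ?thesis by (simp add: cinner_ampl adj[OF hilbert_subspace_UNIV XB])
qed

section \<open>The kernel of the representation and its range space\<close>

abbreviation \<Phi> :: "('n fock \<Rightarrow> 'n fock) \<Rightarrow> 'v \<Rightarrow> 'v" where "\<Phi> X v \<equiv> adj V J (ampl r X (J v))"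

definition ker\<Phi> :: "('n fock \<Rightarrow> 'n fock) set" where "ker\<Phi> = {X \<in> L_alg. \<forall>v\<in>V. \<Phi> X v = 0}"

text \<open>With t the adjoint of \<open>\<Phi> X\<close> applied to v, the square norm of t is
  \<open>cinner (\<Phi> X t) v\<close>, which is 0. Membership in the kernel thus becomes a
  statement about single vectors of one Fock space.\<close>

lemma ker_adj:
  assumes X: "X \<in> ker\<Phi>" and v: "v \<in> V" and j: "j \<in> {1..r}"
  shows "adj UNIV X (Rep_l2 (J v) j) = 0"
proof -
  have XL: "X \<in> L_alg" using X by (simp add: ker\<Phi>_def)
  obtain t where t: "t \<in> V" "\<forall>j\<in>{1..r}. adj UNIV X (Rep_l2 (J v) j) = Rep_l2 (J t) j"
    using adj_L_alg[OF XL v] by blast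
  have "cinner t t = (\<Sum>j\<in>{1..r}. cinner (Rep_l2 (J t) j) (adj UNIV X (Rep_l2 (J v) j)))"
    using cinner_J[OF t(1) t(1)] t(2) by simp
  also have "\<dots> = cinner (ampl r X (J t)) (J v)" by (rule cinner_ampl_J[OF XL v, symmetric])
  also have "\<dots> = cinner (\<Phi> X t) v" by (simp add: adj(3)[OF V JD(2) v])
  also have "\<dots> = 0" using X t(1) by (simp add: ker\<Phi>_def)
  finally show ?thesis using t j bounded_ops_zero[OF JD(2) hilbert_subspaceD(3)[OF V]] by simp
qed

lemma ker_adjI:
  assumes XL: "X \<in> L_alg" and 0: "\<And>v j. v \<in> V \<Longrightarrow> j \<in> {1..r} \<Longrightarrow> adj UNIV X (Rep_l2 (J v) j) = 0"
  shows "X \<in> ker\<Phi>"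
proof -
  have "\<Phi> X v = 0" if "v \<in> V" for v
    by (rule cinner_eqI[OF V adj(1)[OF V JD(2)] hilbert_subspaceD(3)[OF V]])
      (simp add: adj(3)[OF V JD(2)] cinner_ampl_J[OF XL] 0)
  with XL show ?thesis by (simp add: ker\<Phi>_def)
qed

lemma ker_ideal:
  assumes Y: "Y \<in> L_alg" and X: "X \<in> ker\<Phi>"
  shows "Y \<circ> X \<in> ker\<Phi>"
proof (rule ker_adjI)
  have XL: "X \<in> L_alg" using X by (simp add: ker\<Phi>_def)
  show "Y \<circ> X \<in> L_alg" by (rule L_alg_closed(3)[OF Y XL])
  fix v j assume v: "v \<in> V" and j: "j \<in> {1..r}"
  obtain t where t: "t \<in> V" "\<forall>j\<in>{1..r}. adj UNIV Y (Rep_l2 (J v) j) = Rep_l2 (J t) j"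
    using adj_L_alg[OF Y v] by blast
  have "adj UNIV (Y \<circ> X) (Rep_l2 (J v) j) = adj UNIV X (adj UNIV Y (Rep_l2 (J v) j))"
    using XL Y L_alg_bounded by (intro adj_comp) auto
  then show "adj UNIV (Y \<circ> X) (Rep_l2 (J v) j) = 0" using t j ker_adj[OF X t(1) j] by simp
qed

definition MM :: "'n fock set" where "MM = closed_cspan {X x |X x. X \<in> ker\<Phi>}"

text \<open>An element of \<open>L_alg\<close> is absorbed by the ideal \<open>ker\<Phi>\<close>,
  while an element of \<open>R_alg\<close> commutes past X and is absorbed by the argument.\<close>

lemma MM_invariant:
  assumes T: "T \<in> L_alg \<union> R_alg" and x: "x \<in> MM"
  shows "T x \<in> MM"
  unfolding MM_def
proof (rule closed_cspan_invariant[OF _ _ x[unfolded MM_def]])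
  show "T \<in> bounded_ops UNIV UNIV" using T L_alg_bounded by (auto simp: R_alg_def)
  fix y assume "y \<in> {X x |X x. X \<in> ker\<Phi>}"
  then obtain X z where X: "X \<in> ker\<Phi>" "y = X z" by blast
  from T show "T y \<in> {X x |X x. X \<in> ker\<Phi>}"
  proof
    assume "T \<in> L_alg"
    from ker_ideal[OF this X(1)] X(2) show ?thesis by (auto intro!: exI[of _ "T \<circ> X"])
  next
    assume "T \<in> R_alg"
    then have "T y = X (T z)" using X by (auto simp: R_alg_def ker\<Phi>_def fun_eq_iff)
    with X(1) show ?thesis by blast
  qed
qed

lemma MM_Lat: "MM \<in> Lat_L"
  using MM_invariant by (auto simp: Lat_L_def MM_def hilbert_subspace_closed_cspan)

lemma MM_orthogonal:
  assumes "x \<in> MM" "v \<in> V" "j \<in> {1..r}"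
  shows "cinner x (Rep_l2 (J v) j) = 0"
proof -
  have "MM \<subseteq> {x. \<forall>y\<in>{Rep_l2 (J v) j}. cinner x y = 0}"
    unfolding MM_def
  proof (rule closed_cspan_minimal[OF hilbert_subspace_ortho], clarify)
    fix X x assume X: "X \<in> ker\<Phi>"
    then have "X \<in> bounded_ops UNIV UNIV" using L_alg_bounded by (auto simp: ker\<Phi>_def)
    then have "cinner (X x) (Rep_l2 (J v) j) = cinner x (adj UNIV X (Rep_l2 (J v) j))"
      by (simp add: adj[OF hilbert_subspace_UNIV])
    then show "cinner (X x) (Rep_l2 (J v) j) = 0" using ker_adj[OF X assms(2,3)] by simp
  qed
  with assms(1) show ?thesis by blast
qed

section \<open>The semi-invariant subspace\<close>

lemma N1_Lat: "N1 \<in> Lat_L"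
proof (rule Lat_LI)
  show "hilbert_subspace N1" unfolding N1_def by (rule isometry_on_image_hilbert[OF isometry_\<Psi> fock_sum_hilbert])
  fix i f assume "f \<in> N1" then show "L_op i f \<in> N1"
    by (auto simp: N1_def L_alg_\<Psi>[OF L_op_L_alg])
qed

lemma N1_hilbert: "hilbert_subspace N1"
  using N1_Lat by (simp add: Lat_L_def)

text \<open>S is co-invariant relative to N1: for f in N1, pairing \<open>L_op i f\<close> with
  \<open>U v\<close> equals pairing f with \<open>U (As i v)\<close>. The full adjoint may leave N1,
  as \<open>Ls b\<close> sends \<open>\<xi> (wd j)\<close> to
  \<open>\<xi> (replicate j a)\<close>.\<close>

lemma N2_Lat: "N2 \<in> Lat_L"
proof (rule Lat_LI)
  show "hilbert_subspace N2" unfolding N2_def by (rule hilbert_subspace_ocompl[OF N1_hilbert])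
  fix i f assume f: "f \<in> N2"
  then obtain g where g: "g \<in> fock_sum r" "f = \<Psi> g" by (auto simp: N2_def ocompl_in_def N1_def)
  have Lf: "L_op i f = \<Psi> (ampl r (L_op i) g)" using g by (simp add: L_alg_\<Psi>[OF L_op_L_alg])
  have "cinner (L_op i f) (U v) = 0" if v: "v \<in> V" for v
  proof -
    have "cinner (L_op i f) (U v) = (\<Sum>j\<in>{1..r}. cinner (Rep_l2 g j) (Ls i (Rep_l2 (J v) j)))"
      unfolding Lf U_def by (simp add: cinner_\<Psi> cinner_ampl_J[OF L_op_L_alg v] del: Rep_Ls)
    also have "\<dots> = cinner g (J (As i v))"
      unfolding cinner_fock_sum[OF g(1)] using JD(4)[OF v] by (intro sum.cong) auto
    also have "\<dots> = cinner f (U (As i v))" unfolding U_def g(2) by (rule cinner_\<Psi>[OF g(1), symmetric])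
    also have "\<dots> = 0" using f As_in by (auto simp: N2_def ocompl_in_def S_def)
    finally show ?thesis .
  qed
  then show "L_op i f \<in> N2" unfolding N2_def ocompl_in_def S_def N1_def Lf by auto
qed

lemma S_eq: "S = N1 \<ominus> N2"
  unfolding N2_def by (rule ocompl_ocompl[OF N1_hilbert S_hilbert S_subset, symmetric])

text \<open>This is minimality of the dilation carried over by \<Psi>: a lattice element above S
  pulls back to a closed subspace containing all translates of \<open>J v\<close>.\<close>

lemma N1_eq_L_gen: "N1 = L_gen S"
proof
  show "L_gen S \<subseteq> N1" unfolding L_gen_def using N1_Lat S_subset by blast
  have D: "min_isom_dilation V A (fock_sum r) (\<lambda>i. ampl r (L_op i)) J"
    by (rule coinv_embedding_minimal[OF V AB J onto])
  show "N1 \<subseteq> L_gen S"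
    unfolding L_gen_def
  proof (intro Inter_greatest)
    fix N assume "N \<in> {N \<in> Lat_L. S \<subseteq> N}"
    then have N: "hilbert_subspace N" "S \<subseteq> N" "\<And>X x. X \<in> L_alg \<Longrightarrow> x \<in> N \<Longrightarrow> X x \<in> N" by (auto simp: Lat_L_def)
    have "closed_cspan {word_op (\<lambda>i. ampl r (L_op i)) w (J v) |w v. v \<in> V} \<subseteq> {f \<in> fock_sum r. \<Psi> f \<in> N}"
    proof (rule closed_cspan_minimal)
      show "hilbert_subspace {f \<in> fock_sum r. \<Psi> f \<in> N}"
        by (rule hilbert_subspace_vimage[OF isometry_onD(1)[OF isometry_\<Psi>] fock_sum_hilbert N(1)])
      have "\<Psi> (ampl r (word_op L_op w) (J v)) \<in> N" if "v \<in> V" for w v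
        using N(3)[OF word_L_alg, of "U v" w] N(2) that
        by (auto simp: U_def S_def L_alg_\<Psi>[OF word_L_alg])
      then show "{word_op (\<lambda>i. ampl r (L_op i)) w (J v) |w v. v \<in> V} \<subseteq> {f \<in> fock_sum r. \<Psi> f \<in> N}"
        by (auto simp: word_ampl JD(3))
    qed
    moreover have "closed_cspan {word_op (\<lambda>i. ampl r (L_op i)) w (J v) |w v. v \<in> V} = fock_sum r"
      using D unfolding min_isom_dilation_def by (elim conjE)
    ultimately show "N1 \<subseteq> N" unfolding N1_def by blast
  qed
qed

lemma N1_sum: "N1 = sum_sets {1..r} (\<lambda>j. range (R_mul (wd j)))"
proof
  show "N1 \<subseteq> sum_sets {1..r} (\<lambda>j. range (R_mul (wd j)))"
    unfolding N1_def sum_sets_def \<Psi>_def by blast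
  show "sum_sets {1..r} (\<lambda>j. range (R_mul (wd j))) \<subseteq> N1"
  proof
    fix x assume "x \<in> sum_sets {1..r} (\<lambda>j. range (R_mul (wd j)))"
    then obtain y where y: "x = (\<Sum>j\<in>{1..r}. y j)" "\<forall>j\<in>{1..r}. y j \<in> range (R_mul (wd j))"
      unfolding sum_sets_def by blast
    then have "\<forall>j\<in>{1..r}. \<exists>g. y j = R_mul (wd j) g" by blast
    from bchoice[OF this] obtain f where f: "\<And>j. j \<in> {1..r} \<Longrightarrow> y j = R_mul (wd j) (f j)" by blast
    have "x = \<Psi> (tuple {1..r} f)" unfolding \<Psi>_def y(1) by (intro sum.cong) (auto simp: f)
    then show "x \<in> N1" unfolding N1_def using tuple_in_fock_sum by blast
  qed
qed

text \<open>As the ranges are orthogonal, pairing with \<open>U v\<close> splits into pairings of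
  elements of \<open>MM\<close> with components of \<open>J v\<close>.\<close>

lemma R_MM_subset: "sum_sets {1..r} (\<lambda>j. R_mul (wd j) ` MM) \<subseteq> N2"
proof
  fix x assume "x \<in> sum_sets {1..r} (\<lambda>j. R_mul (wd j) ` MM)"
  then obtain y where y: "x = (\<Sum>j\<in>{1..r}. y j)" "\<forall>j\<in>{1..r}. y j \<in> R_mul (wd j) ` MM"
    unfolding sum_sets_def by blast
  then obtain f where f: "\<And>j. j \<in> {1..r} \<Longrightarrow> y j = R_mul (wd j) (f j)" "\<And>j. j \<in> {1..r} \<Longrightarrow> f j \<in> MM"

  proof -
    have "\<forall>j\<in>{1..r}. \<exists>g. y j = R_mul (wd j) g \<and> g \<in> MM" using y(2) by blast
    from bchoice[OF this] show ?thesis using that by blast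
  qed
  have x: "x = \<Psi> (tuple {1..r} f)" unfolding \<Psi>_def y(1) by (intro sum.cong) (auto simp: f)
  have "cinner x (U v) = 0" if v: "v \<in> V" for v
    unfolding x U_def cinner_\<Psi>[OF tuple_in_fock_sum] cinner_fock_sum[OF tuple_in_fock_sum]
    using MM_orthogonal[OF f(2) v] by (intro sum.neutral) auto
  then show "x \<in> N2" unfolding N2_def ocompl_in_def S_def N1_def x using tuple_in_fock_sum by blast
qed

lemma unitary_U: "unitary_on V S U"
  using isometry_U by (simp add: unitary_on_def) (simp add: S_def)

lemma compression_U:
  assumes X: "X \<in> L_alg" and v: "v \<in> V"
  shows "U (\<Phi> X v) = compression S X (U v)"
  unfolding compression_def
proof (rule proj_eqI[OF S_hilbert, symmetric])
  show "U (\<Phi> X v) \<in> S" using adj(1)[OF V JD(2)] by (simp add: S_def)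
  fix z assume "z \<in> S"
  then obtain w where w: "w \<in> V" "z = U w" by (auto simp: S_def)
  have "cinner (X (U v)) z = cinner (ampl r X (J v)) (J w)"
    unfolding w(2) U_def L_alg_\<Psi>[OF X] by (rule cinner_\<Psi>[OF ampl_in_fock_sum])
  also have "\<dots> = cinner (\<Phi> X v) w" by (simp add: adj(3)[OF V JD(2) w(1)])
  also have "\<dots> = cinner (U (\<Phi> X v)) z" unfolding w(2) by (rule cinner_U[OF adj(1)[OF V JD(2)] w(1), symmetric])
  finally show "cinner (X (U v)) z = cinner (U (\<Phi> X v)) z" .
qed

lemma L_gen_orthogonal:
  assumes "j \<noteq> k"
  shows "orthogonal_sets (L_gen {\<xi> (wd j)}) (L_gen {\<xi> (wd k)})"
proof -
  have "L_gen {\<xi> (wd j)} \<subseteq> range (R_mul (wd j))" for j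
    unfolding L_gen_def
  proof (rule Inter_lower)
    have "\<xi> (wd j) = R_mul (wd j) (\<xi> [])" by (simp add: R_mul_xi)
    then show "range (R_mul (wd j)) \<in> {N \<in> Lat_L. {\<xi> (wd j)} \<subseteq> N}" using range_R_mul_Lat by auto
  qed
  then show ?thesis using R_orthogonal[OF assms] unfolding orthogonal_sets_def by blast
qed

lemma M_properties:
  assumes j: "j \<in> {1..r}"
  shows "hilbert_subspace (M j)" "M j \<subseteq> UNIV \<ominus> MM" "\<forall>X\<in>L_alg. adj UNIV X ` M j \<subseteq> M j"
    "\<exists>k\<le>d. has_cdim (M j) k" "C0_contraction (M j) (B j)" "has_pure_rank (M j) (B j) 1"
    "ker\<Phi> \<subseteq> ker_Phi (M j) (B j)"
proof -
  interpret c: coinv_subspace "M j" by (rule M_coinv[OF j])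
  show "hilbert_subspace (M j)" by (rule M_hilbert[OF j])
  show fin: "\<exists>k\<le>d. has_cdim (M j) k" by (rule M_cdim[OF j])
  show "C0_contraction (M j) (B j)" by (rule c.C0_contraction_B)
  \<comment> \<open>Surjectivity of the vacuum map gives a vector of \<open>M j\<close> with nonzero
    vacuum coefficient, which excludes rank 0.\<close>
  obtain v where v: "v \<in> V" "Rep_l2 (Rep_l2 (J v) j) [] = 1"
    using onto[unfolded vacuum_onto_def, rule_format, of "\<lambda>_. 1"] j by blast
  show "has_pure_rank (M j) (B j) 1"
    by (rule c.has_pure_rank_B[of "Rep_l2 (J v) j"]) (use v M_eq[OF j] in auto)
  show "M j \<subseteq> UNIV \<ominus> MM"
    unfolding M_eq[OF j] ocompl_in_def
    using MM_orthogonal[OF _ _ j] cinner_eq_zero_commute by blast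
  show "\<forall>X\<in>L_alg. adj UNIV X ` M j \<subseteq> M j"
    unfolding M_eq[OF j] using adj_L_alg j by fastforce
  show "ker\<Phi> \<subseteq> ker_Phi (M j) (B j)"
  proof
    fix X assume X: "X \<in> ker\<Phi>"
    from fin obtain k where k: "has_cdim (M j) k" by blast
    show "X \<in> ker_Phi (M j) (B j)"
      by (rule c.ker_Phi_B[OF k]) (use X ker_adj[OF X _ j] M_eq[OF j] in \<open>auto simp: ker\<Phi>_def\<close>)
  qed
qed

section \<open>The direct sum of the compressions\<close>

abbreviation Bsum :: "'n \<Rightarrow> (nat, 'n fock) l2 \<Rightarrow> (nat, 'n fock) l2" where
  "Bsum i \<equiv> hsum_op {1..r} (\<lambda>j. B j i)"

abbreviation Bsum_adj :: "'n \<Rightarrow> (nat, 'n fock) l2 \<Rightarrow> (nat, 'n fock) l2" where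
  "Bsum_adj i \<equiv> hsum_op {1..r} (\<lambda>j. adj (M j) (B j i))"

lemma comp_in_M: "v \<in> V \<Longrightarrow> j \<in> {1..r} \<Longrightarrow> Rep_l2 (J v) j \<in> M j"
  by (auto simp: M_eq)

lemma J_in_hsum: "v \<in> V \<Longrightarrow> J v \<in> hsum {1..r} M"
  using JD(3)[of v] comp_in_M[of v] by (auto simp: hsum_def fock_sum_iff)

lemma Bsum_adj_J: "v \<in> V \<Longrightarrow> Bsum_adj i (J v) = J (As i v)"
proof (rule fock_sum_eqI)
  assume v: "v \<in> V"
  show "Bsum_adj i (J v) \<in> fock_sum r" by (simp only: fock_sum_iff) simp
  show "J (As i v) \<in> fock_sum r" by (rule JD(3)[OF As_in])
  fix j assume j: "j \<in> {1..r}"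
  interpret c: coinv_subspace "M j" by (rule M_coinv[OF j])
  show "Rep_l2 (Bsum_adj i (J v)) j = Rep_l2 (J (As i v)) j"
    using j c.adj_B[OF comp_in_M[OF v j]] JD(4)[OF v j] by simp
qed

lemma cinner_B_comp:
  assumes v: "v \<in> V" and j: "j \<in> {1..r}"
  shows "cinner (B j i m) (Rep_l2 (J v) j) = cinner m (Rep_l2 (J (As i v)) j)"
    "cinner (Rep_l2 (J v) j) (B j i m) = cinner (Rep_l2 (J (As i v)) j) m"
proof -
  interpret c: coinv_subspace "M j" by (rule M_coinv[OF j])
  show "cinner (B j i m) (Rep_l2 (J v) j) = cinner m (Rep_l2 (J (As i v)) j)"
    "cinner (Rep_l2 (J v) j) (B j i m) = cinner (Rep_l2 (J (As i v)) j) m"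
    unfolding JD(4)[OF v j, symmetric] by (rule c.cinner_B[OF comp_in_M[OF v j]])+
qed

text \<open>The isometry \<open>X\<close> of the theorem is the inverse of \<open>\<Psi>\<close>, restricted to \<open>S\<close>.\<close>

lemma exists_isometry:
  "\<exists>X. isometry_on S (hsum {1..r} M) X \<and>
     (\<forall>i. \<forall>x\<in>S. Bsum_adj i (X x) = X (adj S (compression S (L_op i)) x)) \<and>
     (\<forall>i. \<forall>x\<in>S. compression S (L_op i) x = adj S X (Bsum i (X x)))"
proof -
  define X where "X x = tuple {1..r} (\<lambda>j. adj UNIV (R_mul (wd j)) x)" for x
  have XU: "X (U v) = J v" if "v \<in> V" for v
    using that by (intro fock_sum_eqI[of _ r]) (auto simp: X_def U_def adj_R_\<Psi> JD(3) simp del: One_nat_def)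
  have RB: "adj UNIV (R_mul (wd j)) \<in> bounded_ops UNIV UNIV" for j
    by (rule adj_bounded[OF hilbert_subspace_UNIV R_mul_bounded])
  have "isometry_on S (hsum {1..r} M) X"
    unfolding isometry_on_def
  proof
    show nX: "\<forall>x\<in>S. norm (X x) = norm x"
      using XU isometry_onD(2)[OF JD(1)] isometry_onD(2)[OF isometry_U] by (auto simp: S_def)
    show "X \<in> bounded_ops S (hsum {1..r} M)"
    proof (rule bounded_opsI[where K = 1])
      show "X x \<in> hsum {1..r} M" if "x \<in> S" for x using that XU J_in_hsum by (auto simp: S_def)
    qed (use nX in \<open>auto simp: X_def bounded_opsD[OF RB] intro!: l2_eqI\<close>)
  qed
  moreover have adjS: "adj S (compression S (L_op i)) (U v) = U (As i v)" if v: "v \<in> V" for i v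
  proof (rule adj_eqI[OF S_hilbert])
    show "U (As i v) \<in> S" using As_in by (simp add: S_def)
    fix z assume "z \<in> S"
    then obtain w where w: "w \<in> V" "z = U w" by (auto simp: S_def)
    have "cinner (compression S (L_op i) z) (U v) = cinner (L_op i z) (U v)"
      unfolding compression_def by (rule proj(2)[OF S_hilbert]) (simp add: S_def v)
    also have "\<dots> = cinner (ampl r (L_op i) (J w)) (J v)"
      unfolding w(2) U_def L_alg_\<Psi>[OF L_op_L_alg] by (rule cinner_\<Psi>[OF ampl_in_fock_sum])
    also have "\<dots> = (\<Sum>j\<in>{1..r}. cinner (Rep_l2 (J w) j) (Rep_l2 (J (As i v)) j))"
      unfolding cinner_ampl_J[OF L_op_L_alg v] using JD(4)[OF v] by (intro sum.cong) auto
    also have "\<dots> = cinner z (U (As i v))" using w by (simp add: cinner_J cinner_U As_in del: One_nat_def)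
    finally show "cinner (compression S (L_op i) z) (U v) = cinner z (U (As i v))" .
  qed
  then have "\<forall>i. \<forall>x\<in>S. Bsum_adj i (X x) = X (adj S (compression S (L_op i)) x)"
    using XU Bsum_adj_J As_in by (auto simp: S_def)
  moreover have "compression S (L_op i) x = adj S X (Bsum i (X x))" if x: "x \<in> S" for i x
  proof (rule adj_eqI[OF S_hilbert, symmetric])
    show "compression S (L_op i) x \<in> S" unfolding compression_def by (rule proj(1)[OF S_hilbert])
    fix z assume z: "z \<in> S"
    then obtain w where w: "w \<in> V" "z = U w" by (auto simp: S_def)
    obtain v where v: "v \<in> V" "x = U v" using x by (auto simp: S_def)
    \<comment> \<open>In each slot \<open>B j i\<close> moves to the other side and turns the
      component of \<open>J w\<close> into that of \<open>J (As i w)\<close>; the isometry J then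
      reassembles the sum over j into one inner product.\<close>
    have "cinner (X z) (Bsum i (X x)) = (\<Sum>j\<in>{1..r}. cinner (Rep_l2 (J w) j) (B j i (Rep_l2 (J v) j)))"
      unfolding v(2) w(2) XU[OF v(1)] XU[OF w(1)] cinner_fock_sum[OF JD(3)[OF w(1)]]
      by (intro sum.cong) auto
    also have "\<dots> = (\<Sum>j\<in>{1..r}. cinner (Rep_l2 (J (As i w)) j) (Rep_l2 (J v) j))"
      using cinner_B_comp(2)[OF w(1)] by (intro sum.cong) auto
    also have "\<dots> = cinner (U (As i w)) x" using v by (simp add: cinner_J cinner_U As_in del: One_nat_def)
    also have "\<dots> = cinner (adj S (compression S (L_op i)) z) x" using adjS[OF w(1)] w(2) by simp
    also have "\<dots> = cinner z (compression S (L_op i) x)"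
    proof (rule adj(3)[OF S_hilbert _ x])
      have "proj S \<circ> L_op i \<in> bounded_ops S S"
        by (rule bounded_ops_mono[OF bounded_ops_comp[OF L_op_bounded proj_bounded[OF S_hilbert]]]) auto
      then show "compression S (L_op i) \<in> bounded_ops S S" by (simp add: compression_def[abs_def] o_def)
    qed
    finally show "cinner (X z) (Bsum i (X x)) = cinner z (compression S (L_op i) x)" .
  qed
  ultimately show ?thesis by blast
qed

lemma exists_invariant_subspace:
  "\<exists>W T. hilbert_subspace W \<and> W \<subseteq> hsum {1..r} M \<and> (\<forall>i. Bsum_adj i ` W \<subseteq> W) \<and>
     unitary_on V W T \<and> (\<forall>i. \<forall>v\<in>V. T (As i v) = Bsum_adj i (T v))"
proof (intro exI[of _ "J ` V"] exI[of _ J] conjI allI ballI)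
  show "hilbert_subspace (J ` V)" by (rule isometry_on_image_hilbert[OF JD(1) V])
  show "J ` V \<subseteq> hsum {1..r} M" using J_in_hsum by blast
  show "Bsum_adj i ` J ` V \<subseteq> J ` V" for i using Bsum_adj_J As_in by auto
  have "J \<in> bounded_ops V (J ` V)" using JD(2) unfolding bounded_ops_def by blast
  then show "unitary_on V (J ` V) J"
    using isometry_onD(2)[OF JD(1)] by (simp add: unitary_on_def isometry_on_def)
  show "v \<in> V \<Longrightarrow> J (As i v) = Bsum_adj i (J v)" for i v by (rule Bsum_adj_J[symmetric])
qed

lemma comp_bounded: "j \<in> {1..r} \<Longrightarrow> (\<lambda>v. Rep_l2 (J v) j) \<in> bounded_ops V (M j)"
  by (rule has_cdim_bounded_ops[OF dim]) (auto simp: comp_lin comp_in_M)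

text \<open>The coefficients are the component maps of J. That their squares sum to the identity is
  the isometry of J, and the formula for \<open>A i\<close> is its intertwining property in adjoint
  form.\<close>

lemma cstar_convex: "cstar_convex_comb V A {1..r} M B"
  unfolding cstar_convex_comb_def
proof (intro exI[of _ "\<lambda>j v. Rep_l2 (J v) j"] conjI ballI allI)
  fix v assume v: "v \<in> V"
  note adjJ = adj[OF V comp_bounded]
  have inV: "(\<Sum>j\<in>{1..r}. adj V (\<lambda>v. Rep_l2 (J v) j) (f j)) \<in> V" for f
    by (intro cvec.subspace_sum[OF hilbert_subspaceD(1)[OF V]] adjJ(1)) auto
  show "(\<Sum>j\<in>{1..r}. adj V (\<lambda>v. Rep_l2 (J v) j) (Rep_l2 (J v) j)) = v"
  proof (rule cinner_eqI[OF V inV v])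
    fix z assume z: "z \<in> V"
    have "cinner (\<Sum>j\<in>{1..r}. adj V (\<lambda>v. Rep_l2 (J v) j) (Rep_l2 (J v) j)) z
      = (\<Sum>j\<in>{1..r}. cinner (Rep_l2 (J v) j) (Rep_l2 (J z) j))"
      unfolding cinner_sum_left by (intro sum.cong refl) (rule adjJ(3)[OF _ z])
    then show "cinner (\<Sum>j\<in>{1..r}. adj V (\<lambda>v. Rep_l2 (J v) j) (Rep_l2 (J v) j)) z = cinner v z"
      by (simp only: cinner_J[OF v z])
  qed
  fix i
  show "A i v = (\<Sum>j\<in>{1..r}. adj V (\<lambda>v. Rep_l2 (J v) j) (B j i (Rep_l2 (J v) j)))"
  proof (rule cinner_eqI[OF V bounded_opsD(1)[OF AB v] inV])
    fix z assume z: "z \<in> V"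
    have "cinner (\<Sum>j\<in>{1..r}. adj V (\<lambda>v. Rep_l2 (J v) j) (B j i (Rep_l2 (J v) j))) z
      = (\<Sum>j\<in>{1..r}. cinner (B j i (Rep_l2 (J v) j)) (Rep_l2 (J z) j))"
      unfolding cinner_sum_left by (intro sum.cong refl) (rule adjJ(3)[OF _ z])
    also have "\<dots> = (\<Sum>j\<in>{1..r}. cinner (Rep_l2 (J v) j) (Rep_l2 (J (As i z)) j))"
      by (intro sum.cong refl) (rule cinner_B_comp(1)[OF z])
    also have "\<dots> = cinner (A i v) z" using v by (simp only: cinner_J[OF v As_in] cinner_As)
    finally show "cinner (A i v) z = cinner (\<Sum>j\<in>{1..r}. adj V (\<lambda>v. Rep_l2 (J v) j) (B j i (Rep_l2 (J v) j))) z" ..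
  qed
qed (rule comp_bounded)

text \<open>The kernel of \<open>v \<mapsto> Rep_l2 (J v) j\<close> is invariant for the adjoints, so its complement is invariant
  for the algebra generated by \<open>A\<close>; irreducibility makes the map injective, and its adjoint
  is the similarity.\<close>

lemma comp_injective:
  assumes irr: "(\<lambda>T. restrict T V) ` gen_algebra V A = (\<lambda>T. restrict T V) ` bounded_ops V V"
    and j: "j \<in> {1..r}"
  shows "inj_on (\<lambda>v. Rep_l2 (J v) j) V"
proof -
  define K where "K = {v \<in> V. Rep_l2 (J v) j \<in> {0}}"
  have K: "hilbert_subspace K" unfolding K_def
    by (rule hilbert_subspace_vimage[OF comp_bounded[OF j] V])
      (simp add: hilbert_subspace_def cvec.subspace_single_0)
  have AsK: "As i k \<in> K" if "k \<in> K" for i k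
  proof -
    have "Ls i 0 = 0" by (rule bounded_ops_zero[OF Ls_bounded]) simp
    then show ?thesis using that JD(4)[of k j i] j As_in by (auto simp: K_def)
  qed
  let ?Q = "V \<ominus> K"
  have Q: "hilbert_subspace ?Q" by (rule hilbert_subspace_ocompl[OF V])
  define \<A> where "\<A> = {T \<in> bounded_ops V V. \<forall>x\<in>?Q. T x \<in> ?Q}"
  have "unital_algebra V \<A>"
    unfolding unital_algebra_def
  proof (intro conjI ballI allI)
    fix S T c assume "S \<in> \<A>" "T \<in> \<A>"
    then show "(\<lambda>x. S x + T x) \<in> \<A>" "S \<circ> T \<in> \<A>" "(\<lambda>x. c *\<^sub>C T x) \<in> \<A>"
      unfolding \<A>_def using hilbert_subspaceD[OF Q] hilbert_subspaceD(1)[OF V]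
      by (auto intro: bounded_ops_add bounded_ops_comp bounded_ops_scaleC)
  qed (auto simp: \<A>_def bounded_ops_id)
  moreover have "A i \<in> \<A>" for i
  proof -
    have "cinner (A i x) k = 0" if "x \<in> ?Q" "k \<in> K" for x k
      using that AsK[of k i] by (simp add: cinner_As(1)[symmetric] ocompl_in_def)
    then show ?thesis using AB bounded_opsD(1)[OF AB] by (auto simp: \<A>_def ocompl_in_def)
  qed
  ultimately have gen: "gen_algebra V A \<subseteq> \<A>" unfolding gen_algebra_def by blast
  have K0: "k = 0" if k: "k \<in> K" for k
  proof -
    obtain v where v: "v \<in> V" "Rep_l2 (Rep_l2 (J v) j) [] = 1"
      using onto[unfolded vacuum_onto_def, rule_format, of "\<lambda>_. 1"] j by blast
    define p where "p = v - proj K v"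
    have pK: "proj K v \<in> K" by (rule proj(1)[OF K])
    have kV: "k \<in> V" "proj K v \<in> V" using k pK by (auto simp: K_def)
    have p: "p \<in> ?Q" using v(1) kV(2)
      by (simp add: p_def ocompl_in_def hilbert_subspaceD[OF V] cinner_diff_left proj(2)[OF K])
    have "p \<noteq> 0" using v(2) pK by (auto simp: p_def K_def)
    \<comment> \<open>p is nonzero because v has a nonzero j-th component and so lies outside K. The
      rank-one operator sends p, which is orthogonal to K, to a nonzero multiple of k in K; an
      operator that preserves the complement of K can do so only if k = 0.\<close>
    define T0 where "T0 x = cinner x p *\<^sub>C k" for x
    have "T0 \<in> bounded_ops V V"
      using kV by (intro has_cdim_bounded_ops[OF dim])
        (auto simp: T0_def cinner_add_left cinner_scaleC_left scaleC_add_left scaleC_scaleC hilbert_subspaceD[OF V])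
    then obtain T where T: "T \<in> gen_algebra V A" "restrict T0 V = restrict T V"
      using irr by (metis (no_types, lifting) imageE imageI)
    have pV: "p \<in> V" using p by (simp add: ocompl_in_def)
    have "T0 p = T p" using fun_cong[OF T(2), of p] pV by simp
    moreover have "T p \<in> ?Q" using T(1) gen p by (auto simp: \<A>_def)
    ultimately have "cinner (T0 p) k = 0" using k by (simp add: ocompl_in_def)
    then have "cinner p p * cinner k k = 0" by (simp only: T0_def cinner_scaleC_left)
    with \<open>p \<noteq> 0\<close> show ?thesis by simp
  qed
  show ?thesis
  proof (rule inj_onI)
    fix x y assume xy: "x \<in> V" "y \<in> V" "Rep_l2 (J x) j = Rep_l2 (J y) j"
    then have "x - y \<in> K"
      by (simp add: K_def hilbert_subspaceD[OF V] bounded_ops_diff[OF comp_bounded[OF j] V])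
    then show "x = y" using K0[of "x - y"] by simp
  qed
qed

lemma irreducible_similar:
  assumes irr: "(\<lambda>T. restrict T V) ` gen_algebra V A = (\<lambda>T. restrict T V) ` bounded_ops V V"
    and j: "j \<in> {1..r}"
  shows "has_cdim (M j) d" "similar_tuples (M j) (B j) V A"
proof -
  let ?c = "\<lambda>v. Rep_l2 (J v) j"
  note inj = comp_injective[OF irr j] and cB = comp_bounded[OF j]
  have Mj: "M j = ?c ` V" by (rule M_eq[OF j])
  show dimM: "has_cdim (M j) d" unfolding Mj by (rule has_cdim_inj_image[OF dim _ _ inj]) (auto simp: comp_lin)
  note Mh = M_hilbert[OF j]
  define T where "T = adj V ?c"
  have TB: "T \<in> bounded_ops (M j) V" unfolding T_def
    by (rule bounded_ops_mono[OF adj_bounded[OF V cB]]) auto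
  have cT: "cinner v (T m) = cinner (?c v) m" if "v \<in> V" for v m
    unfolding T_def by (rule adj(2)[OF V cB that])
  have inj_T: "inj_on T (M j)"
  proof (rule inj_onI)
    fix x y assume xy: "x \<in> M j" "y \<in> M j" "T x = T y"
    have "cinner m x = cinner m y" if "m \<in> M j" for m
      using that cT[of _ x] cT[of _ y] xy(3) unfolding Mj by auto
    then have "cinner x m = cinner y m" if "m \<in> M j" for m using that by (metis cinner_commute)
    then show "x = y" by (rule cinner_eqI[OF Mh xy(1,2)])
  qed
  have TM: "has_cdim (T ` M j) d"
    by (rule has_cdim_inj_image[OF dimM _ _ inj_T]) (auto simp: bounded_opsD[OF TB])
  \<comment> \<open>A vector orthogonal to the range of T is killed by the component map, which is
    injective.\<close>
  have onto_T: "T ` M j = V"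
  proof (rule hilbert_subspace_eqI[OF V has_cdim_hilbert_subspace[OF TM]])
    show "T ` M j \<subseteq> V" using bounded_opsD(1)[OF TB] by blast
    fix x assume x: "x \<in> V" "\<And>y. y \<in> T ` M j \<Longrightarrow> cinner x y = 0"
    have "cinner (?c x) (?c x) = 0" using x(2)[of "T (?c x)"] cT[OF x(1)] comp_in_M[OF x(1) j] by simp
    then have "?c x = ?c 0" using bounded_ops_zero[OF cB hilbert_subspaceD(3)[OF V]] by simp
    then show "x = 0" using inj x(1) hilbert_subspaceD(3)[OF V] by (auto dest: inj_onD)
  qed
  define T' where "T' = inv_into (M j) T"
  have T'T: "T' (T m) = m" if "m \<in> M j" for m using inj_T that by (simp add: T'_def)
  have T'M: "T' v \<in> M j" and TT': "T (T' v) = v" if "v \<in> V" for v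
    using that onto_T unfolding T'_def by (auto intro: inv_into_into f_inv_into_f)
  have T'_eq: "T' v = m" if "v \<in> V" "m \<in> M j" "T m = v" for v m
    using that T'T by blast
  have "T' \<in> bounded_ops V (M j)"
  proof (rule has_cdim_bounded_ops[OF dim _ _ T'M])
    fix x y c assume x: "x \<in> V"
    show "T' (c *\<^sub>C x) = c *\<^sub>C T' x"
      using x by (intro T'_eq) (auto simp: hilbert_subspaceD[OF V] hilbert_subspaceD[OF Mh] T'M TT' bounded_opsD[OF TB])
    assume y: "y \<in> V"
    show "T' (x + y) = T' x + T' y"
      using x y by (intro T'_eq) (auto simp: hilbert_subspaceD[OF V] hilbert_subspaceD[OF Mh] T'M TT' bounded_opsD[OF TB])
  qed
  moreover have "T (B j i m) = A i (T m)" if m: "m \<in> M j" for i m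
  proof (rule cinner_eqI[OF V])
    interpret c: coinv_subspace "M j" by (rule M_coinv[OF j])
    show "T (B j i m) \<in> V" "A i (T m) \<in> V"
      using m bounded_opsD(1)[OF TB] bounded_opsD(1)[OF c.B_bounded] bounded_opsD(1)[OF AB] by auto
    fix v assume v: "v \<in> V"
    have TmV: "T m \<in> V" by (rule bounded_opsD(1)[OF TB m])
    have "cinner v (T (B j i m)) = cinner (?c (As i v)) m" by (simp only: cT[OF v] cinner_B_comp(2)[OF v j])
    also have "\<dots> = cinner v (A i (T m))" by (simp only: cT[OF As_in, symmetric] cinner_As(2)[OF TmV])
    finally show "cinner (T (B j i m)) v = cinner (A i (T m)) v" by (metis cinner_commute)
  qed
  ultimately show "similar_tuples (M j) (B j) V A"
    unfolding similar_tuples_def using TB T'T TT' by (intro exI[of _ T] exI[of _ T']) blast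
qed

end

theorem theorem7p6:
  fixes V :: "'v::chilbert_space set"
    and A :: "'n::finite \<Rightarrow> 'v \<Rightarrow> 'v"
    and d :: nat
  assumes n: "CARD('n) \<ge> 2"
    and d: "d \<ge> 1"
    and V: "has_cdim V d"
    and A: "C0_contraction V A"
  defines "\<JJ> \<equiv> ker_Phi V A"
  defines "\<M> \<equiv> closed_cspan {X x |X x. X \<in> \<JJ>}"
  shows
    "\<M> \<in> Lat_L \<and> (\<forall>T\<in>R_alg. T ` \<M> \<subseteq> \<M>) \<and>
     (\<exists>\<S> N1 N2 U.
        N1 \<in> Lat_L \<and> N2 \<in> Lat_L \<and> N2 \<subseteq> N1 \<and> \<S> = N1 \<ominus> N2 \<and>
        N1 = L_gen \<S> \<and> N2 = N1 \<ominus> \<S> \<and>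
        unitary_on V \<S> U \<and>
        (\<forall>X\<in>L_alg. \<forall>v\<in>V. U (Phi V A X v) = compression \<S> X (U v)) \<and>
        (\<exists>s \<zeta>.
           s \<le> d \<and>
           (\<forall>j\<in>{1..s}. norm (\<zeta> j) = 1 \<and> wandering (\<zeta> j)) \<and>
           (\<forall>j\<in>{1..s}. \<forall>k\<in>{1..s}. j \<noteq> k \<longrightarrow>
              orthogonal_sets (L_gen {\<zeta> j}) (L_gen {\<zeta> k})) \<and>
           N1 = sum_sets {1..s} (\<lambda>j. range (R_op (\<zeta> j))) \<and>
           sum_sets {1..s} (\<lambda>j. R_op (\<zeta> j) ` \<M>) \<subseteq> N2 \<and>
           (let M = (\<lambda>j. adj UNIV (R_op (\<zeta> j)) ` \<S>);
                B = (\<lambda>j i. compression (M j) (L_op i));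
                Bsum = (\<lambda>i. hsum_op {1..s} (\<lambda>j. B j i));
                Bsum_adj = (\<lambda>i. hsum_op {1..s} (\<lambda>j. adj (M j) (B j i)))
            in
              (\<forall>j\<in>{1..s}.
                 hilbert_subspace (M j) \<and> M j \<subseteq> UNIV \<ominus> \<M> \<and>
                 (\<forall>X\<in>L_alg. adj UNIV X ` M j \<subseteq> M j) \<and>
                 (\<exists>k\<le>d. has_cdim (M j) k) \<and>
                 C0_contraction (M j) (B j) \<and> has_pure_rank (M j) (B j) 1 \<and>
                 \<JJ> \<subseteq> ker_Phi (M j) (B j)) \<and>
              (\<exists>X. isometry_on \<S> (hsum {1..s} M) X \<and>
                 (\<forall>i. \<forall>x\<in>\<S>. Bsum_adj i (X x) = X (adj \<S> (compression \<S> (L_op i)) x)) \<and>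
                 (\<forall>i. \<forall>x\<in>\<S>. compression \<S> (L_op i) x = adj \<S> X (Bsum i (X x)))) \<and>
              (\<exists>W T. hilbert_subspace W \<and> W \<subseteq> hsum {1..s} M \<and> (\<forall>i. Bsum_adj i ` W \<subseteq> W) \<and>
                 unitary_on V W T \<and>
                 (\<forall>i. \<forall>v\<in>V. T (adj V (A i) v) = Bsum_adj i (T v))) \<and>
              cstar_convex_comb V A {1..s} M B \<and>
              ((\<lambda>T. restrict T V) ` gen_algebra V A = (\<lambda>T. restrict T V) ` bounded_ops V V \<longrightarrow>
                 (\<forall>j\<in>{1..s}. has_cdim (M j) d \<and> similar_tuples (M j) (B j) V A)))))"
proof -
  \<comment> \<open>The model has to start from the dilation selected inside \<open>Phi\<close>, so
    that \<JJ> is literally \<open>fm.ker\<Phi>\<close>.\<close>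
  obtain r J where D: "min_isom_dilation V A (fock_sum r) (\<lambda>i. ampl r (L_op i)) J"
    and Phi: "Phi V A = (\<lambda>X v. adj V J (ampl r X (J v)))"
    using Phi_dilation[OF A V] by metis
  note AB = C0_contractionD(2)[OF A]
  note vac = min_isom_dilation_vacuum[OF V AB D]
  have "\<not> is_singleton (UNIV :: 'n set)" using n by (auto simp: is_singleton_altdef)
  then obtain a b :: 'n where ab: "a \<noteq> b" by (metis UNIV_I UNIV_not_empty is_singletonI')
  interpret fm: fock_model V A d r J a b by unfold_locales (fact V AB vac ab)+
  define \<zeta> where "\<zeta> j = \<xi> (b # replicate j a)" for j
  have JJ: "\<JJ> = fm.ker\<Phi>" unfolding \<JJ>_def ker_Phi_def fm.ker\<Phi>_def Phi ..
  have MM: "\<M> = fm.MM" unfolding \<M>_def fm.MM_def JJ ..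
  have R: "R_op (\<zeta> j) = R_mul (b # replicate j a)" for j unfolding \<zeta>_def by (rule R_op_xi)
  have M: "(\<lambda>j. adj UNIV (R_mul (b # replicate j a)) ` fm.S) = fm.M"
    by (rule ext) (rule fm.M_def[symmetric])
  show ?thesis
    unfolding JJ MM
    apply (intro conjI)
      apply (rule fm.MM_Lat)
     apply (use fm.MM_invariant in blast)
    apply (rule exI[of _ fm.S], rule exI[of _ fm.N1], rule exI[of _ fm.N2], rule exI[of _ fm.U])
    apply (intro conjI)
            apply (rule fm.N1_Lat)
           apply (rule fm.N2_Lat)
          apply (simp add: fm.N2_def ocompl_in_def)
         apply (rule fm.S_eq)
        apply (rule fm.N1_eq_L_gen)
       apply (rule fm.N2_def)
      apply (rule fm.unitary_U)
     apply (simp add: Phi fm.compression_U)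
    apply (rule exI[of _ r], rule exI[of _ \<zeta>])
    unfolding R M Let_def
    apply (intro conjI)
             apply (rule vac(3))
            apply (simp add: \<zeta>_def wandering_xi)
           apply (simp add: \<zeta>_def fm.L_gen_orthogonal)
          apply (rule fm.N1_sum)
         apply (rule fm.R_MM_subset)
        apply (rule ballI, intro conjI fm.M_properties; assumption)
       apply (rule fm.exists_isometry)
      apply (rule fm.exists_invariant_subspace)
     apply (rule fm.cstar_convex)
    apply (intro impI ballI conjI; rule fm.irreducible_similar; assumption)
    done
qed

end
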